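(* Assume the hypotheses [Dynamics], [Running cost] and [Terminal cost] stated in the context, that $g$ is locally semiconcave and that the value function $V$ is continuous. Let $x\in\mathcal R\setminus\mathcal S$ and let $u^*(\cdot)$ be an optimal control steering $x$ to $x^*=y^{x,u^*}(\tau^* )\in\partial\mathcal S$, where $\tau^*=\tau^{x,u^*}$. (i) Let $q^*\in D^+g(x^* )$ and $\xi^*\in N_1(x^* )$ be such that $H(x^*,p^* )=0$ with $p^*=q^*-\xi^*$. If $p(\cdot)$ is the solution of $$p'(t)=-D_x^{T}f(y^{x,u^*}(t),u^*(t))\,p(t)-D_xr(y^{x,u^*}(t),u^*(t)),\qquad p(\tau^* )=p^*,$$ then for a.e. $t\in[0,\tau^*]$ $$H(y^{x,u^*}(t),p(t))=-p(t)\cdot f\big(y^{x,u^*}(t),u^*(t)\big)-r\big(y^{x,u^*}(t),u^*(t)\big)=0.$$ (ii) Let $\xi^*\in N_0(x^* )$ and let $p(\cdot)$ be the solution of $$p'(t)=-D_x^{T}f(y^{x,u^*}(t),u^*(t))\,p(t),\qquad p(\tau^* )=-\xi^*.$$ Then for a.e. $t\in[0,\tau^*]$ $$H^0(y^{x,u^*}(t),p(t))=-p(t)\cdot f\big(y^{x,u^*}(t),u^*(t)\big)=0.$$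
   Context: Setting. $U\subset\mathbb{R}^m$ is nonempty and compact, $\mathcal S\subseteq\mathbb{R}^d$ is nonempty and closed (the target), $\mathcal S^c=\mathbb{R}^d\setminus\mathcal S$, and $f:\mathbb{R}^d\times U\to\mathbb{R}^d$, $r:\mathbb{R}^d\times U\to\mathbb{R}$, $g:\mathbb{R}^d\to\mathbb{R}$ are given. For $x\in\mathbb{R}^d$ and a measurable control $u:[0,\infty)\to U$, $y^{x,u}$ is the Carath\'eodory solution of $y'(s)=f(y(s),u(s))$, $y(0)=x$, and $\tau^{x,u}=\min\{t\ge 0:y^{x,u}(t)\in\mathcal S\}$ ($+\infty$ if $\mathcal S$ is never reached). The value function is $V(x)=\inf_u\big(\int_0^{\tau^{x,u}}r(y^{x,u}(s),u(s))\,ds+g(y^{x,u}(\tau^{x,u}))\big)$, the infimum being over measurable controls with $\tau^{x,u}<\infty$ ($V(x)=+\infty$ if there are none). $\mathcal R=\{x:\tau^{x,u}<\infty\text{ for some }u\}$. "$V$ is continuous" means continuous on $\mathcal R$. A control $u^*$ is optimal for $x$ if $\tau^{x,u^*}<\infty$ and it attains the infimum. $H(x,p)=\max_{\omega\in U}\{-p\cdot f(x,\omega)-r(x,\omega)\}$ and $H^0(x,p)=\max_{\omega\in U}\{-p\cdot f(x,\omega)\}$. Hypotheses (with constants $N,L,r_0>0$). [Dynamics] $f$ is continuous, $|f|<N$; $D_xf$ exists everywhere and is continuous in $(x,u)$; $|f(y,\omega)-f(x,\omega)|\le L|y-x|$ and $|D_xf(y,\omega)-D_xf(x,\omega)|\le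 L|y-x|$ for all $x,y\in\mathbb{R}^d$, $\omega\in U$. [Running cost] $r$ is continuous and differentiable in $x$, $D_xr$ is continuous, $|r(y,\omega)-r(x,\omega)|+|D_xr(y,\omega)-D_xr(x,\omega)|\le L|y-x|$ for all $x,y,\omega$, and $r(x,\omega)\ge r_0$ for all $x,\omega$. [Terminal cost] There are a neighborhood $\mathcal N$ of $\partial\mathcal S$ and $0\le G<r_0/N$ with $|g(y)-g(x)|\le G|y-x|$ for $x,y\in\mathcal N$. Notions. For a closed set $Q$ and $x\in Q$, $v\in N^P_Q(x)$ iff there is $\sigma\ge0$ with $v\cdot(y-x)\le\sigma|y-x|^2$ for all $y\in Q$. $N_0(x^* )=\{0\ne\xi\in N^P_{\overline{\mathcal S^c}}(x^* ):\max_{\omega\in U}\xi\cdot f(x^*,\omega)=0\}$, $N_1(x^* )=\{\xi\in N^P_{\overline{\mathcal S^c}}(x^* ):\max_{\omega\in U}\xi\cdot f(x^*,\omega)>0\}$. $g$ is locally semiconcave if every point has a ball $B$ and $c>0$ with $(1-\lambda)g(x_0)+\lambda g(x_1)-g((1-\lambda)x_0+\lambda x_1)\le c\lambda(1-\lambda)|x_0-x_1|^2$ for $x_0,x_1\in B$, $\lambda\in[0,1]$. $D^+g(x)=\{p:\limsup_{y\to x}\frac{g(y)-g(x)-p\cdot(y-x)}{|y-x|}\le0\}$. *)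

theory Defs
  imports "HOL-Analysis.Analysis"
begin

section \<open>Dynamics, controls and trajectories\<close>

definition absolutely_continuous_on_interval ::
    "real \<Rightarrow> real \<Rightarrow> (real \<Rightarrow> 'a::real_normed_vector) \<Rightarrow> bool" where
  "absolutely_continuous_on_interval a b y \<longleftrightarrow>
     (\<forall>\<epsilon>>0. \<exists>\<delta>>0. \<forall>\<I>. finite \<I> \<longrightarrow>
        (\<forall>(s, t)\<in>\<I>. a \<le> s \<and> s \<le> t \<and> t \<le> b) \<longrightarrow>
        pairwise (\<lambda>(s, t) (s', t'). {s<..<t} \<inter> {s'<..<t'} = {}) \<I> \<longrightarrow>
        (\<Sum>(s, t)\<in>\<I>. t - s) < \<delta> \<longrightarrow>
        (\<Sum>(s, t)\<in>\<I>. norm (y t - y s)) < \<epsilon>)"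

text \<open>Caratheodory solutions of \<open>y' t = F t (y t)\<close> on an interval. The values of
  the total function \<open>y\<close> outside \<open>I\<close> play no role.\<close>

definition caratheodory_solution ::
    "real set \<Rightarrow> (real \<Rightarrow> 'a::real_normed_vector \<Rightarrow> 'a) \<Rightarrow> (real \<Rightarrow> 'a) \<Rightarrow> bool" where
  "caratheodory_solution I F y \<longleftrightarrow>
     (\<forall>a b. a \<le> b \<longrightarrow> {a..b} \<subseteq> I \<longrightarrow> absolutely_continuous_on_interval a b y) \<and>
     (AE t in lebesgue_on I. (y has_vector_derivative F t (y t)) (at t within I))"

definition admissible_control :: "(real ^ 'm) set \<Rightarrow> (real \<Rightarrow> real ^ 'm) \<Rightarrow> bool" where
  "admissible_control U u \<longleftrightarrow>
     u \<in> borel_measurable (lebesgue_on {0..}) \<and> (\<forall>t\<ge>0. u t \<in> U)"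

text \<open>\<open>y\<close> is the trajectory of the control \<open>u\<close> from \<open>x\<close>. Under the standing hypotheses it
  exists and is unique on \<open>{0..}\<close>, so the relation stands for the usual notation \<open>y\<^bsub>x,u\<^esub>\<close>.\<close>

definition trajectory ::
    "(real ^ 'd \<Rightarrow> real ^ 'm \<Rightarrow> real ^ 'd) \<Rightarrow> real ^ 'd \<Rightarrow> (real \<Rightarrow> real ^ 'm)
      \<Rightarrow> (real \<Rightarrow> real ^ 'd) \<Rightarrow> bool" where
  "trajectory f x u y \<longleftrightarrow> y 0 = x \<and> caratheodory_solution {0..} (\<lambda>s z. f z (u s)) y"

text \<open>For closed \<open>S\<close> and continuous \<open>y\<close> the infimum is a minimum whenever \<open>S\<close> is reached;
  it is \<open>\<infinity>\<close> otherwise.\<close>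

definition hitting_time :: "'a set \<Rightarrow> (real \<Rightarrow> 'a) \<Rightarrow> ereal" where
  "hitting_time S y = (INF t\<in>{t. 0 \<le> t \<and> y t \<in> S}. ereal t)"

definition reachable_set ::
    "(real ^ 'd \<Rightarrow> real ^ 'm \<Rightarrow> real ^ 'd) \<Rightarrow> (real ^ 'm) set \<Rightarrow> (real ^ 'd) set
      \<Rightarrow> (real ^ 'd) set" where
  "reachable_set f U S =
     {x. \<exists>u y. admissible_control U u \<and> trajectory f x u y \<and> hitting_time S y < \<infinity>}"

section \<open>Cost and value function\<close>

text \<open>Meaningful only if the hitting time is finite.\<close>

definition total_cost ::
    "(real ^ 'd \<Rightarrow> real ^ 'm \<Rightarrow> real) \<Rightarrow> (real ^ 'd \<Rightarrow> real) \<Rightarrow> (real ^ 'd) set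
      \<Rightarrow> (real \<Rightarrow> real ^ 'm) \<Rightarrow> (real \<Rightarrow> real ^ 'd) \<Rightarrow> real" where
  "total_cost r g S u y =
     (let \<tau> = real_of_ereal (hitting_time S y)
      in (LINT s:{0..\<tau>}|lebesgue. r (y s) (u s)) + g (y \<tau>))"

definition value_function ::
    "(real ^ 'd \<Rightarrow> real ^ 'm \<Rightarrow> real ^ 'd) \<Rightarrow> (real ^ 'd \<Rightarrow> real ^ 'm \<Rightarrow> real)
      \<Rightarrow> (real ^ 'd \<Rightarrow> real) \<Rightarrow> (real ^ 'm) set \<Rightarrow> (real ^ 'd) set \<Rightarrow> real ^ 'd \<Rightarrow> ereal" where
  "value_function f r g U S x =
     Inf {ereal (total_cost r g S u y) | u y.
            admissible_control U u \<and> trajectory f x u y \<and> hitting_time S y < \<infinity>}"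

definition optimal_pair ::
    "(real ^ 'd \<Rightarrow> real ^ 'm \<Rightarrow> real ^ 'd) \<Rightarrow> (real ^ 'd \<Rightarrow> real ^ 'm \<Rightarrow> real)
      \<Rightarrow> (real ^ 'd \<Rightarrow> real) \<Rightarrow> (real ^ 'm) set \<Rightarrow> (real ^ 'd) set \<Rightarrow> real ^ 'd
      \<Rightarrow> (real \<Rightarrow> real ^ 'm) \<Rightarrow> (real \<Rightarrow> real ^ 'd) \<Rightarrow> bool" where
  "optimal_pair f r g U S x u y \<longleftrightarrow>
     admissible_control U u \<and> trajectory f x u y \<and> hitting_time S y < \<infinity> \<and>
     ereal (total_cost r g S u y) = value_function f r g U S x"

text \<open>The suprema in the Hamiltonians are maxima, as \<open>U\<close> is nonempty and compact and the
  data are continuous in the control.\<close>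

definition hamiltonian ::
    "(real ^ 'd \<Rightarrow> real ^ 'm \<Rightarrow> real ^ 'd) \<Rightarrow> (real ^ 'd \<Rightarrow> real ^ 'm \<Rightarrow> real)
      \<Rightarrow> (real ^ 'm) set \<Rightarrow> real ^ 'd \<Rightarrow> real ^ 'd \<Rightarrow> real" where
  "hamiltonian f r U x p = (SUP \<omega>\<in>U. - (p \<bullet> f x \<omega>) - r x \<omega>)"

definition hamiltonian0 ::
    "(real ^ 'd \<Rightarrow> real ^ 'm \<Rightarrow> real ^ 'd) \<Rightarrow> (real ^ 'm) set
      \<Rightarrow> real ^ 'd \<Rightarrow> real ^ 'd \<Rightarrow> real" where
  "hamiltonian0 f U x p = (SUP \<omega>\<in>U. - (p \<bullet> f x \<omega>))"

section \<open>Standing hypotheses\<close>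

text \<open>\<open>Df x \<omega>\<close> is the Jacobian matrix of \<open>\<lambda>z. f z \<omega>\<close> at \<open>x\<close>; differences of Jacobians
  are measured in the operator norm.\<close>

definition dynamics_hyp ::
    "(real ^ 'm) set \<Rightarrow> (real ^ 'd \<Rightarrow> real ^ 'm \<Rightarrow> real ^ 'd)
      \<Rightarrow> (real ^ 'd \<Rightarrow> real ^ 'm \<Rightarrow> real ^ 'd ^ 'd) \<Rightarrow> real \<Rightarrow> real \<Rightarrow> bool" where
  "dynamics_hyp U f Df N L \<longleftrightarrow>
     continuous_on (UNIV \<times> U) (\<lambda>(x, \<omega>). f x \<omega>) \<and>
     (\<forall>x. \<forall>\<omega>\<in>U. norm (f x \<omega>) < N) \<and>
     (\<forall>x. \<forall>\<omega>\<in>U. ((\<lambda>z. f z \<omega>) has_derivative (\<lambda>h. Df x \<omega> *v h)) (at x)) \<and>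
     continuous_on (UNIV \<times> U) (\<lambda>(x, \<omega>). Df x \<omega>) \<and>
     (\<forall>x y. \<forall>\<omega>\<in>U. norm (f y \<omega> - f x \<omega>) \<le> L * norm (y - x)) \<and>
     (\<forall>x y. \<forall>\<omega>\<in>U. onorm (\<lambda>h. (Df y \<omega> - Df x \<omega>) *v h) \<le> L * norm (y - x))"

text \<open>\<open>Dr x \<omega>\<close> is the gradient of \<open>\<lambda>z. r z \<omega>\<close> at \<open>x\<close>.\<close>

definition running_cost_hyp ::
    "(real ^ 'm) set \<Rightarrow> (real ^ 'd \<Rightarrow> real ^ 'm \<Rightarrow> real)
      \<Rightarrow> (real ^ 'd \<Rightarrow> real ^ 'm \<Rightarrow> real ^ 'd) \<Rightarrow> real \<Rightarrow> real \<Rightarrow> bool" where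
  "running_cost_hyp U r Dr L r\<^sub>0 \<longleftrightarrow>
     continuous_on (UNIV \<times> U) (\<lambda>(x, \<omega>). r x \<omega>) \<and>
     (\<forall>x. \<forall>\<omega>\<in>U. ((\<lambda>z. r z \<omega>) has_derivative (\<lambda>h. Dr x \<omega> \<bullet> h)) (at x)) \<and>
     continuous_on (UNIV \<times> U) (\<lambda>(x, \<omega>). Dr x \<omega>) \<and>
     (\<forall>x y. \<forall>\<omega>\<in>U. \<bar>r y \<omega> - r x \<omega>\<bar> + norm (Dr y \<omega> - Dr x \<omega>) \<le> L * norm (y - x)) \<and>
     (\<forall>x. \<forall>\<omega>\<in>U. r x \<omega> \<ge> r\<^sub>0)"

definition terminal_cost_hyp ::
    "(real ^ 'd) set \<Rightarrow> (real ^ 'd \<Rightarrow> real) \<Rightarrow> real \<Rightarrow> real \<Rightarrow> bool" where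
  "terminal_cost_hyp S g N r\<^sub>0 \<longleftrightarrow>
     (\<exists>\<N> G. frontier S \<subseteq> interior \<N> \<and> 0 \<le> G \<and> G < r\<^sub>0 / N \<and>
        (\<forall>x\<in>\<N>. \<forall>y\<in>\<N>. \<bar>g y - g x\<bar> \<le> G * norm (y - x)))"

section \<open>Nonsmooth analysis\<close>

text \<open>Intended for closed \<open>Q\<close> and \<open>x \<in> Q\<close>.\<close>

definition proximal_normal_cone :: "(real ^ 'd) set \<Rightarrow> real ^ 'd \<Rightarrow> (real ^ 'd) set" where
  "proximal_normal_cone Q x =
     {v. \<exists>\<sigma>\<ge>0. \<forall>y\<in>Q. v \<bullet> (y - x) \<le> \<sigma> * (norm (y - x))\<^sup>2}"

definition normals0 ::
    "(real ^ 'd \<Rightarrow> real ^ 'm \<Rightarrow> real ^ 'd) \<Rightarrow> (real ^ 'm) set \<Rightarrow> (real ^ 'd) set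
      \<Rightarrow> real ^ 'd \<Rightarrow> (real ^ 'd) set" where
  "normals0 f U S z =
     {\<xi> \<in> proximal_normal_cone (closure (- S)) z. \<xi> \<noteq> 0 \<and> (SUP \<omega>\<in>U. \<xi> \<bullet> f z \<omega>) = 0}"

definition normals1 ::
    "(real ^ 'd \<Rightarrow> real ^ 'm \<Rightarrow> real ^ 'd) \<Rightarrow> (real ^ 'm) set \<Rightarrow> (real ^ 'd) set
      \<Rightarrow> real ^ 'd \<Rightarrow> (real ^ 'd) set" where
  "normals1 f U S z =
     {\<xi> \<in> proximal_normal_cone (closure (- S)) z. (SUP \<omega>\<in>U. \<xi> \<bullet> f z \<omega>) > 0}"

definition locally_semiconcave :: "(real ^ 'd \<Rightarrow> real) \<Rightarrow> bool" where
  "locally_semiconcave g \<longleftrightarrow>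
     (\<forall>z. \<exists>\<rho>>0. \<exists>c>0. \<forall>x\<^sub>0\<in>ball z \<rho>. \<forall>x\<^sub>1\<in>ball z \<rho>. \<forall>\<theta>\<in>{0..1}.
        (1 - \<theta>) * g x\<^sub>0 + \<theta> * g x\<^sub>1 - g ((1 - \<theta>) *\<^sub>R x\<^sub>0 + \<theta> *\<^sub>R x\<^sub>1)
          \<le> c * \<theta> * (1 - \<theta>) * (norm (x\<^sub>0 - x\<^sub>1))\<^sup>2)"

definition superdifferential :: "(real ^ 'd \<Rightarrow> real) \<Rightarrow> real ^ 'd \<Rightarrow> (real ^ 'd) set" where
  "superdifferential g x =
     {p. Limsup (at x) (\<lambda>y. ereal ((g y - g x - p \<bullet> (y - x)) / norm (y - x))) \<le> 0}"

end

theory Submission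
  imports Defs
begin

text \<open>Two kinds of variations of the optimal control suffice: inserting a constant control during
  \<open>[t, t + \<epsilon>]\<close>, and deleting what the control does during \<open>[t - \<epsilon>, t]\<close>; afterwards the control is
  followed with a time shift. Along the perturbed trajectory \<open>z\<close> the quantity
  \<open>p \<bullet> (z - y) + \<integral> (r z - r y)\<close> is constant up to \<open>O(\<epsilon>\<^sup>2)\<close> by the adjoint equation, so that only the
  end of the trajectory has to be analysed. In case (i) one switches, \<open>O(\<epsilon>)\<close> before the final time, to
  the constant control maximizing the Hamiltonian at \<open>xs\<close>, which enters \<open>S\<close> transversally because
  \<open>|q| \<le> G < r\<^sub>0 / N\<close>. In case (ii) a first-order decrease would put the perturbed trajectory inside
  \<open>S\<close> already at a time of order \<open>\<surd>\<epsilon>\<close> before the final one, saving more running cost than the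
  perturbation can lose.
  Insertion shows \<open>p \<bullet> f + r \<ge> 0\<close> for every control value; deletion shows that the integral of
  \<open>p \<bullet> f + r\<close> along the optimal pair has nonpositive left slope, hence vanishes. In case (ii) the terms in \<open>r\<close>
  are absent from both quantities.\<close>

section \<open>Absolutely continuous functions\<close>

text \<open>The obstacle is the end of a perturbed trajectory: its own hitting time is out of
  control, and at time \<open>\<tau>\<close> it may lie on either side of the boundary. Competitors
  are therefore not compared through first entrances; they need only end in \<open>S\<close> close
  to \<open>xs\<close>, and membership in \<open>S\<close> is certified by violating the proximal
  inequality. In case (i), stopping at \<open>\<tau> - B * \<epsilon>\<close> leaves the perturbed
  point on the outer side of the hyperplane normal to \<open>\<xi>\<close>, so that the remaining
  crossing time is nonnegative. In case (ii) the order \<open>sqrt \<epsilon>\<close> is forced: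
  tangency costs an error of order \<open>h\<^sup>2\<close>, to be kept below a decrease of order
  \<open>\<epsilon>\<close>, while the time \<open>h\<close> saved has to dominate losses of order
  \<open>\<epsilon>\<close>. An inserted arc starts at \<open>y t\<close> and a deleted arc ends
  there, so no Lebesgue points of the control enter; the almost everywhere clause of the conclusion
  comes from a nonnegative function with vanishing integral. Trajectories are kept as integral
  equations over all subintervals (\<open>primitive_on\<close>), which shift and splice without
  exceptional null sets.\<close>

definition primitive_on ::
    "real \<Rightarrow> real \<Rightarrow> (real \<Rightarrow> 'a::euclidean_space) \<Rightarrow> (real \<Rightarrow> 'a) \<Rightarrow> bool" where
  "primitive_on a b F y \<longleftrightarrow>
     (\<forall>s t. a \<le> s \<longrightarrow> s \<le> t \<longrightarrow> t \<le> b \<longrightarrow> (F has_integral (y t - y s)) {s..t})"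

lemma absolutely_continuousE:
  assumes "absolutely_continuous_on_interval a b y" and "e > 0"
  obtains d where "d > 0"
    "\<And>\<I>. finite \<I> \<Longrightarrow> (\<forall>(s, t)\<in>\<I>. a \<le> s \<and> s \<le> t \<and> t \<le> b) \<Longrightarrow>
        pairwise (\<lambda>(s, t) (s', t'). {s<..<t} \<inter> {s'<..<t'} = {}) \<I> \<Longrightarrow>
        (\<Sum>(s, t)\<in>\<I>. t - s) < d \<Longrightarrow> (\<Sum>(s, t)\<in>\<I>. norm (y t - y s)) < e"
  using assms unfolding absolutely_continuous_on_interval_def by meson

section \<open>Fundamental theorem of calculus for absolutely continuous functions\<close>

lemma absolutely_continuous_imp_continuous_on:
  assumes "absolutely_continuous_on_interval a b y"
  shows "continuous_on {a..b} y"
  unfolding continuous_on_iff dist_norm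
proof (intro ballI allI impI)
  fix x and e :: real assume x: "x \<in> {a..b}" and "e > 0"
  with assms obtain d where "d > 0" and d:
    "\<And>\<I>. finite \<I> \<Longrightarrow> (\<forall>(s, t)\<in>\<I>. a \<le> s \<and> s \<le> t \<and> t \<le> b) \<Longrightarrow>
        pairwise (\<lambda>(s, t) (s', t'). {s<..<t} \<inter> {s'<..<t'} = {}) \<I> \<Longrightarrow>
        (\<Sum>(s, t)\<in>\<I>. t - s) < d \<Longrightarrow> (\<Sum>(s, t)\<in>\<I>. norm (y t - y s)) < e"
    unfolding absolutely_continuous_on_interval_def by meson
  have "norm (y x' - y x) < e" if "x' \<in> {a..b}" "norm (x' - x) < d" for x'
  proof (cases "x \<le> x'")
    case True
    then show ?thesis using d[of "{(x, x')}"] x that by auto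
  next
    case False
    then show ?thesis using d[of "{(x', x)}"] x that by (auto simp: norm_minus_commute)
  qed
  then show "\<exists>d>0. \<forall>x'\<in>{a..b}. norm (x' - x) < d \<longrightarrow> norm (y x' - y x) < e"
    using \<open>d > 0\<close> by blast
qed

text \<open>Absolute continuity in the form that Henstock sums ask for: the intervals of a tagged
  partial division do not overlap, and their total length is at most the measure of a set containing
  them.\<close>

lemma absolutely_continuous_tagged_sum:
  assumes ac: "absolutely_continuous_on_interval a b y" and "\<epsilon> > 0"
  obtains \<delta> where "\<delta> > 0"
    "\<And>p W. p tagged_partial_division_of {a..b} \<Longrightarrow> W \<in> lmeasurable \<Longrightarrow> measure lebesgue W < \<delta> \<Longrightarrow>
       (\<And>x K. (x, K) \<in> p \<Longrightarrow> K \<subseteq> W) \<Longrightarrow> (\<Sum>(x, K)\<in>p. norm (y (Sup K) - y (Inf K))) < \<epsilon>"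
proof -
  obtain d where "d > 0" and d:
    "\<And>\<I>. finite \<I> \<Longrightarrow> (\<forall>(s, t)\<in>\<I>. a \<le> s \<and> s \<le> t \<and> t \<le> b) \<Longrightarrow>
        pairwise (\<lambda>(s, t) (s', t'). {s<..<t} \<inter> {s'<..<t'} = {}) \<I> \<Longrightarrow>
        (\<Sum>(s, t)\<in>\<I>. t - s) < d \<Longrightarrow> (\<Sum>(s, t)\<in>\<I>. norm (y t - y s)) < \<epsilon>"
    using assms unfolding absolutely_continuous_on_interval_def by meson
  show thesis
  proof (rule that[OF \<open>d > 0\<close>])
    fix p W assume p: "p tagged_partial_division_of {a..b}" and W: "W \<in> lmeasurable" "measure lebesgue W < d"
      and pO: "\<And>x K. (x, K) \<in> p \<Longrightarrow> K \<subseteq> W"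
    have "finite p" using p by (rule tagged_partial_division_ofD)
    \<comment> \<open>On nondegenerate intervals disjoint interiors force distinct end points, so
      the passage to pairs of end points is injective. Degenerate intervals contribute increment
      zero.\<close>
    define q where "q = {(x, K) \<in> p. Inf K < Sup K}"
    have qp: "q \<subseteq> p" and fq: "finite q"
      using \<open>finite p\<close> unfolding q_def by (auto intro: finite_subset)
    have K: "K = {Inf K..Sup K}" "Inf K \<le> Sup K" "a \<le> Inf K" "Sup K \<le> b" if xK: "(x, K) \<in> p" for x K
    proof -
      obtain s t where st: "K = {s..t}"
        using tagged_partial_division_ofD(4)[OF p xK] by auto
      moreover have "x \<in> K" "K \<subseteq> {a..b}"
        using tagged_partial_division_ofD(2,3)[OF p xK] by auto
      ultimately show "K = {Inf K..Sup K}" "Inf K \<le> Sup K" "a \<le> Inf K" "Sup K \<le> b"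
        by auto
    qed
    let ?h = "\<lambda>(x::real, K). (Inf K :: real, Sup K)"
    have dis: "{Inf K<..<Sup K} \<inter> {Inf K'<..<Sup K'} = {}"
      if "(x, K) \<in> p" "(x', K') \<in> p" "(x, K) \<noteq> (x', K')" for x K x' K'
    proof -
      have "interior K = {Inf K<..<Sup K}" "interior K' = {Inf K'<..<Sup K'}"
        using K(1)[OF that(1)] K(1)[OF that(2)] interior_atLeastAtMost_real by metis+
      then show ?thesis
        using tagged_partial_division_ofD(5)[OF p that(1,2,3)] by simp
    qed
    have inj: "inj_on ?h q"
    proof (rule inj_onI)
      fix u v assume u: "u \<in> q" and v: "v \<in> q" and e: "?h u = ?h v"
      obtain x K x' K' where [simp]: "u = (x, K)" "v = (x', K')" by fastforce
      show "u = v"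
      proof (rule ccontr)
        assume "u \<noteq> v"
        then have "{Inf K<..<Sup K} \<inter> {Inf K'<..<Sup K'} = {}"
          using dis[of x K x' K'] u v qp by auto
        moreover have "Inf K = Inf K'" "Sup K = Sup K'" "Inf K < Sup K"
          using e u by (auto simp: q_def)
        ultimately show False by simp
      qed
    qed
    have disf: "disjoint_family_on (\<lambda>(x, K). {Inf K<..<Sup K}) q"
      unfolding disjoint_family_on_def
    proof (intro ballI impI)
      fix u v assume "u \<in> q" "v \<in> q" "u \<noteq> v"
      then show "(\<lambda>(x, K). {Inf K<..<Sup K}) u \<inter> (\<lambda>(x, K). {Inf K<..<Sup K}) v = {}"
        using dis[of "fst u" "snd u" "fst v" "snd v"] qp by (auto simp: case_prod_beta')
    qed
    have "(\<Sum>(x, K)\<in>q. Sup K - Inf K) = (\<Sum>u\<in>q. measure lebesgue ((\<lambda>(x, K). {Inf K<..<Sup K}) u))"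
      by (rule sum.cong) (auto simp: q_def)
    also have "\<dots> = measure lebesgue (\<Union>u\<in>q. (\<lambda>(x, K). {Inf K<..<Sup K}) u)"
      by (rule measure_finite_Union[symmetric, OF fq _ disf])
         (auto simp: q_def emeasure_lborel_Ioo)
    also have "\<dots> \<le> measure lebesgue W"
    proof (rule measure_mono_fmeasurable)
      show "(\<Union>u\<in>q. (\<lambda>(x, K). {Inf K<..<Sup K}) u) \<subseteq> W"
      proof clarify
        fix z x K assume "(x, K) \<in> q" and z: "z \<in> {Inf K<..<Sup K}"
        then have "(x, K) \<in> p" using qp by auto
        moreover have "z \<in> K" using z K(1)[OF calculation] by force
        ultimately show "z \<in> W" using pO by auto
      qed
      show "(\<Union>u\<in>q. (\<lambda>(x, K). {Inf K<..<Sup K}) u) \<in> sets lebesgue"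
        using fq by (intro sets.finite_UN) (auto split: prod.split)
    qed (rule W)
    finally have len: "(\<Sum>(x, K)\<in>q. Sup K - Inf K) < d" using W by simp
    have "(\<Sum>(s, t)\<in>?h ` q. norm (y t - y s)) < \<epsilon>"
    proof (rule d)
      show "finite (?h ` q)" using fq by simp
      show "\<forall>(s, t)\<in>?h ` q. a \<le> s \<and> s \<le> t \<and> t \<le> b"
      proof
        fix i assume "i \<in> ?h ` q"
        then obtain u where "u \<in> q" "i = ?h u" by blast
        then show "case i of (s, t) \<Rightarrow> a \<le> s \<and> s \<le> t \<and> t \<le> b"
          using K(2,3,4)[of "fst u" "snd u"] qp by (auto simp: case_prod_beta')
      qed
      show "pairwise (\<lambda>(s, t) (s', t'). {s<..<t} \<inter> {s'<..<t'} = {}) (?h ` q)"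
        unfolding pairwise_def
      proof (intro ballI impI)
        fix i j assume i: "i \<in> ?h ` q" and j: "j \<in> ?h ` q" and "i \<noteq> j"
        from i obtain u where "u \<in> q" "i = ?h u" by blast
        moreover from j obtain v where "v \<in> q" "j = ?h v" by blast
        ultimately show "(\<lambda>(s, t) (s', t'). {s<..<t} \<inter> {s'<..<t'} = {}) i j"
          using \<open>i \<noteq> j\<close> dis[of "fst u" "snd u" "fst v" "snd v"] qp by (auto simp: case_prod_beta')
      qed
      show "(\<Sum>(s, t)\<in>?h ` q. t - s) < d"
        using len by (subst sum.reindex[OF inj]) (simp add: case_prod_beta' o_def)
    qed
    then have "(\<Sum>(x, K)\<in>q. norm (y (Sup K) - y (Inf K))) < \<epsilon>"
      by (subst (asm) sum.reindex[OF inj]) (simp add: case_prod_beta' o_def)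
    moreover have "(\<Sum>(x, K)\<in>p. norm (y (Sup K) - y (Inf K))) = (\<Sum>(x, K)\<in>q. norm (y (Sup K) - y (Inf K)))"
    proof (intro sum.mono_neutral_right \<open>finite p\<close> qp ballI)
      fix u assume "u \<in> p - q"
      then have "Inf (snd u) = Sup (snd u)"
        using K(2)[of "fst u" "snd u"] by (auto simp: q_def case_prod_beta')
      then show "(case u of (x, K) \<Rightarrow> norm (y (Sup K) - y (Inf K))) = 0"
        by (simp add: case_prod_beta')
    qed
    ultimately show "(\<Sum>(x, K)\<in>p. norm (y (Sup K) - y (Inf K))) < \<epsilon>" by simp
  qed
qed

text \<open>Tags outside \<open>Z\<close> are handled by differentiability, as in the fundamental
  theorem for everywhere differentiable functions. Tags in \<open>Z\<close> are confined by the
  gauge to an open set of small measure, where absolute continuity bounds the sum of the increments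
  of \<open>y\<close>.\<close>

theorem absolutely_continuous_has_integral:
  fixes y :: "real \<Rightarrow> 'a::euclidean_space"
  assumes "a \<le> b" and ac: "absolutely_continuous_on_interval a b y" and Z: "negligible Z"
    and der: "\<And>t. t \<in> {a..b} - Z \<Longrightarrow> (y has_vector_derivative F t) (at t within {a..b})"
  shows "(F has_integral (y b - y a)) {a..b}"
proof -
  \<comment> \<open>With value 0 on \<open>Z\<close>, tags there leave only the increments of
    \<open>y\<close> to estimate.\<close>
  define F' where "F' t = (if t \<in> Z then 0 else F t)" for t
  have "(F' has_integral (y b - y a)) {a..b}"
    unfolding has_integral_real
  proof (intro allI impI)
    fix e :: real assume "e > 0"
    \<comment> \<open>The \<open>+ 1\<close> covers \<open>a = b\<close> and makes
      \<open>e' * (b - a) < e / 2\<close> strict.\<close>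
    define e' where "e' = e / (2 * (b - a + 1))"
    have e': "e' > 0" "e' * (b - a) < e / 2"
      using \<open>e > 0\<close> \<open>a \<le> b\<close> by (auto simp: e'_def field_simps)
    obtain \<delta> where "\<delta> > 0" and \<delta>:
      "\<And>p W. p tagged_partial_division_of {a..b} \<Longrightarrow> W \<in> lmeasurable \<Longrightarrow> measure lebesgue W < \<delta> \<Longrightarrow>
       (\<And>x K. (x, K) \<in> p \<Longrightarrow> K \<subseteq> W) \<Longrightarrow> (\<Sum>(x, K)\<in>p. norm (y (Sup K) - y (Inf K))) < e / 2"
      by (rule absolutely_continuous_tagged_sum[OF ac half_gt_zero[OF \<open>e > 0\<close>]]) blast
    obtain W where W: "open W" "Z \<subseteq> W" "W - Z \<in> lmeasurable" "emeasure lebesgue (W - Z) < ennreal \<delta>"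
      using sets_lebesgue_outer_open[OF negligible_imp_sets[OF Z] \<open>\<delta> > 0\<close>] .
    have WZ: "W = (W - Z) \<union> Z" using W(2) by blast
    have Wl: "W \<in> lmeasurable"
      by (subst WZ, rule fmeasurable.Un[OF W(3) negligible_imp_measurable[OF Z]])
    have "measure lebesgue (W - Z) < \<delta>"
      using W(3,4) \<open>\<delta> > 0\<close> by (metis emeasure_eq_measure2 ennreal_less_iff measure_nonneg)
    moreover have "measure lebesgue (W - Z) = measure lebesgue W"
      by (rule measure_Diff_null_set) (use Z W Wl in \<open>auto simp: negligible_iff_null_sets\<close>)
    ultimately have Wm: "measure lebesgue W < \<delta>" by simp
    have "\<exists>d>0. \<forall>s\<in>{a..b}. norm (s - t) < d \<longrightarrow> norm (y s - y t - (s - t) *\<^sub>R F t) \<le> e' * norm (s - t)"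
      if "t \<in> {a..b} - Z" for t
      using der[OF that] e'(1) unfolding has_vector_derivative_def has_derivative_within_alt by blast
    then obtain d where d: "\<And>t. t \<in> {a..b} - Z \<Longrightarrow> d t > 0"
      "\<And>t s. t \<in> {a..b} - Z \<Longrightarrow> s\<in>{a..b} \<Longrightarrow> norm (s - t) < d t \<Longrightarrow>
         norm (y s - y t - (s - t) *\<^sub>R F t) \<le> e' * norm (s - t)"
      by metis
    define \<gamma> where "\<gamma> t = (if t \<in> Z then W else if t \<in> {a..b} then ball t (d t) else UNIV)" for t
    have g: "gauge \<gamma>"
      unfolding gauge_def \<gamma>_def using W d(1) by auto
    have est: "norm ((\<Sum>(x, K)\<in>p. measure lborel K *\<^sub>R F' x) - (y b - y a)) < e"
      if p: "p tagged_division_of {a..b}" and fine: "\<gamma> fine p" for p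
    proof -
      have "finite p" using p by auto
      have K: "K = {Inf K..Sup K}" "Inf K \<le> x" "x \<le> Sup K" "a \<le> Inf K" "Sup K \<le> b"
        "measure lborel K = Sup K - Inf K" if xK: "(x, K) \<in> p" for x K
      proof -
        obtain s t where st: "K = {s..t}"
          using tagged_division_ofD(4)[OF p xK] by auto
        moreover have "x \<in> K" "K \<subseteq> {a..b}"
          using tagged_division_ofD(2,3)[OF p xK] by auto
        ultimately show "K = {Inf K..Sup K}" "Inf K \<le> x" "x \<le> Sup K" "a \<le> Inf K" "Sup K \<le> b"
          "measure lborel K = Sup K - Inf K"
          by auto
      qed
      define pZ where "pZ = {(x, K) \<in> p. x \<in> Z}"
      define pN where "pN = {(x, K) \<in> p. x \<notin> Z}"
      have pU: "p = pZ \<union> pN" "pZ \<inter> pN = {}" "finite pZ" "finite pN"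
        using \<open>finite p\<close> by (auto simp: pZ_def pN_def intro: finite_subset[of _ p])
      have bZ: "(\<Sum>(x, K)\<in>pZ. norm (measure lborel K *\<^sub>R F' x - (y (Sup K) - y (Inf K)))) < e / 2"
      proof -
        have "(\<Sum>(x, K)\<in>pZ. norm (y (Sup K) - y (Inf K))) < e / 2"
        proof (rule \<delta>)
          show "pZ tagged_partial_division_of {a..b}"
            by (rule tagged_partial_division_subset[of p]) (use p pU(1) in \<open>auto simp: tagged_division_of_def\<close>)
          show "K \<subseteq> W" if "(x, K) \<in> pZ" for x K
            using fineD[OF fine, of x K] that by (simp add: \<gamma>_def pZ_def)
        qed (use Wl Wm in auto)
        moreover have "(\<Sum>(x, K)\<in>pZ. norm (measure lborel K *\<^sub>R F' x - (y (Sup K) - y (Inf K)))) =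
            (\<Sum>(x, K)\<in>pZ. norm (y (Sup K) - y (Inf K)))"
          by (rule sum.cong) (auto simp: pZ_def F'_def norm_minus_commute)
        ultimately show ?thesis by simp
      qed
      have bN: "(\<Sum>(x, K)\<in>pN. norm (measure lborel K *\<^sub>R F' x - (y (Sup K) - y (Inf K)))) < e / 2"
      proof -
        have "norm (measure lborel K *\<^sub>R F' x - (y (Sup K) - y (Inf K))) \<le> e' * measure lborel K" if "(x, K) \<in> pN" for x K
        proof -
          have xK: "(x, K) \<in> p" "x \<notin> Z" using that by (auto simp: pN_def)
          have x: "x \<in> {a..b} - Z" using K[OF xK(1)] xK(2) by auto
          have sub: "K \<subseteq> ball x (d x)" using fineD[OF fine xK(1)] xK x by (simp add: \<gamma>_def)
          have "Inf K \<in> {Inf K..Sup K}" "Sup K \<in> {Inf K..Sup K}" using K(2,3)[OF xK(1)] by auto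
          then have "Inf K \<in> K" "Sup K \<in> K" using K(1)[OF xK(1)] by simp_all
          then have nr: "norm (Inf K - x) < d x" "norm (Sup K - x) < d x"
            using sub by (auto simp: dist_real_def abs_minus_commute)
          have i: "norm (y (Inf K) - y x - (Inf K - x) *\<^sub>R F x) \<le> e' * (x - Inf K)"
            using d(2)[OF x _ nr(1)] K[OF xK(1)] by auto
          have s: "norm (y (Sup K) - y x - (Sup K - x) *\<^sub>R F x) \<le> e' * (Sup K - x)"
            using d(2)[OF x _ nr(2)] K[OF xK(1)] by auto
          \<comment> \<open>The tag lies between the end points of \<open>K\<close>, so the two
            one-sided errors add up to \<open>e'\<close> times the length of
            \<open>K\<close>.\<close>
          have "measure lborel K *\<^sub>R F' x - (y (Sup K) - y (Inf K)) =
             (y (Inf K) - y x - (Inf K - x) *\<^sub>R F x) - (y (Sup K) - y x - (Sup K - x) *\<^sub>R F x)"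
            using xK by (simp add: F'_def K(6)[OF xK(1)] algebra_simps)
          also have "norm \<dots> \<le> e' * (x - Inf K) + e' * (Sup K - x)"
            by (rule norm_triangle_le_diff) (use i s in linarith)
          finally show ?thesis by (simp add: K(6)[OF xK(1)] algebra_simps)
        qed
        then have "(\<Sum>(x, K)\<in>pN. norm (measure lborel K *\<^sub>R F' x - (y (Sup K) - y (Inf K)))) \<le> (\<Sum>(x, K)\<in>pN. e' * measure lborel K)"
          by (intro sum_mono) auto
        also have "\<dots> \<le> (\<Sum>(x, K)\<in>p. e' * measure lborel K)"
          by (rule sum_mono2) (use pU(1) \<open>finite p\<close> e'(1) in auto)
        also have "\<dots> = e' * (b - a)"
        proof -
          have "(\<Sum>(x, K)\<in>p. measure lborel K) = b - a"
            using additive_content_tagged_division[of p a b] p \<open>a \<le> b\<close> by simp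
          moreover have "(\<Sum>(x, K)\<in>p. e' * measure lborel K) = e' * (\<Sum>(x, K)\<in>p. measure lborel K)"
            by (simp add: sum_distrib_left case_prod_unfold)
          ultimately show ?thesis by simp
        qed
        finally show ?thesis using e' by linarith
      qed
      have "(\<Sum>(x, K)\<in>p. y (Sup K) - y (Inf K)) = y b - y a"
        using additive_tagged_division_1[OF \<open>a \<le> b\<close> p] .
      then have "norm ((\<Sum>(x, K)\<in>p. measure lborel K *\<^sub>R F' x) - (y b - y a)) =
          norm (\<Sum>(x, K)\<in>p. measure lborel K *\<^sub>R F' x - (y (Sup K) - y (Inf K)))"
        by (simp only: case_prod_unfold sum_subtractf)
      also have "\<dots> \<le> (\<Sum>(x, K)\<in>p. norm (measure lborel K *\<^sub>R F' x - (y (Sup K) - y (Inf K))))"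
        unfolding case_prod_unfold by (rule norm_sum)
      also have "\<dots> < e"
      proof -
        have "(\<Sum>(x, K)\<in>p. norm (measure lborel K *\<^sub>R F' x - (y (Sup K) - y (Inf K)))) =
            (\<Sum>(x, K)\<in>pZ. norm (measure lborel K *\<^sub>R F' x - (y (Sup K) - y (Inf K)))) +
            (\<Sum>(x, K)\<in>pN. norm (measure lborel K *\<^sub>R F' x - (y (Sup K) - y (Inf K))))"
          by (subst pU(1)) (rule sum.union_disjoint[OF pU(3,4,2)])
        then show ?thesis using bZ bN by linarith
      qed
      finally show ?thesis .
    qed
    show "\<exists>\<gamma>. gauge \<gamma> \<and> (\<forall>\<D>. \<D> tagged_division_of {a..b} \<and> \<gamma> fine \<D> \<longrightarrow>
         norm ((\<Sum>(x, K)\<in>\<D>. measure lborel K *\<^sub>R F' x) - (y b - y a)) < e)"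
      by (rule exI[of _ \<gamma>], rule conjI[OF g]) (auto intro!: est)
  qed
  then show ?thesis
    by (rule has_integral_spike[OF Z, rotated]) (auto simp: F'_def)
qed

subsection \<open>Differentiating indefinite integrals\<close>

text \<open>By Vitali's theorem the exceptional set is covered by disjoint intervals, contained in an open
  set that exceeds \<open>{f < c}\<close> only slightly in measure; each of them has a fixed proportion of its
  length outside \<open>{f < c}\<close>.\<close>

lemma average_exceeds_negligible:
  fixes f :: "real \<Rightarrow> real"
  assumes f: "f integrable_on {a..b}" and M: "\<And>t. t \<in> {a..b} \<Longrightarrow> \<bar>f t\<bar> \<le> M" and "c < d"
  shows "negligible {x \<in> {a..b}. f x < c \<and> (\<forall>e>0. \<exists>s t. a \<le> s \<and> s \<le> x \<and> x \<le> t \<and> t \<le> b \<and> s < t \<and>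
           t - s < e \<and> integral {s..t} f > d * (t - s))}" (is "negligible ?B")
  unfolding negligible_outer
proof (intro allI impI)
  fix \<epsilon> :: real assume "\<epsilon> > 0"
  show "\<exists>T. ?B \<subseteq> T \<and> T \<in> lmeasurable \<and> measure lebesgue T < \<epsilon>"
  proof (cases "?B = {}")
    case True
    then show ?thesis using \<open>\<epsilon> > 0\<close> by (intro exI[of _ "{}"]) auto
  next
    case False
    then obtain x0 where "x0 \<in> {a..b}" by blast
    then have M0: "M \<ge> 0" using M[of x0] by linarith
    \<comment> \<open>Chosen so that the integrand is at most \<open>c + D\<close> outside
      \<open>E\<close>, even where \<open>c\<close> is negative.\<close>
    define D where "D = M + \<bar>c\<bar> + 1"
    have D: "D > 0" using M0 by (simp add: D_def)
    \<comment> \<open>Solves \<open>D * \<epsilon>' = (d - c) * (\<epsilon> / 2)\<close>, the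
      balance needed in \<open>bound\<close>.\<close>
    define \<epsilon>' where "\<epsilon>' = \<epsilon> * (d - c) / (2 * D)"
    have "\<epsilon>' > 0" using \<open>\<epsilon> > 0\<close> D \<open>c < d\<close> by (simp add: \<epsilon>'_def)
    define E where "E = {x \<in> {a..b}. f x < c}"
    have "f \<in> borel_measurable (lebesgue_on {a..b})"
      using integrable_imp_measurable[OF f] .
    then have "E \<in> sets (lebesgue_on {a..b})"
      unfolding E_def using borel_measurable_less[of f "lebesgue_on {a..b}" "\<lambda>_. c"]
      by (simp add: space_restrict_space)
    then have "E \<in> sets lebesgue"
      by (simp add: sets_restrict_space_iff)
    then have E: "E \<in> lmeasurable"
      by (rule bounded_set_imp_lmeasurable[rotated]) (auto simp: E_def intro: bounded_subset[of "{a..b}"])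
    obtain W where W: "open W" "E \<subseteq> W" "W - E \<in> lmeasurable" "emeasure lebesgue (W - E) < ennreal \<epsilon>'"
      using sets_lebesgue_outer_open[OF \<open>E \<in> sets lebesgue\<close> \<open>\<epsilon>' > 0\<close>] .
    then have Wm: "measure lebesgue (W - E) < \<epsilon>'"
      using \<open>\<epsilon>' > 0\<close> by (metis emeasure_eq_measure2 ennreal_less_iff measure_nonneg)
    define K where "K = {(s, t). a \<le> s \<and> s < t \<and> t \<le> b \<and> {s..t} \<subseteq> W \<and> integral {s..t} f > d * (t - s)}"
    define m where "m i = (fst i + snd i) / 2" for i :: "real \<times> real"
    define r where "r i = (snd i - fst i) / 2" for i :: "real \<times> real"
    have cb: "cball (m i) (r i) = {fst i..snd i}" for i
      by (auto simp: m_def r_def cball_eq_atLeastAtMost field_simps)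
    obtain C where C: "countable C" "C \<subseteq> K"
      "pairwise (\<lambda>i j. disjnt (cball (m i) (r i)) (cball (m j) (r j))) C"
      "negligible (?B - (\<Union>i\<in>C. cball (m i) (r i)))"
    proof (rule Vitali_covering_theorem_cballs[of K r ?B m])
      show "0 < r i" if "i \<in> K" for i using that by (auto simp: K_def r_def)
      show "\<exists>i. i \<in> K \<and> x \<in> cball (m i) (r i) \<and> r i < e" if x: "x \<in> ?B" and "0 < e" for x e
      proof -
        have "x \<in> W" using x W by (auto simp: E_def)
        then obtain e1 where e1: "e1 > 0" "ball x e1 \<subseteq> W" using W(1) openE by blast
        then obtain s t where st: "a \<le> s" "s \<le> x" "x \<le> t" "t \<le> b" "s < t" "t - s < min e e1"
          "integral {s..t} f > d * (t - s)"
          using x \<open>0 < e\<close> by (auto dest!: spec[of _ "min e e1"])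
        have "{s..t} \<subseteq> ball x e1" using st by (auto simp: dist_real_def)
        then have "(s, t) \<in> K" using st e1 by (auto simp: K_def)
        moreover have "x \<in> cball (m (s, t)) (r (s, t))" unfolding cb using st by simp
        moreover have "r (s, t) < e" using st by (auto simp: r_def)
        ultimately show ?thesis by blast
      qed
    qed
    \<comment> \<open>The integral over the interval exceeds \<open>d\<close> times its length, but
      is at most \<open>c\<close> times its length plus \<open>D\<close> times the measure of the
      part outside \<open>E\<close>.\<close>
    have each: "(d - c) * measure lebesgue (cball (m i) (r i)) \<le> D * measure lebesgue (cball (m i) (r i) - E)"
      if "i \<in> K" for i
    proof -
      obtain s t where i: "i = (s, t)" by fastforce
      have st: "a \<le> s" "s < t" "t \<le> b" "integral {s..t} f > d * (t - s)" using that i by (auto simp: K_def)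
      have fi: "f integrable_on {s..t}" using f by (rule integrable_subinterval_real) (use st in auto)
      have lm: "{s..t} - E \<in> lmeasurable" using E by (intro fmeasurable_Diff) auto
      have "(indicat_real ({s..t} - E) has_integral measure lebesgue ({s..t} - E)) UNIV"
        using lm by (simp only: lmeasurable_iff_has_integral)
      then have ind: "(indicat_real ({s..t} - E) has_integral measure lebesgue ({s..t} - E)) {s..t}"
        by (subst has_integral_restrict_UNIV[symmetric])
          (erule has_integral_eq[rotated], auto simp: indicator_def)
      have "integral {s..t} f \<le> c * (t - s) + D * measure lebesgue ({s..t} - E)"
      proof (rule has_integral_le[OF integrable_integral[OF fi]])
        show "((\<lambda>x. c + D * indicat_real ({s..t} - E) x) has_integral
                 c * (t - s) + D * measure lebesgue ({s..t} - E)) {s..t}"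
          using has_integral_add[OF has_integral_const_real[of c s t] has_integral_mult_right[OF ind, of D]] st
          by (simp add: mult.commute)
        show "f x \<le> c + D * indicat_real ({s..t} - E) x" if "x \<in> {s..t}" for x
          using M[of x] that st M0 by (auto simp: indicator_def E_def D_def)
      qed
      then show ?thesis unfolding cb using st by (simp add: i algebra_simps)
    qed
    \<comment> \<open>The parts outside \<open>E\<close> of the disjoint intervals all lie in
      \<open>W - E\<close>. The bound is uniform in the finite subfamily and so passes to the
      countable union.\<close>
    have bound: "measure lebesgue (\<Union>i\<in>J. cball (m i) (r i)) \<le> \<epsilon> / 2" if J: "J \<subseteq> C" "finite J" for J
    proof -
      have dis: "disjoint_family_on (\<lambda>i. cball (m i) (r i)) J"
        using C(3) J unfolding disjoint_family_on_def pairwise_def disjnt_def by blast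
      have dis': "disjoint_family_on (\<lambda>i. cball (m i) (r i) - E) J"
        using dis unfolding disjoint_family_on_def by blast
      have lmi: "cball (m i) (r i) - E \<in> lmeasurable" for i using E by (intro fmeasurable_Diff) auto
      have "(d - c) * measure lebesgue (\<Union>i\<in>J. cball (m i) (r i)) = (\<Sum>i\<in>J. (d - c) * measure lebesgue (cball (m i) (r i)))"
        by (subst measure_finite_Union[OF J(2) _ dis])
          (use fmeasurableD2[OF lmeasurable_cball] in \<open>auto simp: sum_distrib_left\<close>)
      also have "\<dots> \<le> (\<Sum>i\<in>J. D * measure lebesgue (cball (m i) (r i) - E))"
        using each J C by (intro sum_mono) auto
      also have "\<dots> = D * measure lebesgue (\<Union>i\<in>J. cball (m i) (r i) - E)"
        by (subst measure_finite_Union[OF J(2) _ dis'])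
          (use fmeasurableD2[OF lmi] fmeasurableD[OF lmi] in \<open>auto simp: sum_distrib_left\<close>)
      also have "\<dots> \<le> D * measure lebesgue (W - E)"
      proof (intro mult_left_mono measure_mono_fmeasurable)
        show "(\<Union>i\<in>J. cball (m i) (r i) - E) \<subseteq> W - E"
          using J C(2) unfolding cb by (force simp: K_def)
        show "(\<Union>i\<in>J. cball (m i) (r i) - E) \<in> sets lebesgue"
          using J fmeasurableD[OF lmi] by (intro sets.finite_UN) auto
      qed (use W D in auto)
      also have "\<dots> \<le> D * \<epsilon>'" using Wm D by simp
      also have "\<dots> = (d - c) * (\<epsilon> / 2)" using D by (simp add: \<epsilon>'_def field_simps)
      finally show ?thesis using \<open>c < d\<close> by simp
    qed
    have UC: "(\<Union>i\<in>C. cball (m i) (r i)) \<in> lmeasurable" "measure lebesgue (\<Union>i\<in>C. cball (m i) (r i)) \<le> \<epsilon> / 2"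
      using fmeasurable_UN_bound[OF C(1) _ bound] measure_UN_bound[OF C(1) _ bound] by auto
    let ?T = "(\<Union>i\<in>C. cball (m i) (r i)) \<union> (?B - (\<Union>i\<in>C. cball (m i) (r i)))"
    have "measure lebesgue ?T \<le> \<epsilon> / 2 + 0"
      using measure_Un_le[of "\<Union>i\<in>C. cball (m i) (r i)" lebesgue "?B - (\<Union>i\<in>C. cball (m i) (r i))"]
        UC C(4) negligible_imp_measure0[OF C(4)] negligible_imp_sets[OF C(4)] by (simp add: fmeasurableD)
    moreover have "?T \<in> lmeasurable"
      using UC(1) negligible_imp_measurable[OF C(4)] by (rule fmeasurable.Un)
    ultimately show ?thesis using \<open>\<epsilon> > 0\<close> by (intro exI[of _ ?T]) auto
  qed
qed

lemma primitive_on_lipschitz: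
  assumes "primitive_on a b F y" and M: "\<And>t. t \<in> {a..b} \<Longrightarrow> norm (F t) \<le> M"
    and st: "s \<in> {a..b}" "t \<in> {a..b}"
  shows "norm (y t - y s) \<le> M * \<bar>t - s\<bar>"
proof -
  have M0: "M \<ge> 0" using M[OF st(1)] norm_ge_zero order_trans by blast
  have "norm (y t - y s) \<le> M * (t - s)" if "s \<in> {a..b}" "t \<in> {a..b}" "s \<le> t" for s t
    using has_integral_bound_real[OF M0 finite.emptyI, of F "y t - y s" s t] assms(1) M that
    by (auto simp: primitive_on_def)
  from this[of s t] this[of t s] show ?thesis
    using st by (cases "s \<le> t") (auto simp: norm_minus_commute)
qed

lemma primitive_onD:
  "primitive_on a b F y \<Longrightarrow> a \<le> s \<Longrightarrow> s \<le> t \<Longrightarrow> t \<le> b \<Longrightarrow> (F has_integral (y t - y s)) {s..t}"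
  by (simp add: primitive_on_def)

lemma primitive_on_subinterval:
  "primitive_on a b F y \<Longrightarrow> a \<le> a' \<Longrightarrow> b' \<le> b \<Longrightarrow> primitive_on a' b' F y"
  unfolding primitive_on_def by auto

lemma primitive_on_integral:
  "primitive_on a b F y \<Longrightarrow> a \<le> s \<Longrightarrow> s \<le> t \<Longrightarrow> t \<le> b \<Longrightarrow>
    F integrable_on {s..t} \<and> integral {s..t} F = y t - y s"
  unfolding primitive_on_def using has_integral_integrable_integral by blast

lemma primitive_on_linear:
  assumes "primitive_on a b F y" "bounded_linear h"
  shows "primitive_on a b (\<lambda>t. h (F t)) (\<lambda>t. h (y t))"
  unfolding primitive_on_def
proof (intro allI impI)
  fix s t assume "a \<le> s" "s \<le> t" "t \<le> b"
  then have "(F has_integral (y t - y s)) {s..t}" using assms(1) by (simp add: primitive_on_def)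
  from has_integral_linear[OF this assms(2)]
  show "((\<lambda>t. h (F t)) has_integral h (y t) - h (y s)) {s..t}"
    by (simp add: o_def linear_diff[OF bounded_linear.linear[OF assms(2)]])
qed

lemma primitive_on_diff:
  assumes "primitive_on a b F y" "primitive_on a b G z"
  shows "primitive_on a b (\<lambda>t. F t - G t) (\<lambda>t. y t - z t)"
  unfolding primitive_on_def
proof (intro allI impI)
  fix s t assume "a \<le> s" "s \<le> t" "t \<le> b"
  then have "((\<lambda>t. F t - G t) has_integral (y t - y s) - (z t - z s)) {s..t}"
    using assms by (intro has_integral_diff) (auto simp: primitive_on_def)
  then show "((\<lambda>t. F t - G t) has_integral (y t - z t) - (y s - z s)) {s..t}"
    by (simp add: algebra_simps)
qed

text \<open>One half of Lebesgue's differentiation theorem. Rational thresholds with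
  \<open>f x < c < f x + \<eta> / 2 < d < f x + \<eta>\<close> reduce it to countably many
  negligible sets; applied to \<open>f\<close> and \<open>- f\<close> it yields the
  derivative.\<close>

lemma primitive_on_upper_slope:
  fixes f :: "real \<Rightarrow> real"
  assumes p: "primitive_on a b f y" and M: "\<And>t. t \<in> {a..b} \<Longrightarrow> \<bar>f t\<bar> \<le> M"
  obtains Z where "negligible Z"
    "\<And>x \<eta>. x \<in> {a..b} - Z \<Longrightarrow> \<eta> > 0 \<Longrightarrow> \<exists>e>0. \<forall>s t. a \<le> s \<longrightarrow> s \<le> x \<longrightarrow> x \<le> t \<longrightarrow> t \<le> b \<longrightarrow>
       t - s < e \<longrightarrow> y t - y s \<le> (f x + \<eta>) * (t - s)"
proof (cases "a \<le> b")
  case False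
  then show thesis using that[of "{}"] by auto
next
  case True
  define B where "B c d = {x \<in> {a..b}. f x < c \<and> (\<forall>e>0. \<exists>s t. a \<le> s \<and> s \<le> x \<and> x \<le> t \<and> t \<le> b \<and> s < t \<and>
           t - s < e \<and> integral {s..t} f > d * (t - s))}" for c d
  define Z where "Z = (\<Union>(c, d)\<in>{(c, d). c \<in> \<rat> \<and> d \<in> \<rat> \<and> c < d}. B c d)"
  have fi: "f integrable_on {a..b}" using p True by (auto simp: primitive_on_def)
  show thesis
  proof (rule that[of Z])
    have "countable {(c::real, d). c \<in> \<rat> \<and> d \<in> \<rat> \<and> c < d}"
      by (rule countable_subset[of _ "\<rat> \<times> \<rat>"]) (auto intro: countable_rat)
    moreover have "negligible (B c d)" if "c < d" for c d
      unfolding B_def by (rule average_exceeds_negligible[OF fi M that])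
    ultimately show "negligible Z"
      unfolding Z_def by (intro negligible_countable_Union countable_image) auto
    fix x \<eta> :: real assume x: "x \<in> {a..b} - Z" and "\<eta> > 0"
    obtain c where c: "c \<in> \<rat>" "f x < c" "c < f x + \<eta> / 2"
      using Rats_dense_in_real[of "f x" "f x + \<eta> / 2"] \<open>\<eta> > 0\<close> by auto
    obtain d where d: "d \<in> \<rat>" "f x + \<eta> / 2 < d" "d < f x + \<eta>"
      using Rats_dense_in_real[of "f x + \<eta> / 2" "f x + \<eta>"] \<open>\<eta> > 0\<close> by auto
    have "x \<notin> B c d" using x c d unfolding Z_def by auto
    then obtain e where e: "e > 0" "\<And>s t. a \<le> s \<Longrightarrow> s \<le> x \<Longrightarrow> x \<le> t \<Longrightarrow> t \<le> b \<Longrightarrow> s < t \<Longrightarrow>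
           t - s < e \<Longrightarrow> integral {s..t} f \<le> d * (t - s)"
      using x c unfolding B_def by fastforce
    have "y t - y s \<le> (f x + \<eta>) * (t - s)" if st: "a \<le> s" "s \<le> x" "x \<le> t" "t \<le> b" "t - s < e" for s t
    proof (cases "s < t")
      case True
      have "y t - y s = integral {s..t} f" using primitive_on_integral[OF p, of s t] st by simp
      also have "\<dots> \<le> d * (t - s)" using e(2) st True by blast
      also have "\<dots> \<le> (f x + \<eta>) * (t - s)" using d True by (intro mult_right_mono) auto
      finally show ?thesis .
    next
      case False then have "s = t" using st by simp
      then show ?thesis by simp
    qed
    then show "\<exists>e>0. \<forall>s t. a \<le> s \<longrightarrow> s \<le> x \<longrightarrow> x \<le> t \<longrightarrow> t \<le> b \<longrightarrow>
       t - s < e \<longrightarrow> y t - y s \<le> (f x + \<eta>) * (t - s)"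
      using e(1) by blast
  qed
qed

lemma primitive_on_derivative_real:
  fixes f :: "real \<Rightarrow> real"
  assumes p: "primitive_on a b f y" and M: "\<And>t. t \<in> {a..b} \<Longrightarrow> \<bar>f t\<bar> \<le> M"
  obtains Z where "negligible Z"
    "\<And>x. x \<in> {a..b} - Z \<Longrightarrow> (y has_vector_derivative f x) (at x within {a..b})"
proof -
  obtain Z1 where Z1: "negligible Z1"
    "\<And>x \<eta>. x \<in> {a..b} - Z1 \<Longrightarrow> \<eta> > 0 \<Longrightarrow> \<exists>e>0. \<forall>s t. a \<le> s \<longrightarrow> s \<le> x \<longrightarrow> x \<le> t \<longrightarrow> t \<le> b \<longrightarrow>
       t - s < e \<longrightarrow> y t - y s \<le> (f x + \<eta>) * (t - s)"
    using primitive_on_upper_slope[OF p M] by blast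
  have p': "primitive_on a b (\<lambda>t. - f t) (\<lambda>t. - y t)"
    by (rule primitive_on_linear[OF p]) (rule bounded_linear_minus, rule bounded_linear_ident)
  obtain Z2 where Z2: "negligible Z2"
    "\<And>x \<eta>. x \<in> {a..b} - Z2 \<Longrightarrow> \<eta> > 0 \<Longrightarrow> \<exists>e>0. \<forall>s t. a \<le> s \<longrightarrow> s \<le> x \<longrightarrow> x \<le> t \<longrightarrow> t \<le> b \<longrightarrow>
       t - s < e \<longrightarrow> - y t - - y s \<le> (- f x + \<eta>) * (t - s)"
    using primitive_on_upper_slope[OF p', of M] M by auto
  show thesis
  proof (rule that[of "Z1 \<union> Z2"])
    show "negligible (Z1 \<union> Z2)" using Z1 Z2 by (simp add: negligible_Un)
    fix x assume x: "x \<in> {a..b} - (Z1 \<union> Z2)"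
    show "(y has_vector_derivative f x) (at x within {a..b})"
      unfolding has_vector_derivative_def has_derivative_within_alt
    proof (intro conjI allI impI)
      show "bounded_linear (\<lambda>h. h *\<^sub>R f x)" by (rule bounded_linear_scaleR_left)
      fix \<eta> :: real assume "\<eta> > 0"
      obtain e1 where e1: "e1 > 0" "\<forall>s t. a \<le> s \<longrightarrow> s \<le> x \<longrightarrow> x \<le> t \<longrightarrow> t \<le> b \<longrightarrow>
         t - s < e1 \<longrightarrow> y t - y s \<le> (f x + \<eta>) * (t - s)"
        using Z1(2)[of x \<eta>] x \<open>\<eta> > 0\<close> by blast
      obtain e2 where e2: "e2 > 0" "\<forall>s t. a \<le> s \<longrightarrow> s \<le> x \<longrightarrow> x \<le> t \<longrightarrow> t \<le> b \<longrightarrow>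
         t - s < e2 \<longrightarrow> - y t - - y s \<le> (- f x + \<eta>) * (t - s)"
        using Z2(2)[of x \<eta>] x \<open>\<eta> > 0\<close> by blast
      have "norm (y z - y x - (z - x) *\<^sub>R f x) \<le> \<eta> * norm (z - x)"
        if z: "z \<in> {a..b}" "norm (z - x) < min e1 e2" for z
      proof (cases "x \<le> z")
        case True
        have "y z - y x \<le> (f x + \<eta>) * (z - x)" "- y z - - y x \<le> (- f x + \<eta>) * (z - x)"
          using e1(2)[rule_format, of x z] e2(2)[rule_format, of x z] x z True by auto
        then show ?thesis using True by (auto simp: algebra_simps abs_le_iff)
      next
        case False
        have "y x - y z \<le> (f x + \<eta>) * (x - z)" "- y x - - y z \<le> (- f x + \<eta>) * (x - z)"
          using e1(2)[rule_format, of z x] e2(2)[rule_format, of z x] x z False by auto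
        then show ?thesis using False by (auto simp: algebra_simps abs_le_iff)
      qed
      then show "\<exists>d>0. \<forall>z\<in>{a..b}. norm (z - x) < d \<longrightarrow> norm (y z - y x - (z - x) *\<^sub>R f x) \<le> \<eta> * norm (z - x)"
        using e1(1) e2(1) by (intro exI[of _ "min e1 e2"]) auto
    qed
  qed
qed

theorem primitive_on_derivative:
  fixes F :: "real \<Rightarrow> 'a::euclidean_space"
  assumes p: "primitive_on a b F y" and M: "\<And>t. t \<in> {a..b} \<Longrightarrow> norm (F t) \<le> M"
  obtains Z where "negligible Z"
    "\<And>x. x \<in> {a..b} - Z \<Longrightarrow> (y has_vector_derivative F x) (at x within {a..b})"
proof -
  have "\<exists>Z. negligible Z \<and> (\<forall>x\<in>{a..b} - Z. ((\<lambda>t. y t \<bullet> i) has_vector_derivative F x \<bullet> i) (at x within {a..b}))"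
    if "i \<in> Basis" for i
  proof -
    have "primitive_on a b (\<lambda>t. F t \<bullet> i) (\<lambda>t. y t \<bullet> i)"
      by (rule primitive_on_linear[OF p bounded_linear_inner_left])
    moreover have "\<bar>F t \<bullet> i\<bar> \<le> M" if "t \<in> {a..b}" for t
      using Basis_le_norm[OF \<open>i \<in> Basis\<close>, of "F t"] M[OF that] by linarith
    ultimately show ?thesis by (rule primitive_on_derivative_real) auto
  qed
  then obtain Z where Z: "\<And>i. i \<in> Basis \<Longrightarrow> negligible (Z i)"
    "\<And>i x. i \<in> Basis \<Longrightarrow> x \<in> {a..b} - Z i \<Longrightarrow>
       ((\<lambda>t. y t \<bullet> i) has_vector_derivative F x \<bullet> i) (at x within {a..b})"
    by metis
  show thesis
  proof (rule that[of "\<Union>i\<in>Basis. Z i"])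
    show "negligible (\<Union>i\<in>Basis. Z i)" using Z(1) by (intro negligible_Union) auto
    show "(y has_vector_derivative F x) (at x within {a..b})" if "x \<in> {a..b} - (\<Union>i\<in>Basis. Z i)" for x
      unfolding has_vector_derivative_def
      by (subst has_derivative_componentwise_within)
        (use Z(2)[of _ x] that in \<open>auto simp: has_vector_derivative_def\<close>)
  qed
qed

section \<open>Absolute continuity of Lipschitz functions and of products; integration by
  parts\<close>

lemma lipschitz_imp_absolutely_continuous:
  assumes lip: "\<And>s t. a \<le> s \<Longrightarrow> s \<le> t \<Longrightarrow> t \<le> b \<Longrightarrow> norm (y t - y s) \<le> M * (t - s)"
  shows "absolutely_continuous_on_interval a b y"
  unfolding absolutely_continuous_on_interval_def
proof (intro allI impI)
  fix \<epsilon> :: real assume "\<epsilon> > 0"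
  \<comment> \<open>No sign of \<open>M\<close> is assumed, and \<open>M\<close> may be zero;
    \<open>\<bar>M\<bar> + 1\<close> is a safe divisor.\<close>
  have M: "\<bar>M\<bar> + 1 > 0" by simp
  have "(\<Sum>(s, t)\<in>\<I>. norm (y t - y s)) < \<epsilon>"
    if I: "\<forall>(s, t)\<in>\<I>. a \<le> s \<and> s \<le> t \<and> t \<le> b" "(\<Sum>(s, t)\<in>\<I>. t - s) < \<epsilon> / (\<bar>M\<bar> + 1)" for \<I>
  proof -
    have "(\<Sum>(s, t)\<in>\<I>. norm (y t - y s)) \<le> (\<Sum>(s, t)\<in>\<I>. (\<bar>M\<bar> + 1) * (t - s))"
    proof (rule sum_mono, clarify)
      fix s t assume "(s, t) \<in> \<I>"
      then have st: "a \<le> s" "s \<le> t" "t \<le> b" using I(1) by auto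
      have "M * (t - s) \<le> (\<bar>M\<bar> + 1) * (t - s)" using st by (intro mult_right_mono) auto
      then show "norm (y t - y s) \<le> (\<bar>M\<bar> + 1) * (t - s)" using lip[OF st] by linarith
    qed
    also have "\<dots> = (\<bar>M\<bar> + 1) * (\<Sum>(s, t)\<in>\<I>. t - s)"
      by (simp add: sum_distrib_left case_prod_unfold)
    also have "\<dots> < \<epsilon>" using I(2) M by (simp add: pos_less_divide_eq mult.commute)
    finally show ?thesis .
  qed
  then show "\<exists>\<delta>>0. \<forall>\<I>. finite \<I> \<longrightarrow> (\<forall>(s, t)\<in>\<I>. a \<le> s \<and> s \<le> t \<and> t \<le> b) \<longrightarrow>
     pairwise (\<lambda>(s, t) (s', t'). {s<..<t} \<inter> {s'<..<t'} = {}) \<I> \<longrightarrow>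
     (\<Sum>(s, t)\<in>\<I>. t - s) < \<delta> \<longrightarrow> (\<Sum>(s, t)\<in>\<I>. norm (y t - y s)) < \<epsilon>"
    using \<open>\<epsilon> > 0\<close> M by (intro exI[of _ "\<epsilon> / (\<bar>M\<bar> + 1)"]) auto
qed

lemma absolutely_continuous_subinterval:
  assumes "absolutely_continuous_on_interval a b y" "a \<le> a'" "b' \<le> b"
  shows "absolutely_continuous_on_interval a' b' y"
  unfolding absolutely_continuous_on_interval_def
proof (intro allI impI)
  fix e :: real assume "e > 0"
  with assms(1) obtain d where d: "d > 0"
    "\<And>\<I>. finite \<I> \<Longrightarrow> (\<forall>(s, t)\<in>\<I>. a \<le> s \<and> s \<le> t \<and> t \<le> b) \<Longrightarrow>
        pairwise (\<lambda>(s, t) (s', t'). {s<..<t} \<inter> {s'<..<t'} = {}) \<I> \<Longrightarrow>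
        (\<Sum>(s, t)\<in>\<I>. t - s) < d \<Longrightarrow> (\<Sum>(s, t)\<in>\<I>. norm (y t - y s)) < e"
    unfolding absolutely_continuous_on_interval_def by meson
  have "\<forall>(s, t)\<in>\<I>. a \<le> s \<and> s \<le> t \<and> t \<le> b" if "\<forall>(s, t)\<in>\<I>. a' \<le> s \<and> s \<le> t \<and> t \<le> b'" for \<I>
    using that assms(2,3) by fastforce
  then show "\<exists>d>0. \<forall>\<I>. finite \<I> \<longrightarrow> (\<forall>(s, t)\<in>\<I>. a' \<le> s \<and> s \<le> t \<and> t \<le> b') \<longrightarrow>
     pairwise (\<lambda>(s, t) (s', t'). {s<..<t} \<inter> {s'<..<t'} = {}) \<I> \<longrightarrow>
     (\<Sum>(s, t)\<in>\<I>. t - s) < d \<longrightarrow> (\<Sum>(s, t)\<in>\<I>. norm (y t - y s)) < e"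
    using d by (intro exI[of _ d]) auto
qed

lemma absolutely_continuous_inner:
  fixes p q :: "real \<Rightarrow> 'a::euclidean_space"
  assumes p: "absolutely_continuous_on_interval a b p" and q: "absolutely_continuous_on_interval a b q"
  shows "absolutely_continuous_on_interval a b (\<lambda>t. p t \<bullet> q t)"
  unfolding absolutely_continuous_on_interval_def
proof (intro allI impI)
  fix \<epsilon> :: real assume "\<epsilon> > 0"
  have "bounded (p ` {a..b})" "bounded (q ` {a..b})"
    using p q by (auto intro!: compact_imp_bounded compact_continuous_image absolutely_continuous_imp_continuous_on)
  then obtain P Q where P: "P > 0" "\<And>t. t \<in> {a..b} \<Longrightarrow> norm (p t) \<le> P"
    and Q: "Q > 0" "\<And>t. t \<in> {a..b} \<Longrightarrow> norm (q t) \<le> Q"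
    unfolding bounded_pos by auto
  have "\<epsilon> / (2 * Q) > 0" using \<open>\<epsilon> > 0\<close> Q(1) by simp
  then obtain d1 where d1: "d1 > 0"
    "\<And>\<I>. finite \<I> \<Longrightarrow> (\<forall>(s, t)\<in>\<I>. a \<le> s \<and> s \<le> t \<and> t \<le> b) \<Longrightarrow>
        pairwise (\<lambda>(s, t) (s', t'). {s<..<t} \<inter> {s'<..<t'} = {}) \<I> \<Longrightarrow>
        (\<Sum>(s, t)\<in>\<I>. t - s) < d1 \<Longrightarrow> (\<Sum>(s, t)\<in>\<I>. norm (p t - p s)) < \<epsilon> / (2 * Q)"
    by (rule absolutely_continuousE[OF p]) blast
  have "\<epsilon> / (2 * P) > 0" using \<open>\<epsilon> > 0\<close> P(1) by simp
  then obtain d2 where d2: "d2 > 0"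
    "\<And>\<I>. finite \<I> \<Longrightarrow> (\<forall>(s, t)\<in>\<I>. a \<le> s \<and> s \<le> t \<and> t \<le> b) \<Longrightarrow>
        pairwise (\<lambda>(s, t) (s', t'). {s<..<t} \<inter> {s'<..<t'} = {}) \<I> \<Longrightarrow>
        (\<Sum>(s, t)\<in>\<I>. t - s) < d2 \<Longrightarrow> (\<Sum>(s, t)\<in>\<I>. norm (q t - q s)) < \<epsilon> / (2 * P)"
    by (rule absolutely_continuousE[OF q]) blast
  have "(\<Sum>(s, t)\<in>\<I>. norm (p t \<bullet> q t - p s \<bullet> q s)) < \<epsilon>"
    if I: "finite \<I>" "\<forall>(s, t)\<in>\<I>. a \<le> s \<and> s \<le> t \<and> t \<le> b"
      "pairwise (\<lambda>(s, t) (s', t'). {s<..<t} \<inter> {s'<..<t'} = {}) \<I>" "(\<Sum>(s, t)\<in>\<I>. t - s) < min d1 d2" for \<I>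
  proof -
    have "(\<Sum>(s, t)\<in>\<I>. norm (p t \<bullet> q t - p s \<bullet> q s)) \<le>
        (\<Sum>(s, t)\<in>\<I>. Q * norm (p t - p s) + P * norm (q t - q s))"
    proof (rule sum_mono, clarify)
      fix s t assume "(s, t) \<in> \<I>"
      then have st: "s \<in> {a..b}" "t \<in> {a..b}" using I(2) by auto
      have "p t \<bullet> q t - p s \<bullet> q s = (p t - p s) \<bullet> q t + p s \<bullet> (q t - q s)"
        by (simp add: inner_simps)
      also have "norm \<dots> \<le> norm (p t - p s) * norm (q t) + norm (p s) * norm (q t - q s)"
        by (rule norm_triangle_le, rule add_mono) (auto simp: Cauchy_Schwarz_ineq2)
      also have "\<dots> \<le> norm (p t - p s) * Q + P * norm (q t - q s)"
        using P(2)[OF st(1)] Q(2)[OF st(2)] by (intro add_mono mult_left_mono mult_right_mono) auto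
      finally show "norm (p t \<bullet> q t - p s \<bullet> q s) \<le> Q * norm (p t - p s) + P * norm (q t - q s)"
        by (simp add: mult.commute)
    qed
    also have "\<dots> = Q * (\<Sum>(s, t)\<in>\<I>. norm (p t - p s)) + P * (\<Sum>(s, t)\<in>\<I>. norm (q t - q s))"
      by (simp add: sum_distrib_left case_prod_unfold sum.distrib)
    also have "\<dots> < Q * (\<epsilon> / (2 * Q)) + P * (\<epsilon> / (2 * P))"
      using d1(2)[OF I(1,2,3)] d2(2)[OF I(1,2,3)] I(4) P Q by (intro add_strict_mono mult_strict_left_mono) auto
    also have "\<dots> = \<epsilon>" using P(1) Q(1) by simp
    finally show ?thesis .
  qed
  then show "\<exists>\<delta>>0. \<forall>\<I>. finite \<I> \<longrightarrow> (\<forall>(s, t)\<in>\<I>. a \<le> s \<and> s \<le> t \<and> t \<le> b) \<longrightarrow>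
     pairwise (\<lambda>(s, t) (s', t'). {s<..<t} \<inter> {s'<..<t'} = {}) \<I> \<longrightarrow>
     (\<Sum>(s, t)\<in>\<I>. t - s) < \<delta> \<longrightarrow> (\<Sum>(s, t)\<in>\<I>. norm (p t \<bullet> q t - p s \<bullet> q s)) < \<epsilon>"
    using d1(1) d2(1) by (intro exI[of _ "min d1 d2"]) auto
qed

text \<open>Integration by parts for the pairing of the adjoint arc with the displacement of a
  trajectory: the product is again absolutely continuous, hence recovered from its derivative off
  \<open>Z\<close>.\<close>

lemma has_integral_inner_product:
  fixes p q :: "real \<Rightarrow> 'a::euclidean_space"
  assumes p: "absolutely_continuous_on_interval a b p" and q: "absolutely_continuous_on_interval a b q"
    and "a \<le> b" "negligible Z"
    and dp: "\<And>t. t \<in> {a..b} - Z \<Longrightarrow> (p has_vector_derivative P t) (at t within {a..b})"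
    and dq: "\<And>t. t \<in> {a..b} - Z \<Longrightarrow> (q has_vector_derivative Q t) (at t within {a..b})"
  shows "((\<lambda>t. P t \<bullet> q t + p t \<bullet> Q t) has_integral (p b \<bullet> q b - p a \<bullet> q a)) {a..b}"
proof (rule absolutely_continuous_has_integral[OF \<open>a \<le> b\<close> absolutely_continuous_inner[OF p q] \<open>negligible Z\<close>])
  fix t assume t: "t \<in> {a..b} - Z"
  have "((\<lambda>t. p t \<bullet> q t) has_derivative (\<lambda>h. p t \<bullet> (h *\<^sub>R Q t) + (h *\<^sub>R P t) \<bullet> q t)) (at t within {a..b})"
    using dp[OF t] dq[OF t] unfolding has_vector_derivative_def by (rule has_derivative_inner)
  then show "((\<lambda>t. p t \<bullet> q t) has_vector_derivative P t \<bullet> q t + p t \<bullet> Q t) (at t within {a..b})"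
    unfolding has_vector_derivative_def by (simp add: algebra_simps)
qed

section \<open>Controlled trajectories\<close>

text \<open>The integrating factor \<open>exp (- L * (t - a))\<close> makes the right-hand side of
  the hypothesis nonincreasing, and its value at \<open>a\<close> is \<open>A\<close>. Hence neither
  \<open>m\<close> nor \<open>A\<close> needs a sign.\<close>

lemma gronwall:
  fixes m :: "real \<Rightarrow> real"
  assumes m: "continuous_on {a..b} m" and "L \<ge> 0"
    and le: "\<And>s. s \<in> {a..b} \<Longrightarrow> m s \<le> A + L * integral {a..s} m" and s: "s \<in> {a..b}"
  shows "m s \<le> A * exp (L * (s - a))"
proof -
  define \<phi> where "\<phi> t = exp (- L * (t - a)) * (A + L * integral {a..t} m)" for t
  have int: "continuous_on {a..b} (\<lambda>t. integral {a..t} m)"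
    by (rule indefinite_integral_continuous_1) (rule integrable_continuous_real[OF m])
  have "\<phi> s \<le> \<phi> a"
  proof (rule DERIV_nonpos_imp_decreasing_open[of a s \<phi>])
    show "a \<le> s" using s by simp
    show "continuous_on {a..s} \<phi>"
      unfolding \<phi>_def using s by (intro continuous_intros continuous_on_subset[OF int]) auto
    fix t assume t: "a < t" "t < s"
    have "((\<lambda>t. integral {a..t} m) has_real_derivative m t) (at t within {a..b})"
      by (rule integral_has_real_derivative[OF m]) (use t s in auto)
    then have "((\<lambda>t. integral {a..t} m) has_real_derivative m t) (at t)"
      using at_within_Icc_at[of a t b] t s by auto
    then have "(\<phi> has_real_derivative exp (- L * (t - a)) * (L * (m t - (A + L * integral {a..t} m)))) (at t)"
      unfolding \<phi>_def by (auto intro!: derivative_eq_intros simp: algebra_simps)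
    moreover have "exp (- L * (t - a)) * (L * (m t - (A + L * integral {a..t} m))) \<le> 0"
      using le[of t] t s \<open>L \<ge> 0\<close> by (intro mult_nonneg_nonpos) auto
    ultimately show "\<exists>y. (\<phi> has_real_derivative y) (at t) \<and> y \<le> 0" by blast
  qed
  then have "exp (- L * (s - a)) * (A + L * integral {a..s} m) \<le> A"
    by (simp add: \<phi>_def)
  then have "exp (L * (s - a)) * (exp (- L * (s - a)) * (A + L * integral {a..s} m)) \<le> exp (L * (s - a)) * A"
    by (rule mult_left_mono) simp
  then show ?thesis using le[OF s] by (simp add: mult.assoc[symmetric] exp_add[symmetric] mult.commute)
qed

section \<open>Caratheodory solutions as integral equations\<close>

lemma caratheodory_derivative:
  assumes "caratheodory_solution I F y" "{a..b} \<subseteq> I" "I \<in> sets lebesgue"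
  obtains Z where "negligible Z"
    "\<And>t. t \<in> {a..b} - Z \<Longrightarrow> (y has_vector_derivative F t (y t)) (at t within {a..b})"
proof -
  have "AE t in lebesgue. t \<in> I \<longrightarrow> (y has_vector_derivative F t (y t)) (at t within I)"
    using assms(1,3) unfolding caratheodory_solution_def by (subst (asm) AE_restrict_space_iff) auto
  then obtain Z where "negligible Z"
    "{t. \<not> (t \<in> I \<longrightarrow> (y has_vector_derivative F t (y t)) (at t within I))} \<subseteq> Z"
    unfolding eventually_ae_filter_negligible by blast
  then show thesis
    using assms(2) by (intro that[of Z]) (auto intro!: has_vector_derivative_within_subset[of y _ _ I "{a..b}"])
qed

lemma caratheodory_primitive_on:
  fixes y :: "real \<Rightarrow> 'a::euclidean_space"
  assumes y: "caratheodory_solution I F y" "{a..b} \<subseteq> I" "I \<in> sets lebesgue"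
  shows "primitive_on a b (\<lambda>t. F t (y t)) y"
  unfolding primitive_on_def
proof (intro allI impI)
  fix s t assume st: "a \<le> s" "s \<le> t" "t \<le> b"
  obtain Z where Z: "negligible Z"
    "\<And>t. t \<in> {a..b} - Z \<Longrightarrow> (y has_vector_derivative F t (y t)) (at t within {a..b})"
    using caratheodory_derivative[OF y] by blast
  show "((\<lambda>t. F t (y t)) has_integral y t - y s) {s..t}"
  proof (rule absolutely_continuous_has_integral[OF \<open>s \<le> t\<close> _ Z(1)])
    show "absolutely_continuous_on_interval s t y"
      using y st unfolding caratheodory_solution_def by (meson atLeastatMost_subset_iff order_trans)
    show "(y has_vector_derivative F x (y x)) (at x within {s..t})" if "x \<in> {s..t} - Z" for x
      by (rule has_vector_derivative_within_subset[OF Z(2)]) (use that st in auto)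
  qed
qed

text \<open>The bound on the right-hand side makes \<open>y\<close> Lipschitz. The derivative
  theorem is available on compact intervals only, so the null sets of all \<open>{0..real n}\<close>
  are united; at \<open>t < real n\<close> differentiation within \<open>{0..}\<close> and within
  \<open>{0..real n}\<close> agree.\<close>

lemma primitive_on_caratheodory:
  fixes y :: "real \<Rightarrow> 'a::euclidean_space"
  assumes y: "\<And>T. primitive_on 0 T (\<lambda>t. F t (y t)) y" and M: "\<And>t. t \<ge> 0 \<Longrightarrow> norm (F t (y t)) \<le> M"
  shows "caratheodory_solution {0..} F y"
  unfolding caratheodory_solution_def
proof (intro conjI allI impI)
  fix a b :: real assume "a \<le> b" "{a..b} \<subseteq> {0..}"
  then have "a \<ge> 0" by auto
  show "absolutely_continuous_on_interval a b y"
  proof (rule lipschitz_imp_absolutely_continuous)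
    fix s t assume "a \<le> s" "s \<le> t" "t \<le> b"
    then show "norm (y t - y s) \<le> M * (t - s)"
      using primitive_on_lipschitz[OF y[of b], of M s t] M \<open>a \<ge> 0\<close> by auto
  qed
next
  have "\<exists>Z. negligible Z \<and> (\<forall>t\<in>{0..real n} - Z. (y has_vector_derivative F t (y t)) (at t within {0..real n}))" for n
    using primitive_on_derivative[OF y[of "real n"], of M] M by (metis atLeastAtMost_iff)
  then obtain Z where Z: "\<And>n. negligible (Z n)"
    "\<And>n t. t \<in> {0..real n} - Z n \<Longrightarrow> (y has_vector_derivative F t (y t)) (at t within {0..real n})"
    by metis
  have "(y has_vector_derivative F t (y t)) (at t within {0..})" if t: "t \<ge> 0" "t \<notin> (\<Union>n. Z n)" for t
  proof -
    obtain n where n: "t < real n" using reals_Archimedean2 by blast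
    have "at t within {0..} = at t within {0..real n}"
      by (rule at_within_nhd[of _ "{..<real n}"]) (use n in auto)
    then show ?thesis using Z(2)[of t n] t n by auto
  qed
  moreover have "negligible (\<Union>n. Z n)" using Z(1) by (intro negligible_Union_nat) auto
  ultimately have "AE t in lebesgue. t \<in> {0..} \<longrightarrow> (y has_vector_derivative F t (y t)) (at t within {0..})"
    unfolding eventually_ae_filter_negligible by (intro exI[of _ "\<Union>n. Z n"]) auto
  then show "AE t in lebesgue_on {0..}. (y has_vector_derivative F t (y t)) (at t within {0..})"
    by (subst AE_restrict_space_iff) auto
qed

lemma primitive_on_shift:
  assumes "primitive_on a b F y"
  shows "primitive_on (a + c) (b + c) (\<lambda>t. F (t - c)) (\<lambda>t. y (t - c))"
  unfolding primitive_on_def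
proof (intro allI impI)
  fix s t assume "a + c \<le> s" "s \<le> t" "t \<le> b + c"
  then have "(F has_integral y (t - c) - y (s - c)) {s - c..t - c}"
    using assms by (auto simp: primitive_on_def)
  then show "((\<lambda>t. F (t - c)) has_integral y (t - c) - y (s - c)) {s..t}"
    using has_integral_shift_Icc_real[of F "- c" _ s t] by (simp add: o_def)
qed

text \<open>The integrand switches with \<open><\<close> and the primitive with
  \<open>\<le>\<close>: the single point \<open>b\<close> does not affect the integral, and both
  primitives agree there.\<close>

lemma primitive_on_combine:
  assumes p: "primitive_on a b F y" and q: "primitive_on b c G z" and "z b = y b" and "a \<le> b" "b \<le> c"
  shows "primitive_on a c (\<lambda>t. if t < b then F t else G t) (\<lambda>t. if t \<le> b then y t else z t)"
    (is "primitive_on a c ?H ?x")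
  unfolding primitive_on_def
proof (intro allI impI)
  fix s t assume st: "a \<le> s" "s \<le> t" "t \<le> c"
  have 1: "(?H has_integral y t - y s) {s..t}" if "a \<le> s" "s \<le> t" "t \<le> b" for s t
    by (rule has_integral_spike_finite[of "{b}" _ _ F]) (use p that in \<open>auto simp: primitive_on_def\<close>)
  have 2: "(?H has_integral z t - z s) {s..t}" if "b \<le> s" "s \<le> t" "t \<le> c" for s t
    by (rule has_integral_spike_finite[of "{b}" _ _ G]) (use q that in \<open>auto simp: primitive_on_def\<close>)
  consider "t \<le> b" | "b \<le> s" "b < t" | "s < b" "b < t" by linarith
  then show "(?H has_integral ?x t - ?x s) {s..t}"
  proof cases
    assume "t \<le> b"
    then show ?thesis using 1[of s t] st by simp
  next
    assume "b \<le> s" "b < t"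
    then have "?x t = z t" "?x s = z s" using st \<open>z b = y b\<close> by auto
    then show ?thesis using 2[of s t] \<open>b \<le> s\<close> st by simp
  next
    assume 3: "s < b" "b < t"
    have "(?H has_integral (y b - y s) + (z t - z b)) {s..t}"
      by (rule has_integral_combine[of s b t]) (use 1[of s b] 2[of b t] 3 st in auto)
    then show ?thesis using 3 \<open>z b = y b\<close> by simp
  qed
qed

lemma has_integral_imp_primitive_on:
  assumes "\<And>t. t \<in> {0..T} \<Longrightarrow> (F has_integral (w t - P)) {0..t}"
  shows "primitive_on 0 T F w"
  unfolding primitive_on_def
proof (intro allI impI)
  fix s t :: real assume st: "0 \<le> s" "s \<le> t" "t \<le> T"
  have 1: "(F has_integral w t - P) {0..t}" and 2: "(F has_integral w s - P) {0..s}"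
    using assms st by auto
  have "F integrable_on {s..t}"
    by (rule integrable_subinterval_real[of _ 0 t]) (use 1 st in auto)
  moreover have "integral {0..s} F + integral {s..t} F = integral {0..t} F"
    by (rule Henstock_Kurzweil_Integration.integral_combine) (use 1 st in auto)
  then have "integral {s..t} F = w t - w s"
    using integral_unique[OF 1] integral_unique[OF 2] by (simp add: algebra_simps)
  ultimately show "(F has_integral w t - w s) {s..t}"
    by (metis integrable_integral)
qed

section \<open>Existence of trajectories for measurable controls\<close>

locale control_system =
  fixes U :: "(real ^ 'm) set" and f :: "real ^ 'd \<Rightarrow> real ^ 'm \<Rightarrow> real ^ 'd"
    and r :: "real ^ 'd \<Rightarrow> real ^ 'm \<Rightarrow> real" and N L :: real
  assumes U_nonempty: "U \<noteq> {}" and U_compact: "compact U" and N_pos: "N > 0" and L_pos: "L > 0"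
    and f_cont: "continuous_on (UNIV \<times> U) (\<lambda>(x, \<omega>). f x \<omega>)"
    and f_bound: "\<And>x \<omega>. \<omega> \<in> U \<Longrightarrow> norm (f x \<omega>) \<le> N"
    and f_lipschitz: "\<And>x y \<omega>. \<omega> \<in> U \<Longrightarrow> norm (f y \<omega> - f x \<omega>) \<le> L * norm (y - x)"
    and r_cont: "continuous_on (UNIV \<times> U) (\<lambda>(x, \<omega>). r x \<omega>)"
    and r_lipschitz: "\<And>x y \<omega>. \<omega> \<in> U \<Longrightarrow> \<bar>r y \<omega> - r x \<omega>\<bar> \<le> L * norm (y - x)"
begin

text \<open>Since \<open>h\<close> is continuous on \<open>UNIV \<times> U\<close> only, the pair of
  state and control is taken as a measurable map into the Borel space restricted to that
  set.\<close>

lemma measurable_along: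
  fixes h :: "real ^ 'd \<Rightarrow> real ^ 'm \<Rightarrow> 'b::euclidean_space"
  assumes w: "continuous_on {0..} w" and v: "admissible_control U v"
    and h: "continuous_on (UNIV \<times> U) (\<lambda>(x, \<omega>). h x \<omega>)"
  shows "(\<lambda>s. h (w s) (v s)) \<in> borel_measurable (lebesgue_on {0..})"
proof -
  have "(\<lambda>s. (w s, v s)) \<in> borel_measurable (lebesgue_on {0..})"
    using v continuous_imp_measurable_on_sets_lebesgue[OF w]
    by (intro borel_measurable_Pair) (auto simp: admissible_control_def)
  then have "(\<lambda>s. (w s, v s)) \<in> measurable (lebesgue_on {0..}) (restrict_space borel (UNIV \<times> U))"
    by (rule measurable_restrict_space2[rotated]) (use v in \<open>auto simp: admissible_control_def space_restrict_space\<close>)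
  from measurable_compose[OF this borel_measurable_continuous_on_restrict[OF h]]
  show ?thesis by simp
qed

lemma bounded_along:
  fixes h :: "real ^ 'd \<Rightarrow> real ^ 'm \<Rightarrow> 'b::euclidean_space" and w :: "real \<Rightarrow> real ^ 'd"
  assumes w: "continuous_on {a..b} w" and h: "continuous_on (UNIV \<times> U) (\<lambda>(x, \<omega>). h x \<omega>)"
  obtains B where "B > 0" "\<And>s \<omega>. s \<in> {a..b} \<Longrightarrow> \<omega> \<in> U \<Longrightarrow> norm (h (w s) \<omega>) \<le> B"
proof -
  have "compact ((\<lambda>(x, \<omega>). h x \<omega>) ` (w ` {a..b} \<times> U))"
    by (intro compact_continuous_image continuous_on_subset[OF h] compact_Times U_compact w compact_Icc) auto
  then obtain B where "B > 0" "\<forall>z\<in>(\<lambda>(x, \<omega>). h x \<omega>) ` (w ` {a..b} \<times> U). norm z \<le> B"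
    using compact_imp_bounded bounded_pos by metis
  then show thesis by (intro that[of B]) auto
qed

lemma integrable_along:
  fixes h :: "real ^ 'd \<Rightarrow> real ^ 'm \<Rightarrow> 'b::euclidean_space"
  assumes w: "continuous_on {0..} w" and v: "admissible_control U v"
    and h: "continuous_on (UNIV \<times> U) (\<lambda>(x, \<omega>). h x \<omega>)" and "0 \<le> a"
  shows "(\<lambda>s. h (w s) (v s)) integrable_on {a..b}"
proof -
  have "continuous_on {a..b} w" using \<open>0 \<le> a\<close> by (intro continuous_on_subset[OF w]) auto
  then obtain B where B: "\<And>s \<omega>. s \<in> {a..b} \<Longrightarrow> \<omega> \<in> U \<Longrightarrow> norm (h (w s) \<omega>) \<le> B"
    using bounded_along[OF _ h] by metis
  show ?thesis
  proof (rule measurable_bounded_by_integrable_imp_integrable)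
    show "(\<lambda>s. h (w s) (v s)) \<in> borel_measurable (lebesgue_on {a..b})"
      by (rule measurable_restrict_mono[OF measurable_along[OF w v h]]) (use \<open>0 \<le> a\<close> in auto)
    show "norm (h (w s) (v s)) \<le> B" if "s \<in> {a..b}" for s
      using B[OF that] v that \<open>0 \<le> a\<close> by (auto simp: admissible_control_def)
  qed auto
qed

definition solves :: "real ^ 'd \<Rightarrow> (real \<Rightarrow> real ^ 'm) \<Rightarrow> (real \<Rightarrow> real ^ 'd) \<Rightarrow> bool" where
  "solves P v w \<longleftrightarrow> w 0 = P \<and> (\<forall>T. primitive_on 0 T (\<lambda>s. f (w s) (v s)) w)"

lemma admissible_mem: "admissible_control U v \<Longrightarrow> 0 \<le> s \<Longrightarrow> v s \<in> U"
  by (simp add: admissible_control_def)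

lemma admissible_const: "\<omega> \<in> U \<Longrightarrow> admissible_control U (\<lambda>_. \<omega>)"
  by (simp add: admissible_control_def)

lemma solves_lipschitz:
  assumes "admissible_control U v" "solves P v w" "0 \<le> s" "0 \<le> t"
  shows "norm (w t - w s) \<le> N * \<bar>t - s\<bar>"
  using primitive_on_lipschitz[of 0 "max s t" "\<lambda>s. f (w s) (v s)" w N s t] assms
  by (auto simp: solves_def f_bound admissible_mem)

lemma solves_continuous:
  assumes "admissible_control U v" "solves P v w"
  shows "continuous_on {0..} w"
proof -
  have "N-lipschitz_on {0..} w"
    using solves_lipschitz[OF assms] N_pos
    by (intro lipschitz_onI) (auto simp: dist_norm norm_minus_commute abs_minus_commute)
  then show ?thesis by (rule lipschitz_on_continuous_on)
qed

lemma trajectory_iff_solves: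
  assumes "admissible_control U v"
  shows "trajectory f P v w \<longleftrightarrow> solves P v w"
proof
  assume "trajectory f P v w"
  then show "solves P v w"
    unfolding trajectory_def solves_def
    using caratheodory_primitive_on[of "{0..}" "\<lambda>s z. f z (v s)" w 0] by auto
next
  assume "solves P v w"
  then show "trajectory f P v w"
    unfolding trajectory_def solves_def
    using primitive_on_caratheodory[of "\<lambda>s z. f z (v s)" w N] assms by (auto simp: f_bound admissible_mem)
qed

text \<open>Measuring \<open>y t - P\<close> in the weight \<open>exp (2 * L * t)\<close> makes the Picard operator a contraction on
  the whole half-line.\<close>

lemma solves_exists:
  assumes v: "admissible_control U v"
  obtains w where "solves P v w"
proof -
  \<comment> \<open>The unknown bounded function \<open>w\<close> encodes the trajectory
    \<open>P + exp (2 * L * s) *\<^sub>R w s\<close>.\<close>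
  define \<psi> where "\<psi> = (\<lambda>(w :: real \<Rightarrow>\<^sub>C (real ^ 'd)) s. f (P + exp (2 * L * s) *\<^sub>R w s) (v s))"
  \<comment> \<open>Freezing time at 0 for negative \<open>t\<close> places everything in the
    complete space of bounded continuous functions on the whole line.\<close>
  define J where "J = (\<lambda>w t. integral {0..max 0 t} (\<psi> w))"
  define \<Phi> where "\<Phi> = (\<lambda>w t. exp (- 2 * L * max 0 t) *\<^sub>R J w t)"
  have c: "continuous_on {0..} (\<lambda>s. P + exp (2 * L * s) *\<^sub>R apply_bcontfun w s)" for w
    by (intro continuous_intros continuous_on_apply_bcontfun)
  have \<psi>: "\<psi> w integrable_on {a..b}" if "0 \<le> a" for w a b
    unfolding \<psi>_def by (rule integrable_along[OF c v f_cont that])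
  have \<psi>N: "norm (\<psi> w s) \<le> N" if "0 \<le> s" for w s
    unfolding \<psi>_def using v that by (intro f_bound admissible_mem)
  have prim: "primitive_on 0 T (\<psi> w) (J w)" for T w
    by (rule has_integral_imp_primitive_on[where P = 0]) (use \<psi> in \<open>auto simp: J_def intro!: integrable_integral\<close>)
  have Jlip: "norm (J w t - J w s) \<le> N * \<bar>t - s\<bar>" for w s t
  proof -
    have "J w t = J w (max 0 t)" "J w s = J w (max 0 s)" by (simp_all add: J_def)
    then have "norm (J w t - J w s) \<le> N * \<bar>max 0 t - max 0 s\<bar>"
      using primitive_on_lipschitz[OF prim[of "max (max 0 s) (max 0 t)" w], of N "max 0 s" "max 0 t"] \<psi>N by auto
    also have "\<dots> \<le> N * \<bar>t - s\<bar>" using N_pos by (intro mult_left_mono) auto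
    finally show ?thesis .
  qed
  have J0: "J w 0 = 0" for w by (simp add: J_def)
  have "continuous_on UNIV (J w)" for w
  proof -
    have "N-lipschitz_on UNIV (J w)"
      using Jlip N_pos by (intro lipschitz_onI) (auto simp: dist_norm norm_minus_commute abs_minus_commute)
    then show ?thesis by (rule lipschitz_on_continuous_on)
  qed
  then have \<Phi>c: "continuous_on UNIV (\<Phi> w)" for w
    unfolding \<Phi>_def by (intro continuous_intros)
  \<comment> \<open>\<open>J\<close> grows at most linearly with rate \<open>N\<close>, and
    \<open>t \<le> exp (2 * L * t) / (2 * L)\<close> for nonnegative \<open>t\<close>, so the weight
    keeps the image bounded.\<close>
  have "norm (\<Phi> w t) \<le> N / (2 * L)" for w t
  proof -
    let ?t = "max 0 t"
    have "norm (J w t) \<le> N * ?t" using Jlip[of w ?t 0] by (simp add: J_def)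
    moreover have "2 * L * ?t \<le> exp (2 * L * ?t)" using exp_ge_add_one_self[of "2 * L * ?t"] by linarith
    then have "?t \<le> exp (2 * L * ?t) / (2 * L)" using L_pos by (simp add: pos_le_divide_eq mult.commute del: max.bounded_iff)
    then have "N * ?t \<le> N * (exp (2 * L * ?t) / (2 * L))" by (rule mult_left_mono) (use N_pos in simp)
    ultimately have "norm (J w t) \<le> exp (2 * L * ?t) * (N / (2 * L))" by (simp add: mult.commute)
    then have "exp (- 2 * L * ?t) * norm (J w t) \<le> exp (- 2 * L * ?t) * (exp (2 * L * ?t) * (N / (2 * L)))"
      by (rule mult_left_mono) simp
    also have "\<dots> = N / (2 * L)" by (simp add: mult.assoc[symmetric] exp_add[symmetric])
    finally show ?thesis by (simp add: \<Phi>_def)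
  qed
  then have \<Phi>b: "\<Phi> w \<in> bcontfun" for w
    unfolding bcontfun_def bounded_iff using \<Phi>c by auto
  define \<Theta> where "\<Theta> w = Bcontfun (\<Phi> w)" for w
  have \<Theta>: "apply_bcontfun (\<Theta> w) = \<Phi> w" for w
    unfolding \<Theta>_def by (rule Bcontfun_inverse[OF \<Phi>b])
  \<comment> \<open>The factor 1/2 arises from integrating \<open>L * exp (2 * L * s)\<close>, which
    gives at most \<open>exp (2 * L * t) / 2\<close>; the weight cancels the exponential.\<close>
  have "dist (\<Theta> w) (\<Theta> w') \<le> 1 / 2 * dist w w'" for w w'
  proof (rule dist_bound)
    fix t :: real
    let ?t = "max 0 t" and ?D = "dist w w'"
    have bound: "norm (\<psi> w s - \<psi> w' s) \<le> L * ?D * exp (2 * L * s)" if "s \<in> {0..?t}" for s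
    proof -
      have "norm (\<psi> w s - \<psi> w' s) \<le> L * norm ((P + exp (2 * L * s) *\<^sub>R w s) - (P + exp (2 * L * s) *\<^sub>R w' s))"
        unfolding \<psi>_def using v that by (intro f_lipschitz admissible_mem) auto
      also have "\<dots> = L * (exp (2 * L * s) * dist (w s) (w' s))"
        by (simp add: dist_norm scaleR_diff_right[symmetric])
      also have "\<dots> \<le> L * (exp (2 * L * s) * ?D)"
        using dist_bounded[of w s w'] L_pos by (intro mult_left_mono) auto
      finally show ?thesis by (simp add: mult_ac)
    qed
    have "((\<lambda>s. L * ?D * exp (2 * L * s)) has_integral
        (?D / 2 * exp (2 * L * ?t) - ?D / 2 * exp (2 * L * 0))) {0..?t}"
      using L_pos
      by (intro fundamental_theorem_of_calculus)
        (auto intro!: derivative_eq_intros simp: has_real_derivative_iff_has_vector_derivative[symmetric])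
    note I = this
    have "norm (J w t - J w' t) = norm (integral {0..?t} (\<lambda>s. \<psi> w s - \<psi> w' s))"
      unfolding J_def by (subst Henstock_Kurzweil_Integration.integral_diff) (use \<psi> in auto)
    also have "\<dots> \<le> integral {0..?t} (\<lambda>s. L * ?D * exp (2 * L * s))"
      by (rule integral_norm_bound_integral) (use \<psi> I bound in \<open>auto intro!: integrable_diff\<close>)
    also have "\<dots> \<le> ?D / 2 * exp (2 * L * ?t)"
      using integral_unique[OF I] by simp
    finally have "norm (J w t - J w' t) \<le> ?D / 2 * exp (2 * L * ?t)" .
    then have "exp (- 2 * L * ?t) * norm (J w t - J w' t) \<le> exp (- 2 * L * ?t) * (?D / 2 * exp (2 * L * ?t))"
      by (rule mult_left_mono) simp
    also have "\<dots> = 1 / 2 * ?D" by (simp add: mult.commute[of "?D / 2"] mult.assoc[symmetric] exp_add[symmetric])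
    finally show "dist (\<Theta> w t) (\<Theta> w' t) \<le> 1 / 2 * ?D"
      unfolding \<Theta> \<Phi>_def by (simp add: dist_norm scaleR_diff_right[symmetric])
  qed
  then obtain w where w: "\<Theta> w = w"
    using banach_fix_type[of "1 / 2" \<Theta>] by auto
  define y where "y t = P + J w t" for t
  have "P + exp (2 * L * s) *\<^sub>R w s = y s" if "0 \<le> s" for s :: real
  proof -
    have "w s = \<Phi> w s" using \<Theta>[of w] w by simp
    then show ?thesis using that by (simp add: \<Phi>_def y_def max_absorb2 exp_add[symmetric])
  qed
  then have \<psi>y: "\<psi> w s = f (y s) (v s)" if "0 \<le> s" for s :: real
    using that by (simp add: \<psi>_def)
  have "solves P v y"
    unfolding solves_def primitive_on_def
  proof (intro conjI allI impI)
    show "y 0 = P" by (simp add: y_def J0)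
    fix T s t :: real assume st: "0 \<le> s" "s \<le> t" "t \<le> T"
    then have "(\<psi> w has_integral J w t - J w s) {s..t}" using prim[of T w] by (simp add: primitive_on_def)
    then have "((\<lambda>s. f (y s) (v s)) has_integral J w t - J w s) {s..t}"
      by (rule has_integral_eq[rotated]) (use \<psi>y st in auto)
    then show "((\<lambda>s. f (y s) (v s)) has_integral y t - y s) {s..t}" by (simp add: y_def)
  qed
  then show thesis by (rule that)
qed

end

section \<open>Reachability with cost: concatenation and comparison of trajectories\<close>

context control_system begin

text \<open>Keeps only the end points and the accumulated running cost. There is no reference to
  \<open>S\<close>: a trajectory may pass through the target and leave it, which makes the relation
  transitive.\<close>

definition steer :: "real ^ 'd \<Rightarrow> real ^ 'd \<Rightarrow> real \<Rightarrow> bool" where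
  "steer P Q c \<longleftrightarrow> (\<exists>v w T. admissible_control U v \<and> solves P v w \<and> 0 \<le> T \<and> w T = Q \<and>
      ((\<lambda>s. r (w s) (v s)) has_integral c) {0..T})"

lemma steer_refl: "steer P P 0"
proof -
  obtain \<omega> where "\<omega> \<in> U" using U_nonempty by blast
  then have v: "admissible_control U (\<lambda>_. \<omega>)" by (rule admissible_const)
  then obtain w where "solves P (\<lambda>_. \<omega>) w" by (rule solves_exists)
  then show ?thesis
    unfolding steer_def using v
    by (intro exI[of _ "\<lambda>_. \<omega>"] exI[of _ w] exI[of _ 0]) (auto simp: solves_def has_integral_refl(2)[of _ "0::real", simplified])
qed

lemma admissible_shift:
  assumes v: "admissible_control U v" and "0 \<le> a"
  shows "admissible_control U (\<lambda>s. v (s + a))"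
  unfolding admissible_control_def
proof (intro conjI allI impI)
  \<comment> \<open>Extension by 0 moves the question to the whole line, where translation is
    Lebesgue measurable. The default value is never met on the half-line because
    \<open>a \<ge> 0\<close>.\<close>
  have "(\<lambda>x. if x \<in> {0..} then v x else 0) \<in> borel_measurable lebesgue"
    by (rule borel_measurable_if_I; use v in \<open>simp add: admissible_control_def\<close>)
  moreover have "(\<lambda>s. s + a) \<in> lebesgue \<rightarrow>\<^sub>M lebesgue"
    using lebesgue_affine_measurable[of "\<lambda>_. 1" a] by (simp add: add.commute)
  ultimately have "(\<lambda>s. if s + a \<in> {0..} then v (s + a) else 0) \<in> borel_measurable lebesgue"
    using measurable_compose by fastforce
  then have "(\<lambda>s. if s + a \<in> {0..} then v (s + a) else 0) \<in> borel_measurable (lebesgue_on {0..})"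
    by (rule measurable_restrict_space1)
  then show "(\<lambda>s. v (s + a)) \<in> borel_measurable (lebesgue_on {0..})"
    by (rule measurable_cong[THEN iffD1, rotated]) (use \<open>0 \<le> a\<close> in auto)
qed (use v \<open>0 \<le> a\<close> in \<open>simp add: admissible_control_def\<close>)

lemma admissible_splice:
  assumes v: "admissible_control U v" and v': "admissible_control U v'" and "0 \<le> a"
  shows "admissible_control U (\<lambda>s. if s < a then v s else v' (s - a))"
  unfolding admissible_control_def
proof (intro conjI allI impI)
  have "(\<lambda>x. if x \<in> {0..} then v x else 0) \<in> borel_measurable lebesgue"
    "(\<lambda>x. if x \<in> {0..} then v' x else 0) \<in> borel_measurable lebesgue"
    by (rule borel_measurable_if_I; use v v' in \<open>simp add: admissible_control_def\<close>)+
  moreover have "(\<lambda>s. s - a) \<in> lebesgue \<rightarrow>\<^sub>M lebesgue"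
    using lebesgue_affine_measurable[of "\<lambda>_. 1" "- a"] by (simp add: add.commute)
  ultimately have m: "(\<lambda>x. if x \<in> {0..} then v x else 0) \<in> borel_measurable lebesgue"
    "(\<lambda>x. if x \<in> {0..} then v' x else 0) \<in> borel_measurable lebesgue"
    "(\<lambda>s. s - a) \<in> lebesgue \<rightarrow>\<^sub>M lebesgue"
    by auto
  have "(\<lambda>s. if s - a \<in> {0..} then v' (s - a) else 0) \<in> borel_measurable lebesgue"
    by (rule measurable_compose[OF m(3,2)])
  with m(1) have "(\<lambda>s. if s \<in> {..<a} then (if s \<in> {0..} then v s else 0)
      else (if s - a \<in> {0..} then v' (s - a) else 0)) \<in> borel_measurable lebesgue"
    by (rule measurable_If_set) simp
  then have "(\<lambda>s. if s \<in> {..<a} then (if s \<in> {0..} then v s else 0)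
      else (if s - a \<in> {0..} then v' (s - a) else 0)) \<in> borel_measurable (lebesgue_on {0..})"
    by (rule measurable_restrict_space1)
  then show "(\<lambda>s. if s < a then v s else v' (s - a)) \<in> borel_measurable (lebesgue_on {0..})"
    by (rule measurable_cong[THEN iffD1, rotated]) (use \<open>0 \<le> a\<close> in auto)
qed (use v v' \<open>0 \<le> a\<close> in \<open>auto simp: admissible_control_def\<close>)

lemma solves_shift:
  assumes "solves P v w" "0 \<le> a"
  shows "solves (w a) (\<lambda>s. v (s + a)) (\<lambda>s. w (s + a))"
  unfolding solves_def
proof (intro conjI allI)
  fix T
  have "primitive_on a (T + a) (\<lambda>s. f (w s) (v s)) w"
    using assms primitive_on_subinterval[of 0 "T + a" _ w a "T + a"] by (auto simp: solves_def)
  from primitive_on_shift[OF this, of "- a"]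
  show "primitive_on 0 T (\<lambda>s. f (w (s + a)) (v (s + a))) (\<lambda>s. w (s + a))" by simp
qed simp

lemma solves_splice:
  assumes w: "solves P v w" and w': "solves (w a) v' w'" and "0 \<le> a"
  shows "solves P (\<lambda>s. if s < a then v s else v' (s - a)) (\<lambda>s. if s \<le> a then w s else w' (s - a))"
    (is "solves P ?v ?w")
  unfolding solves_def
proof (intro conjI allI)
  show "?w 0 = P" using w \<open>0 \<le> a\<close> by (simp add: solves_def)
  fix T
  \<comment> \<open>Enlarging the interval to contain the splice point \<open>a\<close> allows both
    pieces to be combined; afterwards it is cut back to \<open>T\<close>.\<close>
  let ?c = "max T a"
  have "primitive_on (0 + a) (?c - a + a) (\<lambda>s. f (w' (s - a)) (v' (s - a))) (\<lambda>s. w' (s - a))"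
    by (rule primitive_on_shift) (use w' in \<open>simp add: solves_def\<close>)
  then have "primitive_on a ?c (\<lambda>s. f (w' (s - a)) (v' (s - a))) (\<lambda>s. w' (s - a))" by simp
  moreover have "primitive_on 0 a (\<lambda>s. f (w s) (v s)) w" using w by (simp add: solves_def)
  ultimately have p: "primitive_on 0 ?c (\<lambda>s. if s < a then f (w s) (v s) else f (w' (s - a)) (v' (s - a))) ?w"
    by (intro primitive_on_combine) (use w' \<open>0 \<le> a\<close> in \<open>auto simp: solves_def\<close>)
  \<comment> \<open>At \<open>s = a\<close> the control is already \<open>v'\<close> while the state
    is still written \<open>w a\<close>; the two descriptions agree since
    \<open>w' 0 = w a\<close>.\<close>
  have "(\<lambda>s. if s < a then f (w s) (v s) else f (w' (s - a)) (v' (s - a))) = (\<lambda>s. f (?w s) (?v s))"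
    using w' by (auto simp: fun_eq_iff solves_def)
  with p show "primitive_on 0 T (\<lambda>s. f (?w s) (?v s)) ?w"
    using primitive_on_subinterval[of 0 ?c _ ?w 0 T] by auto
qed

lemma steer_trans:
  assumes "steer P Q c" "steer Q R c'"
  shows "steer P R (c + c')"
proof -
  obtain v w T where v: "admissible_control U v" "solves P v w" "0 \<le> T" "w T = Q"
    "((\<lambda>s. r (w s) (v s)) has_integral c) {0..T}"
    using assms(1) unfolding steer_def by blast
  obtain v' w' T' where v': "admissible_control U v'" "solves (w T) v' w'" "0 \<le> T'" "w' T' = R"
    "((\<lambda>s. r (w' s) (v' s)) has_integral c') {0..T'}"
    using assms(2) v(4) unfolding steer_def by blast
  let ?v = "\<lambda>s. if s < T then v s else v' (s - T)" and ?w = "\<lambda>s. if s \<le> T then w s else w' (s - T)"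
  have "((\<lambda>s. r (?w s) (?v s)) has_integral c + c') {0..T + T'}"
  proof (rule has_integral_combine[of 0 T])
    show "((\<lambda>s. r (?w s) (?v s)) has_integral c) {0..T}"
      by (rule has_integral_spike_finite[of "{T}", OF _ _ v(5)]) auto
    have "((\<lambda>s. r (w' (s - T)) (v' (s - T))) has_integral c') {T..T + T'}"
      using has_integral_shift_Icc_real[of "\<lambda>s. r (w' s) (v' s)" "- T" c' T "T + T'"] v'(5) by (simp add: o_def)
    then show "((\<lambda>s. r (?w s) (?v s)) has_integral c') {T..T + T'}"
      by (rule has_integral_spike_finite[of "{T}", rotated -1]) auto
  qed (use v v' in auto)
  \<comment> \<open>For \<open>T' = 0\<close> the end point is read off the first piece, as
    \<open>w T = w' 0\<close>.\<close>
  moreover have "?w (T + T') = R"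
    using v' v(4) by (cases "T' = 0") (auto simp: solves_def)
  ultimately show ?thesis
    unfolding steer_def using admissible_splice[OF v(1) v'(1) v(3)] solves_splice[OF v(2) v'(2) v(3)] v(3) v'(3)
    by (intro exI[of _ ?v] exI[of _ ?w] exI[of _ "T + T'"]) auto
qed

text \<open>The clock is not reset: \<open>z\<close> starts at time \<open>b\<close> and uses
  \<open>v\<close> at its original instants, so that it can be compared pointwise with another
  trajectory of the same control.\<close>

lemma steer_parallel:
  assumes v: "admissible_control U v" and "0 \<le> b"
  obtains z where "z b = P" "\<And>T. primitive_on b T (\<lambda>s. f (z s) (v s)) z" "continuous_on {b..} z"
    "\<And>s. (\<lambda>s. r (z s) (v s)) integrable_on {b..s}"
    "\<And>s. b \<le> s \<Longrightarrow> steer P (z s) (integral {b..s} (\<lambda>s. r (z s) (v s)))"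
proof -
  have v': "admissible_control U (\<lambda>s. v (s + b))" by (rule admissible_shift[OF assms])
  then obtain w where w: "solves P (\<lambda>s. v (s + b)) w" by (rule solves_exists)
  have wc: "continuous_on {0..} w" by (rule solves_continuous[OF v' w])
  define z where "z = (\<lambda>s. w (s - b))"
  have I: "((\<lambda>s. r (z s) (v s)) has_integral integral {0..s - b} (\<lambda>s. r (w s) (v (s + b)))) {b..s}" for s
    using has_integral_shift_Icc_real[of "\<lambda>s. r (w s) (v (s + b))" "- b" _ b s]
      integrable_along[OF wc v' r_cont, of 0 "s - b"]
    by (auto simp: o_def z_def intro: integrable_integral)
  show thesis
  proof (rule that[of z])
    show "z b = P" using w by (simp add: z_def solves_def)
    show "primitive_on b T (\<lambda>s. f (z s) (v s)) z" for T
      using primitive_on_shift[of 0 "T - b" "\<lambda>s. f (w s) (v (s + b))" w b] w by (simp add: z_def solves_def)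
    show "continuous_on {b..} z"
      unfolding z_def by (rule continuous_on_compose2[OF wc]) (auto intro!: continuous_intros)
    show "(\<lambda>s. r (z s) (v s)) integrable_on {b..s}" for s using I by blast
    show "steer P (z s) (integral {b..s} (\<lambda>s. r (z s) (v s)))" if "b \<le> s" for s
      unfolding steer_def integral_unique[OF I]
      using v' w integrable_along[OF wc v' r_cont, of 0 "s - b"] that
      by (intro exI[of _ "\<lambda>s. v (s + b)"] exI[of _ w] exI[of _ "s - b"]) (auto simp: z_def integrable_integral)
  qed
qed

lemma steer_along:
  assumes v: "admissible_control U v" and w: "solves P v w" and "0 \<le> a" "a \<le> b"
  shows "steer (w a) (w b) (integral {a..b} (\<lambda>s. r (w s) (v s)))"
proof -
  have "((\<lambda>s. r (w s) (v s)) has_integral integral {a..b} (\<lambda>s. r (w s) (v s))) {a..b}"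
    by (rule integrable_integral[OF integrable_along[OF solves_continuous[OF v w] v r_cont \<open>0 \<le> a\<close>]])
  then have "((\<lambda>s. r (w (s + a)) (v (s + a))) has_integral integral {a..b} (\<lambda>s. r (w s) (v s))) {0..b - a}"
    using has_integral_shift_Icc_real[of "\<lambda>s. r (w s) (v s)" a _ 0 "b - a"] by (simp add: o_def add.commute)
  then show ?thesis
    unfolding steer_def using admissible_shift[OF v \<open>0 \<le> a\<close>] solves_shift[OF w \<open>0 \<le> a\<close>] assms
    by (intro exI[of _ "\<lambda>s. v (s + a)"] exI[of _ "\<lambda>s. w (s + a)"] exI[of _ "b - a"]) auto
qed

text \<open>Speed at most \<open>N\<close> keeps the trajectory within \<open>N * T\<close> of
  \<open>P\<close>, so \<open>f\<close> and \<open>r\<close> vary by at most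
  \<open>L * N * T\<close> along it; integration over length \<open>T\<close> gives the quadratic
  error.\<close>

lemma steer_const:
  assumes \<omega>: "\<omega> \<in> U" and "0 \<le> T"
  obtains Q c where "steer P Q c" "norm (Q - P - T *\<^sub>R f P \<omega>) \<le> L * N * T\<^sup>2"
    "\<bar>c - T * r P \<omega>\<bar> \<le> L * N * T\<^sup>2"
proof -
  let ?v = "\<lambda>_::real. \<omega>"
  have v: "admissible_control U ?v" using \<omega> by (rule admissible_const)
  then obtain w where w: "solves P ?v w" by (rule solves_exists)
  have w0: "w 0 = P" using w by (simp add: solves_def)
  have d: "norm (w s - P) \<le> N * T" if "s \<in> {0..T}" for s
  proof -
    have "norm (w s - w 0) \<le> N * \<bar>s - 0\<bar>" using that by (intro solves_lipschitz[OF v w]) auto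
    also have "\<dots> \<le> N * T" using that N_pos by auto
    finally show ?thesis by (simp add: w0)
  qed
  have LNT: "0 \<le> L * (N * T)" using L_pos N_pos \<open>0 \<le> T\<close> by simp
  have "primitive_on 0 T (\<lambda>s. f (w s) \<omega>) w" using w by (simp add: solves_def)
  then have "((\<lambda>s. f (w s) \<omega>) has_integral w T - P) {0..T}"
    using primitive_onD[of 0 T _ w 0 T] \<open>0 \<le> T\<close> w0 by auto
  moreover have "((\<lambda>s. f P \<omega>) has_integral T *\<^sub>R f P \<omega>) {0..T}"
    using has_integral_const_real[of "f P \<omega>" 0 T] \<open>0 \<le> T\<close> by simp
  ultimately have "((\<lambda>s. f (w s) \<omega> - f P \<omega>) has_integral (w T - P - T *\<^sub>R f P \<omega>)) {0..T}"
    by (rule has_integral_diff)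
  then have "norm (w T - P - T *\<^sub>R f P \<omega>) \<le> L * (N * T) * measure lborel {0..T}"
  proof (rule has_integral_bound_real[OF LNT finite.emptyI])
    show "norm (f (w s) \<omega> - f P \<omega>) \<le> L * (N * T)" if "s \<in> {0..T} - {}" for s
      using f_lipschitz[OF \<omega>, of "w s" P] d[of s] that L_pos by (smt (verit) Diff_iff mult_left_mono)
  qed
  then have 1: "norm (w T - P - T *\<^sub>R f P \<omega>) \<le> L * N * T\<^sup>2"
    using \<open>0 \<le> T\<close> by (simp add: power2_eq_square mult.assoc)
  let ?c = "integral {0..T} (\<lambda>s. r (w s) \<omega>)"
  have I: "((\<lambda>s. r (w s) \<omega>) has_integral ?c) {0..T}"
    by (rule integrable_integral[OF integrable_along[OF solves_continuous[OF v w] v r_cont]]) simp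
  have "((\<lambda>s. r P \<omega>) has_integral T * r P \<omega>) {0..T}"
    using has_integral_const_real[of "r P \<omega>" 0 T] \<open>0 \<le> T\<close> by simp
  with I have "((\<lambda>s. r (w s) \<omega> - r P \<omega>) has_integral (?c - T * r P \<omega>)) {0..T}"
    by (rule has_integral_diff)
  then have "norm (?c - T * r P \<omega>) \<le> L * (N * T) * measure lborel {0..T}"
  proof (rule has_integral_bound_real[OF LNT finite.emptyI])
    show "norm (r (w s) \<omega> - r P \<omega>) \<le> L * (N * T)" if "s \<in> {0..T} - {}" for s
      using r_lipschitz[OF \<omega>, of "w s" P] d[of s] that L_pos by (smt (verit) Diff_iff mult_left_mono real_norm_def)
  qed
  then have 2: "\<bar>?c - T * r P \<omega>\<bar> \<le> L * N * T\<^sup>2"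
    using \<open>0 \<le> T\<close> by (simp add: power2_eq_square mult.assoc)
  have "steer P (w T) ?c"
    unfolding steer_def using v w I \<open>0 \<le> T\<close> by blast
  then show thesis using 1 2 by (rule that)
qed

text \<open>Because both trajectories use the same control value at each instant, the Lipschitz
  bound in the state alone gives the integral inequality for Gronwall.\<close>

lemma solution_gap:
  assumes z: "primitive_on a b (\<lambda>s. f (z s) (v s)) z" and y: "primitive_on a b (\<lambda>s. f (y s) (v s)) y"
    and v: "\<And>s. s \<in> {a..b} \<Longrightarrow> v s \<in> U" and s: "s \<in> {a..b}"
  shows "norm (z s - y s) \<le> norm (z a - y a) * exp (L * (s - a))"
proof (rule gronwall[where b = b])
  have lip: "N-lipschitz_on {a..b} w" if "primitive_on a b (\<lambda>s. f (w s) (v s)) w" for w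
  proof (rule lipschitz_onI)
    fix s t assume "s \<in> {a..b}" "t \<in> {a..b}"
    then show "dist (w s) (w t) \<le> N * dist s t"
      using primitive_on_lipschitz[OF that, of N t s] v f_bound by (simp add: dist_norm)
  qed (use N_pos in simp)
  have c: "continuous_on {a..b} z" "continuous_on {a..b} y"
    using lip[OF z] lip[OF y] by (auto intro: lipschitz_on_continuous_on)
  then show m: "continuous_on {a..b} (\<lambda>s. norm (z s - y s))" by (intro continuous_intros)
  show "L \<ge> 0" using L_pos by simp
  fix t assume t: "t \<in> {a..b}"
  have I: "((\<lambda>s. f (z s) (v s) - f (y s) (v s)) has_integral ((z t - y t) - (z a - y a))) {a..t}"
    using primitive_on_diff[OF z y] t by (simp add: primitive_on_def)
  have mi: "(\<lambda>s. L * norm (z s - y s)) integrable_on {a..t}"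
    by (intro integrable_continuous_real continuous_intros continuous_on_subset[OF c(1)] continuous_on_subset[OF c(2)])
      (use t in auto)
  have "norm ((z t - y t) - (z a - y a)) \<le> integral {a..t} (\<lambda>s. L * norm (z s - y s))"
    unfolding integral_unique[OF I, symmetric]
    by (rule integral_norm_bound_integral) (use I mi t v f_lipschitz in auto)
  also have "\<dots> = L * integral {a..t} (\<lambda>s. norm (z s - y s))" by simp
  finally show "norm (z t - y t) \<le> norm (z a - y a) + L * integral {a..t} (\<lambda>s. norm (z s - y s))"
    using norm_triangle_sub[of "z t - y t" "z a - y a"] by linarith
qed (rule s)

end

section \<open>The exit problem\<close>

lemma hitting_time_attained:
  fixes w :: "real \<Rightarrow> 'a::topological_space"
  assumes w: "continuous_on {0..} w" and S: "closed S" and T: "0 \<le> T" "w T \<in> S"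
  obtains h where "0 \<le> h" "h \<le> T" "hitting_time S w = ereal h" "w h \<in> S"
    "\<And>s. 0 \<le> s \<Longrightarrow> s < h \<Longrightarrow> w s \<notin> S"
proof -
  define A where "A = {t \<in> {0..T}. w t \<in> S}"
  have "closed A"
    unfolding A_def
    using continuous_closed_preimage[of "{0..T}" w S] continuous_on_subset[OF w, of "{0..T}"] S
    by (auto simp: vimage_def Int_def)
  moreover have "bounded A" by (rule bounded_subset[of "{0..T}"]) (auto simp: A_def)
  ultimately have "compact A" by (simp add: compact_eq_bounded_closed)
  moreover have "A \<noteq> {}" using T by (auto simp: A_def)
  ultimately obtain h where h: "h \<in> A" "\<forall>t\<in>A. h \<le> t" using compact_attains_inf by meson
  have first: "w s \<notin> S" if "0 \<le> s" "s < h" for s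
    using that h by (force simp: A_def)
  have "hitting_time S w = ereal h"
    unfolding hitting_time_def
  proof (rule INF_eqI)
    show "ereal h \<le> ereal t" if "t \<in> {t. 0 \<le> t \<and> w t \<in> S}" for t
      using first[of t] that by force
    show "c \<le> ereal h" if "\<And>t. t \<in> {t. 0 \<le> t \<and> w t \<in> S} \<Longrightarrow> c \<le> ereal t" for c
      using that[of h] h by (auto simp: A_def)
  qed
  with h first show thesis by (intro that[of h]) (auto simp: A_def)
qed

lemma superdifferentialD:
  assumes "q \<in> superdifferential g x" "\<eta> > 0"
  obtains \<delta> where "\<delta> > 0"
    "\<And>P. norm (P - x) < \<delta> \<Longrightarrow> g P \<le> g x + q \<bullet> (P - x) + \<eta> * norm (P - x)"
proof -
  have "\<forall>\<^sub>F P in at x. ereal ((g P - g x - q \<bullet> (P - x)) / norm (P - x)) < ereal \<eta>"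
    using assms unfolding superdifferential_def Limsup_le_iff by (auto dest!: spec[of _ "ereal \<eta>"])
  then obtain \<delta> where \<delta>: "\<delta> > 0"
    "\<And>P. P \<noteq> x \<Longrightarrow> dist P x < \<delta> \<Longrightarrow> (g P - g x - q \<bullet> (P - x)) / norm (P - x) < \<eta>"
    unfolding eventually_at by auto
  have "g P \<le> g x + q \<bullet> (P - x) + \<eta> * norm (P - x)" if "norm (P - x) < \<delta>" for P
  proof (cases "P = x")
    case False
    then have "(g P - g x - q \<bullet> (P - x)) / norm (P - x) < \<eta>"
      using \<delta>(2)[of P] that by (simp add: dist_norm)
    then show ?thesis using False by (simp add: pos_divide_less_eq)
  qed simp
  with \<delta>(1) show thesis by (rule that)
qed

lemma eventually_mult_small:
  fixes \<mu> :: real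
  assumes "\<mu> > 0"
  shows "\<forall>\<^sub>F e in at_right 0. C * e < \<mu>"
proof -
  have "((\<lambda>e. C * e) \<longlongrightarrow> C * 0) (at_right 0)" by (intro tendsto_intros)
  then show ?thesis using assms by (auto dest: order_tendstoD)
qed

lemma eventually_mult_sqrt_small:
  fixes \<mu> :: real
  assumes "\<mu> > 0"
  shows "\<forall>\<^sub>F e in at_right 0. C * sqrt e < \<mu>"
proof -
  have "((\<lambda>e. C * sqrt e) \<longlongrightarrow> C * sqrt 0) (at_right 0)" by (intro tendsto_intros)
  then show ?thesis using assms by (auto dest: order_tendstoD)
qed

text \<open>For a given slope \<open>\<eta>\<close> the points from which \<open>\<Psi>\<close>
  rises to \<open>b\<close> by at most \<open>\<eta>\<close> times the distance form a compact set.
  Its least element must be \<open>a\<close>, since the slope condition allows a step further to the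
  left from any other point. Only left slopes are needed, which is what deleting a past piece of the
  control provides.\<close>

lemma le_if_left_slope_nonpos:
  fixes \<Psi> :: "real \<Rightarrow> real"
  assumes "a \<le> b" and cont: "continuous_on {a..b} \<Psi>"
    and slope: "\<And>t \<eta>. a < t \<Longrightarrow> t \<le> b \<Longrightarrow> \<eta> > 0 \<Longrightarrow> \<forall>\<^sub>F \<epsilon> in at_right 0. \<Psi> t - \<Psi> (t - \<epsilon>) \<le> \<eta> * \<epsilon>"
  shows "\<Psi> b \<le> \<Psi> a"
proof (rule field_le_epsilon)
  fix e :: real assume "e > 0"
  define \<eta> where "\<eta> = e / (b - a + 1)"
  have "\<eta> > 0" using \<open>e > 0\<close> \<open>a \<le> b\<close> by (simp add: \<eta>_def)
  define A where "A = {s \<in> {a..b}. \<Psi> b - \<Psi> s \<le> \<eta> * (b - s)}"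
  have "closed A"
    unfolding A_def by (intro continuous_on_closed_Collect_le continuous_intros cont)
  moreover have "bounded A" by (rule bounded_subset[of "{a..b}"]) (auto simp: A_def)
  ultimately have "compact A" by (simp add: compact_eq_bounded_closed)
  moreover have "b \<in> A" using \<open>a \<le> b\<close> by (simp add: A_def)
  ultimately obtain c where c: "c \<in> A" "\<forall>t\<in>A. c \<le> t" using compact_attains_inf by blast
  have "c = a"
  proof (rule ccontr)
    assume "c \<noteq> a"
    then have "a < c" "c \<le> b" using c by (auto simp: A_def)
    then have "\<forall>\<^sub>F \<epsilon> in at_right 0. \<Psi> c - \<Psi> (c - \<epsilon>) \<le> \<eta> * \<epsilon> \<and> 1 * \<epsilon> < c - a \<and> \<epsilon> > 0"
      by (intro eventually_conj slope eventually_mult_small \<open>\<eta> > 0\<close> eventually_at_right_less) simp_all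
    then obtain \<epsilon> where \<epsilon>: "\<Psi> c - \<Psi> (c - \<epsilon>) \<le> \<eta> * \<epsilon>" "1 * \<epsilon> < c - a" "\<epsilon> > 0"
      using eventually_happens'[OF trivial_limit_at_right_real] by blast
    have "\<Psi> b - \<Psi> (c - \<epsilon>) \<le> \<eta> * (b - c) + \<eta> * \<epsilon>"
      using \<epsilon>(1) c(1) by (simp add: A_def)
    then have "c - \<epsilon> \<in> A" using \<epsilon> \<open>c \<le> b\<close> by (simp add: A_def algebra_simps)
    then show False using c(2) \<epsilon>(3) by force
  qed
  then have "\<Psi> b - \<Psi> a \<le> \<eta> * (b - a)" using c by (simp add: A_def)
  also have "\<eta> * (b - a) \<le> e"
    using \<open>e > 0\<close> \<open>a \<le> b\<close> by (simp add: \<eta>_def field_simps)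
  finally show "\<Psi> b \<le> \<Psi> a + e" by simp
qed

text \<open>Mean value inequality for \<open>F - F' y\<close>, whose derivative on the segment from
  \<open>y\<close> to \<open>z\<close> has norm at most \<open>L * norm (z - y)\<close>.\<close>

lemma derivative_lipschitz_remainder:
  fixes F :: "'a::euclidean_space \<Rightarrow> 'b::real_normed_vector"
  assumes der: "\<And>w. (F has_derivative F' w) (at w)"
    and lip: "\<And>w. onorm (\<lambda>h. F' w h - F' y h) \<le> L * norm (w - y)" and "L \<ge> 0"
  shows "norm (F z - F y - F' y (z - y)) \<le> L * (norm (z - y))\<^sup>2"
proof -
  have lin: "bounded_linear (F' y)" using der by (rule has_derivative_bounded_linear)
  have "norm ((F z - F' y z) - (F y - F' y y)) \<le> L * norm (z - y) * norm (z - y)"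
  proof (rule differentiable_bound[OF convex_closed_segment, of y z _ "\<lambda>w h. F' w h - F' y h"])
    fix w assume w: "w \<in> closed_segment y z"
    show "((\<lambda>w. F w - F' y w) has_derivative (\<lambda>h. F' w h - F' y h)) (at w within closed_segment y z)"
      by (intro has_derivative_diff has_derivative_at_withinI[OF der] bounded_linear_imp_has_derivative lin)
    have "norm (w - y) \<le> norm (z - y)"
      using segment_bound1[OF w] by simp
    then show "onorm (\<lambda>h. F' w h - F' y h) \<le> L * norm (z - y)"
      using lip[of w] \<open>L \<ge> 0\<close> by (meson mult_left_mono order_trans)
  qed auto
  moreover have "(F z - F' y z) - (F y - F' y y) = F z - F y - F' y (z - y)"
    using lin by (simp add: linear_diff bounded_linear.linear)
  ultimately show ?thesis by (simp add: power2_eq_square mult.assoc)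
qed

lemma inner_le_norm_bounds:
  fixes a b :: "'a::real_inner"
  assumes "norm a \<le> A" "norm b \<le> B"
  shows "a \<bullet> b \<le> A * B"
proof -
  have "a \<bullet> b \<le> norm a * norm b" by (rule norm_cauchy_schwarz)
  also have "\<dots> \<le> A * B"
    using assms norm_ge_zero[of a] by (intro mult_mono) (auto intro: order_trans[OF norm_ge_zero])
  finally show ?thesis .
qed

section \<open>Taylor remainders and comparison with the value function\<close>

locale exit_problem = control_system U f r N L
  for U :: "(real ^ 'm) set" and f :: "real ^ 'd \<Rightarrow> real ^ 'm \<Rightarrow> real ^ 'd"
    and r :: "real ^ 'd \<Rightarrow> real ^ 'm \<Rightarrow> real" and N L :: real +
  fixes Df :: "real ^ 'd \<Rightarrow> real ^ 'm \<Rightarrow> real ^ 'd ^ 'd" and Dr :: "real ^ 'd \<Rightarrow> real ^ 'm \<Rightarrow> real ^ 'd"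
    and S \<N> :: "(real ^ 'd) set" and g :: "real ^ 'd \<Rightarrow> real" and G r\<^sub>0 :: real
  assumes S_closed: "closed S"
    and f_derivative: "\<And>x \<omega>. \<omega> \<in> U \<Longrightarrow> ((\<lambda>z. f z \<omega>) has_derivative (\<lambda>h. Df x \<omega> *v h)) (at x)"
    and Df_lipschitz: "\<And>x y \<omega>. \<omega> \<in> U \<Longrightarrow> onorm (\<lambda>h. (Df y \<omega> - Df x \<omega>) *v h) \<le> L * norm (y - x)"
    and r_derivative: "\<And>x \<omega>. \<omega> \<in> U \<Longrightarrow> ((\<lambda>z. r z \<omega>) has_derivative (\<lambda>h. Dr x \<omega> \<bullet> h)) (at x)"
    and Dr_lipschitz: "\<And>x y \<omega>. \<omega> \<in> U \<Longrightarrow> norm (Dr y \<omega> - Dr x \<omega>) \<le> L * norm (y - x)"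
    and r_lower: "\<And>x \<omega>. \<omega> \<in> U \<Longrightarrow> r\<^sub>0 \<le> r x \<omega>" and r\<^sub>0_pos: "r\<^sub>0 > 0"
    and frontier_nbhd: "frontier S \<subseteq> interior \<N>" and G_nonneg: "0 \<le> G" and GN_less: "G * N < r\<^sub>0"
    and g_lipschitz: "\<And>x y. x \<in> \<N> \<Longrightarrow> y \<in> \<N> \<Longrightarrow> \<bar>g y - g x\<bar> \<le> G * norm (y - x)"
begin

lemma f_remainder:
  "\<omega> \<in> U \<Longrightarrow> norm (f z \<omega> - f y \<omega> - Df y \<omega> *v (z - y)) \<le> L * (norm (z - y))\<^sup>2"
  using derivative_lipschitz_remainder[of "\<lambda>z. f z \<omega>" "\<lambda>x h. Df x \<omega> *v h" y L z]
    f_derivative Df_lipschitz L_pos by (simp add: matrix_vector_mult_diff_rdistrib)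

lemma r_remainder:
  assumes "\<omega> \<in> U"
  shows "\<bar>r z \<omega> - r y \<omega> - Dr y \<omega> \<bullet> (z - y)\<bar> \<le> L * (norm (z - y))\<^sup>2"
proof -
  have "onorm (\<lambda>h. Dr w \<omega> \<bullet> h - Dr y \<omega> \<bullet> h) \<le> L * norm (w - y)" for w
  proof (rule onorm_le)
    fix h
    have "norm (Dr w \<omega> \<bullet> h - Dr y \<omega> \<bullet> h) \<le> norm (Dr w \<omega> - Dr y \<omega>) * norm h"
      using Cauchy_Schwarz_ineq2[of "Dr w \<omega> - Dr y \<omega>" h] by (simp add: inner_diff_left)
    also have "\<dots> \<le> L * norm (w - y) * norm h"
      using Dr_lipschitz[OF assms] by (intro mult_right_mono) auto
    finally show "norm (Dr w \<omega> \<bullet> h - Dr y \<omega> \<bullet> h) \<le> L * norm (w - y) * norm h" .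
  qed
  then show ?thesis
    using derivative_lipschitz_remainder[of "\<lambda>z. r z \<omega>" "\<lambda>x h. Dr x \<omega> \<bullet> h" y L z]
      r_derivative[OF assms] L_pos by simp
qed

lemma cost_lower:
  assumes v: "admissible_control U v" and w: "solves P v w" and "0 \<le> a" "a \<le> b"
  shows "r\<^sub>0 * (b - a) \<le> integral {a..b} (\<lambda>s. r (w s) (v s))"
proof -
  have "integral {a..b} (\<lambda>_. r\<^sub>0) \<le> integral {a..b} (\<lambda>s. r (w s) (v s))"
    by (rule integral_le)
      (use integrable_along[OF solves_continuous[OF v w] v r_cont \<open>0 \<le> a\<close>] r_lower v \<open>0 \<le> a\<close>
        in \<open>auto simp: admissible_mem\<close>)
  then show ?thesis using \<open>a \<le> b\<close> by (simp add: mult.commute)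
qed

text \<open>Positivity of \<open>r\<close> upgrades integrability of the running cost to absolute
  integrability, so the Lebesgue integral in the definition is the gauge integral used
  elsewhere.\<close>

lemma total_cost_eq:
  assumes v: "admissible_control U v" and w: "solves P v w" and h: "hitting_time S w = ereal h"
  shows "total_cost r g S v w = integral {0..h} (\<lambda>s. r (w s) (v s)) + g (w h)"
proof -
  have "(\<lambda>s. r (w s) (v s)) integrable_on {0..h}"
    by (rule integrable_along[OF solves_continuous[OF v w] v r_cont]) simp
  then have "(\<lambda>s. r (w s) (v s)) absolutely_integrable_on {0..h}"
    by (rule nonnegative_absolutely_integrable_1)
      (use r_lower r\<^sub>0_pos v in \<open>auto simp: admissible_mem intro: order_trans[of 0 r\<^sub>0]\<close>)
  then show ?thesis
    unfolding total_cost_def h Let_def by (simp add: set_lebesgue_integral_eq_integral)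
qed

text \<open>Since \<open>G * N < r\<^sub>0\<close>, the running cost saved by stopping at the first entrance into \<open>S\<close>
  outweighs the change of the terminal cost.\<close>

lemma value_function_le_steer:
  assumes "steer x Q c" "x \<notin> S" "Q \<in> S" "Q \<in> \<N>"
  shows "value_function f r g U S x \<le> ereal (c + g Q)"
proof -
  obtain v w T where v: "admissible_control U v" and w: "solves x v w" and T: "0 \<le> T" "w T = Q"
    and c: "((\<lambda>s. r (w s) (v s)) has_integral c) {0..T}"
    using assms(1) unfolding steer_def by blast
  have wc: "continuous_on {0..} w" by (rule solves_continuous[OF v w])
  obtain h where h: "0 \<le> h" "h \<le> T" "hitting_time S w = ereal h" "w h \<in> S"
    "\<And>s. 0 \<le> s \<Longrightarrow> s < h \<Longrightarrow> w s \<notin> S"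
    using hitting_time_attained[OF wc S_closed T(1)] T assms by metis
  have "h \<noteq> 0" using h(4) w assms(2) by (auto simp: solves_def)
  then have "h > 0" using h(1) by simp
  \<comment> \<open>The first entrance point is a limit of points outside \<open>S\<close>, hence on
    the frontier and in the region where \<open>g\<close> is Lipschitz. The intermediate trajectory
    from \<open>w h\<close> to \<open>Q\<close> may leave that region; only its end points
    matter.\<close>
  have "w h \<in> closure (- S)"
  proof -
    have "w ` closure {0..<h} \<subseteq> closure (- S)"
      by (rule image_closure_subset)
        (use continuous_on_subset[OF wc, of "{0..h}"] h(5) \<open>h > 0\<close> closure_subset[of "- S"] in \<open>auto simp: subset_iff\<close>)
    then show ?thesis using \<open>h > 0\<close> by auto
  qed
  then have "w h \<in> frontier S"
    using h(4) by (simp add: frontier_closures closure_closed[OF S_closed])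
  then have hN: "w h \<in> \<N>" using frontier_nbhd interior_subset by blast
  have "g (w h) \<le> g Q + G * norm (w T - w h)"
    using g_lipschitz[OF assms(4) hN] T(2) by (simp add: abs_le_iff norm_minus_commute)
  also have "G * norm (w T - w h) \<le> G * (N * (T - h))"
    using solves_lipschitz[OF v w, of h T] h T G_nonneg by (intro mult_left_mono) auto
  also have "\<dots> \<le> r\<^sub>0 * (T - h)"
    using GN_less h by (simp add: mult.assoc[symmetric] mult_right_mono)
  also have "\<dots> \<le> integral {h..T} (\<lambda>s. r (w s) (v s))"
    by (rule cost_lower[OF v w h(1,2)])
  finally have "g (w h) \<le> g Q + integral {h..T} (\<lambda>s. r (w s) (v s))" by simp
  moreover have "integral {0..h} (\<lambda>s. r (w s) (v s)) + integral {h..T} (\<lambda>s. r (w s) (v s)) = c"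
    using Henstock_Kurzweil_Integration.integral_combine[OF h(1,2) has_integral_integrable[OF c]]
      integral_unique[OF c] by simp
  ultimately have "total_cost r g S v w \<le> c + g Q"
    using total_cost_eq[OF v w h(3)] by simp
  moreover have "value_function f r g U S x \<le> ereal (total_cost r g S v w)"
    unfolding value_function_def
    using v w h(3) trajectory_iff_solves[OF v] by (intro Inf_lower) (auto intro!: exI[of _ v] exI[of _ w])
  ultimately show ?thesis by (meson ereal_less_eq(3) order_trans)
qed

end

text \<open>The optimality of \<open>y\<close> enters only through the comparison \<open>optimality\<close> with arbitrary
  controls that end in \<open>S\<close> near its boundary.\<close>

locale optimal_exit = exit_problem U f r N L Df Dr S \<N> g G r\<^sub>0
  for U :: "(real ^ 'm) set" and f :: "real ^ 'd \<Rightarrow> real ^ 'm \<Rightarrow> real ^ 'd"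
    and r :: "real ^ 'd \<Rightarrow> real ^ 'm \<Rightarrow> real" and N L :: real
    and Df :: "real ^ 'd \<Rightarrow> real ^ 'm \<Rightarrow> real ^ 'd ^ 'd" and Dr :: "real ^ 'd \<Rightarrow> real ^ 'm \<Rightarrow> real ^ 'd"
    and S \<N> :: "(real ^ 'd) set" and g :: "real ^ 'd \<Rightarrow> real" and G r\<^sub>0 :: real +
  fixes x xs :: "real ^ 'd" and u :: "real \<Rightarrow> real ^ 'm" and y :: "real \<Rightarrow> real ^ 'd" and \<tau> :: real
  assumes u: "admissible_control U u" and y: "solves x u y" and \<tau>_pos: "\<tau> > 0" and xs: "xs = y \<tau>"
    and outside: "\<And>s. 0 \<le> s \<Longrightarrow> s < \<tau> \<Longrightarrow> y s \<notin> S" and xs_frontier: "xs \<in> frontier S"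
    and optimality: "\<And>Q c. steer x Q c \<Longrightarrow> Q \<in> S \<Longrightarrow> Q \<in> \<N> \<Longrightarrow>
          integral {0..\<tau>} (\<lambda>s. r (y s) (u s)) + g xs \<le> c + g Q"
begin

definition cost :: "real \<Rightarrow> real \<Rightarrow> real" where
  "cost a b = integral {a..b} (\<lambda>s. r (y s) (u s))"

lemma y_continuous: "continuous_on {0..} y"
  by (rule solves_continuous[OF u y])

lemma y_primitive: "0 \<le> a \<Longrightarrow> primitive_on a b (\<lambda>s. f (y s) (u s)) y"
  using y primitive_on_subinterval[of 0 b _ y a b] by (auto simp: solves_def)

lemma r_integrable: "0 \<le> a \<Longrightarrow> (\<lambda>s. r (y s) (u s)) integrable_on {a..b}"
  by (rule integrable_along[OF y_continuous u r_cont])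

lemma cost_combine: "0 \<le> a \<Longrightarrow> a \<le> b \<Longrightarrow> b \<le> c \<Longrightarrow> cost a c = cost a b + cost b c"
  unfolding cost_def by (rule Henstock_Kurzweil_Integration.integral_combine[symmetric, OF _ _ r_integrable])

lemma xs_mem: "xs \<in> S" "xs \<in> \<N>" "xs \<in> interior \<N>"
  using xs_frontier frontier_nbhd interior_subset S_closed by (auto simp: frontier_def)

lemma near_xs:
  obtains \<delta> where "\<delta> > 0" "\<And>P. norm (P - xs) < \<delta> \<Longrightarrow> P \<in> \<N>"
proof -
  obtain \<delta> where "\<delta> > 0" "ball xs \<delta> \<subseteq> \<N>"
    using xs_mem(3) mem_interior by blast
  then show thesis by (intro that[of \<delta>]) (auto simp: dist_norm norm_minus_commute)
qed

text \<open>Differentiating \<open>p t \<bullet> (z t - y t)\<close> plus \<open>l\<close> times the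
  running cost difference, the adjoint equation cancels all terms linear in \<open>z - y\<close>.
  What remains are Taylor remainders, quadratic in the displacement. The multiplier \<open>l\<close>
  is 1 in case (i) and 0 in case (ii).\<close>

lemma adjoint_estimate:
  assumes p: "caratheodory_solution {0..\<tau>} (\<lambda>t z. - (transpose (Df (y t) (u t)) *v z) - l *\<^sub>R Dr (y t) (u t)) p"
    and l: "0 \<le> l" "l \<le> 1"
  obtains C where "C \<ge> 0"
    "\<And>a s z. 0 \<le> a \<Longrightarrow> a \<le> s \<Longrightarrow> s \<le> \<tau> \<Longrightarrow> primitive_on a s (\<lambda>t. f (z t) (u t)) z \<Longrightarrow>
       (\<lambda>t. r (z t) (u t)) integrable_on {a..s} \<Longrightarrow>
       p s \<bullet> (z s - y s) + l * (integral {a..s} (\<lambda>t. r (z t) (u t)) - cost a s)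
         \<le> p a \<bullet> (z a - y a) + C * (norm (z a - y a))\<^sup>2"
proof -
  have pac: "absolutely_continuous_on_interval 0 \<tau> p"
    using p \<tau>_pos unfolding caratheodory_solution_def by auto
  have pc: "continuous_on {0..\<tau>} p" by (rule absolutely_continuous_imp_continuous_on[OF pac])
  then have "bounded (p ` {0..\<tau>})" by (intro compact_imp_bounded compact_continuous_image) auto
  then obtain B where B: "B > 0" "\<And>t. t \<in> {0..\<tau>} \<Longrightarrow> norm (p t) \<le> B"
    unfolding bounded_pos by auto
  obtain Z where Z: "negligible Z" "\<And>t. t \<in> {0..\<tau>} - Z \<Longrightarrow>
     (p has_vector_derivative (- (transpose (Df (y t) (u t)) *v p t) - l *\<^sub>R Dr (y t) (u t))) (at t within {0..\<tau>})"
    by (rule caratheodory_derivative[OF p, of 0 \<tau>]) auto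
  define E where "E = exp (L * \<tau>)"
  show thesis
  \<comment> \<open>\<open>B\<close> weighs the remainder of \<open>f\<close>, 1 that of
    \<open>r\<close>, \<open>E\<^sup>2\<close> is the squared Gronwall factor and
    \<open>\<tau>\<close> bounds the length of the interval.\<close>
  proof (rule that[of "(B + 1) * L * E\<^sup>2 * \<tau>"])
    show "0 \<le> (B + 1) * L * E\<^sup>2 * \<tau>" using B L_pos \<tau>_pos by simp
    fix a s z
    assume as: "0 \<le> a" "a \<le> s" "s \<le> \<tau>" and z: "primitive_on a s (\<lambda>t. f (z t) (u t)) z"
      and rz: "(\<lambda>t. r (z t) (u t)) integrable_on {a..s}"
    define D where "D t = z t - y t" for t
    define Q where "Q = (\<lambda>t. f (z t) (u t) - f (y t) (u t))"
    have uU: "u t \<in> U" if "t \<in> {a..s}" for t using that as u by (auto simp: admissible_mem)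
    have D: "primitive_on a s Q D"
      unfolding Q_def D_def by (rule primitive_on_diff[OF z y_primitive[OF as(1)]])
    have QN: "norm (Q t) \<le> 2 * N" if "t \<in> {a..s}" for t
      unfolding Q_def using norm_triangle_ineq4[of "f (z t) (u t)" "f (y t) (u t)"] f_bound[OF uU[OF that]]
      by (smt (verit, best))
    obtain Z' where Z': "negligible Z'" "\<And>t. t \<in> {a..s} - Z' \<Longrightarrow> (D has_vector_derivative Q t) (at t within {a..s})"
      using primitive_on_derivative[OF D QN] by blast
    have Dac: "absolutely_continuous_on_interval a s D"
    proof (rule lipschitz_imp_absolutely_continuous)
      fix t t' assume "a \<le> t" "t \<le> t'" "t' \<le> s"
      then show "norm (D t' - D t) \<le> 2 * N * (t' - t)"
        using primitive_on_lipschitz[OF D QN, of t t'] by auto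
    qed
    have I1: "((\<lambda>t. (- (transpose (Df (y t) (u t)) *v p t) - l *\<^sub>R Dr (y t) (u t)) \<bullet> D t + p t \<bullet> Q t)
        has_integral (p s \<bullet> D s - p a \<bullet> D a)) {a..s}"
    proof (rule has_integral_inner_product[OF _ Dac as(2) negligible_Un[OF Z(1) Z'(1)]])
      show "absolutely_continuous_on_interval a s p"
        by (rule absolutely_continuous_subinterval[OF pac as(1,3)])
      show "(p has_vector_derivative (- (transpose (Df (y t) (u t)) *v p t) - l *\<^sub>R Dr (y t) (u t)))
          (at t within {a..s})" if "t \<in> {a..s} - (Z \<union> Z')" for t
        by (rule has_vector_derivative_within_subset[OF Z(2)]) (use that as in auto)
      show "(D has_vector_derivative Q t) (at t within {a..s})" if "t \<in> {a..s} - (Z \<union> Z')" for t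
        using Z'(2)[of t] that by auto
    qed
    have I2: "((\<lambda>t. l * (r (z t) (u t) - r (y t) (u t))) has_integral
        l * (integral {a..s} (\<lambda>t. r (z t) (u t)) - cost a s)) {a..s}"
      unfolding cost_def
      by (intro has_integral_mult_right has_integral_diff integrable_integral rz r_integrable as)
    have "p s \<bullet> D s - p a \<bullet> D a + l * (integral {a..s} (\<lambda>t. r (z t) (u t)) - cost a s)
        \<le> ((B + 1) * L * (norm (D a) * E)\<^sup>2) * (s - a)"
    proof (rule has_integral_le[OF has_integral_add[OF I1 I2]])
      show "((\<lambda>_. (B + 1) * L * (norm (D a) * E)\<^sup>2) has_integral ((B + 1) * L * (norm (D a) * E)\<^sup>2) * (s - a)) {a..s}"
        using has_integral_const_real[of "(B + 1) * L * (norm (D a) * E)\<^sup>2" a s] as by (simp add: mult.commute)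
      fix t assume t: "t \<in> {a..s}"
      let ?A = "Df (y t) (u t)" and ?R = "Dr (y t) (u t)"
      have gap: "norm (D t) \<le> norm (D a) * E"
      proof -
        have "norm (D t) \<le> norm (D a) * exp (L * (t - a))"
          unfolding D_def using solution_gap[OF z y_primitive[OF as(1)] uU t] .
        also have "\<dots> \<le> norm (D a) * E"
          unfolding E_def using t as L_pos by (intro mult_left_mono) auto
        finally show ?thesis .
      qed
      \<comment> \<open>This identity is the cancellation: the transposed Jacobian in the adjoint
        equation absorbs the linearization of \<open>f\<close>.\<close>
      have "(transpose ?A *v p t) \<bullet> D t = p t \<bullet> (?A *v D t)"
        by (simp add: transpose_matrix_vector dot_lmul_matrix)
      then have "(- (transpose ?A *v p t) - l *\<^sub>R ?R) \<bullet> D t + p t \<bullet> Q t + l * (r (z t) (u t) - r (y t) (u t))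
          = p t \<bullet> (Q t - ?A *v D t) + l * (r (z t) (u t) - r (y t) (u t) - ?R \<bullet> D t)"
        by (simp add: inner_simps algebra_simps)
      also have "\<dots> \<le> B * (L * (norm (D t))\<^sup>2) + 1 * (L * (norm (D t))\<^sup>2)"
      proof (rule add_mono)
        have "p t \<bullet> (Q t - ?A *v D t) \<le> norm (p t) * norm (Q t - ?A *v D t)"
          by (rule norm_cauchy_schwarz)
        also have "\<dots> \<le> B * (L * (norm (D t))\<^sup>2)"
          using f_remainder[OF uU[OF t], of "z t" "y t"] B(2)[of t] B(1) t as
          by (intro mult_mono) (auto simp: D_def Q_def)
        finally show "p t \<bullet> (Q t - ?A *v D t) \<le> B * (L * (norm (D t))\<^sup>2)" .
        have "r (z t) (u t) - r (y t) (u t) - ?R \<bullet> D t \<le> L * (norm (D t))\<^sup>2"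
          using r_remainder[OF uU[OF t], of "z t" "y t"] unfolding D_def by linarith
        then have "l * (r (z t) (u t) - r (y t) (u t) - ?R \<bullet> D t) \<le> l * (L * (norm (D t))\<^sup>2)"
          using l by (intro mult_left_mono)
        also have "\<dots> \<le> 1 * (L * (norm (D t))\<^sup>2)"
          using l L_pos by (intro mult_right_mono) auto
        finally show "l * (r (z t) (u t) - r (y t) (u t) - ?R \<bullet> D t) \<le> 1 * (L * (norm (D t))\<^sup>2)" .
      qed
      also have "\<dots> = (B + 1) * L * (norm (D t))\<^sup>2" by (simp add: algebra_simps)
      also have "\<dots> \<le> (B + 1) * L * (norm (D a) * E)\<^sup>2"
        using gap B L_pos by (intro mult_left_mono power_mono) auto
      finally show "(- (transpose ?A *v p t) - l *\<^sub>R ?R) \<bullet> D t + p t \<bullet> Q t + l * (r (z t) (u t) - r (y t) (u t))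
          \<le> (B + 1) * L * (norm (D a) * E)\<^sup>2" .
    qed
    also have "\<dots> \<le> ((B + 1) * L * (norm (D a) * E)\<^sup>2) * \<tau>"
      using as B L_pos by (intro mult_left_mono) auto
    also have "\<dots> = (B + 1) * L * E\<^sup>2 * \<tau> * (norm (D a))\<^sup>2" by (simp add: power_mult_distrib mult_ac)
    finally show "p s \<bullet> (z s - y s) + l * (integral {a..s} (\<lambda>t. r (z t) (u t)) - cost a s)
         \<le> p a \<bullet> (z a - y a) + (B + 1) * L * E\<^sup>2 * \<tau> * (norm (z a - y a))\<^sup>2"
      by (simp add: D_def)
  qed
qed

end

section \<open>Variations of the optimal control\<close>

context optimal_exit begin

lemma u_mem: "0 \<le> s \<Longrightarrow> u s \<in> U"
  using u by (rule admissible_mem)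

lemma cost_ge: "0 \<le> a \<Longrightarrow> a \<le> b \<Longrightarrow> r\<^sub>0 * (b - a) \<le> cost a b"
  unfolding cost_def by (rule cost_lower[OF u y])

lemma y_lipschitz: "0 \<le> s \<Longrightarrow> 0 \<le> t \<Longrightarrow> norm (y t - y s) \<le> N * \<bar>t - s\<bar>"
  by (rule solves_lipschitz[OF u y])

lemma steer_y: "0 \<le> t \<Longrightarrow> steer x (y t) (cost 0 t)"
  unfolding cost_def using steer_along[OF u y, of 0 t] y by (simp add: solves_def)

text \<open>The form in which optimality is used: no way of reaching, at cost \<open>c\<close>, a point close to
  \<open>y t\<close> improves on \<open>y\<close> to first order, when points are priced by \<open>p t\<close> and costs by \<open>l\<close>.\<close>

definition extremal :: "real \<Rightarrow> (real \<Rightarrow> real ^ 'd) \<Rightarrow> bool" where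
  "extremal l p \<longleftrightarrow> (\<forall>t K \<eta>. 0 \<le> t \<longrightarrow> t < \<tau> \<longrightarrow> K > 0 \<longrightarrow> \<eta> > 0 \<longrightarrow>
     (\<forall>\<^sub>F \<epsilon> in at_right 0. \<forall>z c. steer x z c \<longrightarrow> norm (z - y t) \<le> K * \<epsilon> \<longrightarrow> \<bar>c - cost 0 t\<bar> \<le> K * \<epsilon> \<longrightarrow>
        - \<eta> * \<epsilon> \<le> l * (c - cost 0 t) + p t \<bullet> (z - y t)))"

section \<open>Estimates at the end point\<close>

lemma superdifferential_norm_le:
  assumes q: "q \<in> superdifferential g xs"
  shows "norm q \<le> G"
proof (rule field_le_epsilon)
  fix \<eta> :: real assume "\<eta> > 0"
  obtain \<delta> where \<delta>: "\<delta> > 0"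
    "\<And>P. norm (P - xs) < \<delta> \<Longrightarrow> g P \<le> g xs + q \<bullet> (P - xs) + \<eta> * norm (P - xs)"
    using superdifferentialD[OF q \<open>\<eta> > 0\<close>] by blast
  obtain \<rho> where \<rho>: "\<rho> > 0" "\<And>P. norm (P - xs) < \<rho> \<Longrightarrow> P \<in> \<N>" using near_xs by blast
  show "norm q \<le> G + \<eta>"
  proof (cases "q = 0")
    case True then show ?thesis using G_nonneg \<open>\<eta> > 0\<close> by simp
  next
    case False
    define e where "e = min \<delta> \<rho> / 2"
    have e: "e > 0" "e < \<delta>" "e < \<rho>" using \<delta>(1) \<rho>(1) by (auto simp: e_def)
    \<comment> \<open>Steepest descent: along \<open>- q\<close> the superdifferential forces
      \<open>g\<close> to fall at rate about \<open>norm q\<close>, while the Lipschitz condition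
      allows rate \<open>G\<close> at most.\<close>
    define P where "P = xs - (e / norm q) *\<^sub>R q"
    have nP: "norm (P - xs) = e" using False e by (simp add: P_def)
    have "q \<bullet> (P - xs) = - (e * norm q)"
      using False by (simp add: P_def dot_square_norm power2_eq_square)
    then have "g P \<le> g xs - e * norm q + \<eta> * e" using \<delta>(2)[of P] nP e by simp
    moreover have "\<bar>g P - g xs\<bar> \<le> G * e"
      using g_lipschitz[OF xs_mem(2) \<rho>(2)[of P]] nP e by simp
    ultimately have "e * norm q \<le> e * (G + \<eta>)" by (simp add: algebra_simps abs_le_iff)
    then show ?thesis using e(1) by simp
  qed
qed

text \<open>A point violating the proximal inequality cannot lie in the closure of the complement.
  This is how end points of competitors are certified.\<close>

lemma normal_mem_S:
  assumes normal: "\<And>P. P \<in> closure (- S) \<Longrightarrow> \<xi> \<bullet> (P - xs) \<le> \<sigma> * (norm (P - xs))\<^sup>2"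
    and P: "\<xi> \<bullet> (P - xs) > \<sigma> * (norm (P - xs))\<^sup>2"
  shows "P \<in> S"
  using normal[of P] P closure_subset[of "- S"] by fastforce

text \<open>The constant control maximizing the Hamiltonian at \<open>xs\<close> crosses the boundary transversally,
  and this bounds the cost of reaching \<open>S\<close> from above to first order.\<close>

lemma terminal_estimate:
  assumes q: "q \<in> superdifferential g xs" and \<sigma>: "\<sigma> \<ge> 0"
    and normal: "\<And>P. P \<in> closure (- S) \<Longrightarrow> \<xi> \<bullet> (P - xs) \<le> \<sigma> * (norm (P - xs))\<^sup>2"
    and \<omega>: "\<omega> \<in> U" "- ((q - \<xi>) \<bullet> f xs \<omega>) - r xs \<omega> = 0" and "\<eta> > 0"
  obtains \<delta> where "\<delta> > 0"
    "\<And>P. norm (P - xs) < \<delta> \<Longrightarrow> \<xi> \<bullet> (P - xs) \<le> \<sigma> * (norm (P - xs))\<^sup>2 \<Longrightarrow>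
       \<exists>Q c. steer P Q c \<and> Q \<in> S \<and> Q \<in> \<N> \<and>
         c + g Q \<le> g xs + (q - \<xi>) \<bullet> (P - xs) + \<eta> * norm (P - xs)"
proof -
  define fs where "fs = f xs \<omega>"
  define rs where "rs = r xs \<omega>"
  \<comment> \<open>Crossing speed in direction \<open>\<xi>\<close>. Vanishing of the Hamiltonian
    turns it into \<open>q \<bullet> fs + rs\<close>, which is at least
    \<open>r\<^sub>0 - G * N > 0\<close>.\<close>
  define k where "k = \<xi> \<bullet> fs"
  have k_eq: "k = q \<bullet> fs + rs" using \<omega>(2) by (simp add: k_def fs_def rs_def inner_diff_left)
  have k: "k > 0"
  proof -
    have "\<bar>q \<bullet> fs\<bar> \<le> G * N"
      using Cauchy_Schwarz_ineq2[of q fs] superdifferential_norm_le[OF q] f_bound[OF \<omega>(1), of xs] G_nonneg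
      by (smt (verit) fs_def mult_mono norm_ge_zero)
    then show ?thesis using r_lower[OF \<omega>(1), of xs] GN_less k_eq by (simp add: rs_def)
  qed
  \<comment> \<open>\<open>K * e\<close> bounds the crossing time from a point at distance
    \<open>e\<close>. \<open>C\<close> collects the quadratic errors: that of
    \<open>steer_const\<close> and that of freezing \<open>f\<close> and \<open>r\<close> at
    \<open>xs\<close>. \<open>M * e\<close> bounds the distance of the end point from
    \<open>xs\<close>.\<close>
  define K where "K = (norm \<xi> + 1) / k"
  have K: "K > 0" using k by (simp add: K_def add_nonneg_pos)
  define C where "C = L * N * K\<^sup>2 + L * K"
  have C: "C > 0" using K L_pos N_pos by (simp add: C_def add_pos_pos)
  define M where "M = 1 + N * K + C"
  have M: "M > 0" using C K N_pos by (simp add: M_def add_pos_pos)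
  \<comment> \<open>Relative overshoot beyond the hyperplane: linear in \<open>e\<close>, so that it
    beats the quadratic errors, yet cheap enough to fit into the tolerance
    \<open>\<eta>\<close>.\<close>
  define \<mu> where "\<mu> = min 1 (\<eta> / 4)"
  have \<mu>: "0 < \<mu>" "\<mu> \<le> 1" "\<mu> \<le> \<eta> / 4" using \<open>\<eta> > 0\<close> by (auto simp: \<mu>_def)
  define \<nu> where "\<nu> = \<eta> / (4 * M)"
  have \<nu>: "\<nu> > 0" "\<nu> * M = \<eta> / 4" using \<open>\<eta> > 0\<close> M by (auto simp: \<nu>_def)
  obtain \<delta>1 where \<delta>1: "\<delta>1 > 0"
    "\<And>P. norm (P - xs) < \<delta>1 \<Longrightarrow> g P \<le> g xs + q \<bullet> (P - xs) + \<nu> * norm (P - xs)"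
    using superdifferentialD[OF q \<nu>(1)] by blast
  obtain \<delta>2 where \<delta>2: "\<delta>2 > 0" "\<And>P. norm (P - xs) < \<delta>2 \<Longrightarrow> P \<in> \<N>" using near_xs by blast
  have "\<forall>\<^sub>F e in at_right 0. \<sigma> * e < \<mu> \<and> (norm \<xi> * C + \<sigma> * M\<^sup>2) * e < \<mu> \<and> ((1 + norm q) * C) * e < \<eta> / 4 \<and>
      M * e < \<delta>1 \<and> M * e < \<delta>2 \<and> 1 * e < 1"
    using \<mu>(1) \<open>\<eta> > 0\<close> \<delta>1(1) \<delta>2(1) by (intro eventually_conj eventually_mult_small) auto
  then obtain \<delta> where \<delta>: "\<delta> > 0" "\<And>e. 0 < e \<Longrightarrow> e < \<delta> \<Longrightarrow> \<sigma> * e < \<mu> \<and> (norm \<xi> * C + \<sigma> * M\<^sup>2) * e < \<mu> \<and>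
      ((1 + norm q) * C) * e < \<eta> / 4 \<and> M * e < \<delta>1 \<and> M * e < \<delta>2 \<and> 1 * e < 1"
    unfolding eventually_at_right_field by blast
  show thesis
  proof (rule that[OF \<delta>(1)])
    fix P assume P: "norm (P - xs) < \<delta>" "\<xi> \<bullet> (P - xs) \<le> \<sigma> * (norm (P - xs))\<^sup>2"
    show "\<exists>Q c. steer P Q c \<and> Q \<in> S \<and> Q \<in> \<N> \<and>
         c + g Q \<le> g xs + (q - \<xi>) \<bullet> (P - xs) + \<eta> * norm (P - xs)"
    proof (cases "P = xs")
      case True
      then show ?thesis using steer_refl[of xs] xs_mem by (intro exI[of _ xs] exI[of _ 0]) simp
    next
      case False
      define e where "e = norm (P - xs)"
      have e0: "e > 0" using False by (simp add: e_def)
      have e: "\<sigma> * e < \<mu>" "(norm \<xi> * C + \<sigma> * M\<^sup>2) * e < \<mu>" "((1 + norm q) * C) * e < \<eta> / 4"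
        "M * e < \<delta>1" "M * e < \<delta>2" "e < 1"
        using \<delta>(2)[OF e0] P(1) by (auto simp: e_def)
      \<comment> \<open>To first order, \<open>\<xi> \<bullet> (Q - xs) = \<mu> * e\<close> after
        time \<open>T\<close>. The hypothesis on \<open>P\<close> ensures
        \<open>T \<ge> 0\<close>.\<close>
      define T where "T = (\<mu> * e - \<xi> \<bullet> (P - xs)) / k"
      have Tk: "T * k = \<mu> * e - \<xi> \<bullet> (P - xs)" using k by (simp add: T_def)
      have "\<xi> \<bullet> (P - xs) \<le> \<sigma> * e * e" using P(2) by (simp add: e_def power2_eq_square mult.assoc)
      also have "\<dots> \<le> \<mu> * e" using e(1) e0 by (intro mult_right_mono) auto
      finally have T0: "T \<ge> 0" using k by (simp add: T_def)
      have "T * k \<le> (norm \<xi> + 1) * e"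
      proof -
        have "- (\<xi> \<bullet> (P - xs)) \<le> norm \<xi> * e" using Cauchy_Schwarz_ineq2[of \<xi> "P - xs"] by (simp add: e_def abs_le_iff)
        moreover have "\<mu> * e \<le> 1 * e" using \<mu> e0 by (intro mult_right_mono) auto
        ultimately show ?thesis unfolding Tk by (simp add: algebra_simps)
      qed
      then have TK: "T \<le> K * e" using k by (simp add: K_def pos_le_divide_eq)
      obtain Q c where Qc: "steer P Q c" "norm (Q - P - T *\<^sub>R f P \<omega>) \<le> L * N * T\<^sup>2"
        "\<bar>c - T * r P \<omega>\<bar> \<le> L * N * T\<^sup>2"
        using steer_const[OF \<omega>(1) T0] by metis
      have T2: "L * N * T\<^sup>2 + T * (L * e) \<le> C * e\<^sup>2"
      proof -
        have "T\<^sup>2 \<le> (K * e)\<^sup>2" using T0 TK by (rule power_mono[rotated])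
        then have "L * N * T\<^sup>2 \<le> L * N * (K * e)\<^sup>2" using L_pos N_pos by (intro mult_left_mono) auto
        moreover have "T * (L * e) \<le> K * e * (L * e)" using TK L_pos e0 by (intro mult_right_mono) auto
        ultimately show ?thesis by (simp add: C_def power2_eq_square algebra_simps)
      qed
      define \<rho> where "\<rho> = Q - P - T *\<^sub>R fs"
      have \<rho>: "norm \<rho> \<le> C * e\<^sup>2"
      proof -
        have "norm (T *\<^sub>R (f P \<omega> - fs)) \<le> T * (L * e)"
          using f_lipschitz[OF \<omega>(1), of P xs] T0 by (simp add: fs_def e_def mult_left_mono)
        moreover have "\<rho> = (Q - P - T *\<^sub>R f P \<omega>) + T *\<^sub>R (f P \<omega> - fs)"
          by (simp add: \<rho>_def algebra_simps)
        then have "norm \<rho> \<le> norm (Q - P - T *\<^sub>R f P \<omega>) + norm (T *\<^sub>R (f P \<omega> - fs))"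
          using norm_triangle_ineq by metis
        ultimately show ?thesis using Qc(2) T2 by linarith
      qed
      have c: "c \<le> T * rs + C * e\<^sup>2"
      proof -
        have "T * r P \<omega> \<le> T * (rs + L * e)"
          using r_lipschitz[OF \<omega>(1), of P xs] T0 by (intro mult_left_mono) (auto simp: rs_def e_def)
        then show ?thesis using Qc(3) T2 by (simp add: algebra_simps)
      qed
      have ee: "e\<^sup>2 \<le> e" using e0 e(6) by (simp add: power2_eq_square mult_left_le)
      have Q_eq: "Q - xs = (P - xs) + T *\<^sub>R fs + \<rho>" by (simp add: \<rho>_def)
      have QM: "norm (Q - xs) \<le> M * e"
      proof -
        have "norm (T *\<^sub>R fs) \<le> K * e * N"
          using f_bound[OF \<omega>(1), of xs] TK T0 K e0 by (auto simp: fs_def intro!: mult_mono)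
        moreover have "C * e\<^sup>2 \<le> C * e" using ee C by simp
        ultimately show ?thesis
          unfolding Q_eq using \<rho> norm_triangle_ineq[of "(P - xs) + T *\<^sub>R fs" \<rho>] norm_triangle_ineq[of "P - xs" "T *\<^sub>R fs"]
          by (simp add: M_def e_def[symmetric] algebra_simps)
      qed
      have "\<sigma> * (norm (Q - xs))\<^sup>2 < \<xi> \<bullet> (Q - xs)"
      proof -
        have "\<xi> \<bullet> (Q - xs) = \<mu> * e + \<xi> \<bullet> \<rho>"
          unfolding Q_eq using Tk by (simp add: inner_simps k_def)
        moreover have "- (\<xi> \<bullet> \<rho>) \<le> norm \<xi> * (C * e\<^sup>2)"
          using Cauchy_Schwarz_ineq2[of \<xi> \<rho>] \<rho> by (smt (verit) mult_left_mono norm_ge_zero)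
        moreover have "\<sigma> * (norm (Q - xs))\<^sup>2 \<le> \<sigma> * (M * e)\<^sup>2"
          using QM \<sigma> by (intro mult_left_mono power_mono) auto
        moreover have "norm \<xi> * (C * e\<^sup>2) + \<sigma> * (M * e)\<^sup>2 = (norm \<xi> * C + \<sigma> * M\<^sup>2) * e * e"
          by (simp add: power2_eq_square algebra_simps)
        moreover have "(norm \<xi> * C + \<sigma> * M\<^sup>2) * e * e < \<mu> * e"
          using e(2) e0 by (intro mult_strict_right_mono)
        ultimately show ?thesis by linarith
      qed
      then have QS: "Q \<in> S" using normal by (rule normal_mem_S[rotated])
      have QN: "Q \<in> \<N>" using \<delta>2(2)[of Q] QM e(5) by simp
      have "g Q \<le> g xs + q \<bullet> (Q - xs) + \<nu> * norm (Q - xs)" using \<delta>1(2)[of Q] QM e(4) by simp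
      also have "\<dots> \<le> g xs + q \<bullet> (Q - xs) + \<eta> / 4 * e"
        using mult_left_mono[OF QM, of \<nu>] \<nu> by (simp add: mult.assoc[symmetric])
      also have "q \<bullet> (Q - xs) \<le> q \<bullet> (P - xs) + T * (q \<bullet> fs) + norm q * (C * e\<^sup>2)"
        unfolding Q_eq using Cauchy_Schwarz_ineq2[of q \<rho>] mult_left_mono[OF \<rho>, of "norm q"]
        by (simp add: inner_simps abs_le_iff)
      \<comment> \<open>The terms \<open>T * rs\<close> and \<open>T * (q \<bullet> fs)\<close> add
        up to \<open>T * k\<close>, which by the choice of \<open>T\<close> is
        \<open>- (\<xi> \<bullet> (P - xs))\<close> up to the overshoot; this produces the price
        \<open>q - \<xi>\<close>.\<close>
      finally have "c + g Q \<le> g xs + q \<bullet> (P - xs) + T * k + (1 + norm q) * C * e * e + \<eta> / 4 * e"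
        using c by (simp add: k_eq algebra_simps power2_eq_square)
      also have "(1 + norm q) * C * e * e \<le> \<eta> / 4 * e"
        using e(3) e0 by (intro mult_right_mono) auto
      also have "T * k \<le> \<eta> / 4 * e - \<xi> \<bullet> (P - xs)"
        unfolding Tk using mult_right_mono[OF \<mu>(3), of e] e0 by simp
      finally have "c + g Q \<le> g xs + (q - \<xi>) \<bullet> (P - xs) + 3 / 4 * (\<eta> * e)"
        by (simp add: inner_diff_left algebra_simps)
      moreover have "0 \<le> \<eta> * e" using \<open>\<eta> > 0\<close> e0 by simp
      ultimately have "c + g Q \<le> g xs + (q - \<xi>) \<bullet> (P - xs) + \<eta> * norm (P - xs)"
        by (simp add: e_def[symmetric])
      then show ?thesis using Qc(1) QS QN by blast
    qed
  qed
qed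

text \<open>The integrand is nonnegative when the state is frozen at \<open>xs\<close>. Over the
  last \<open>h\<close> time units the state is within \<open>N * h\<close> of \<open>xs\<close>, so
  unfreezing costs order \<open>h\<close> pointwise and order \<open>h\<^sup>2\<close> after
  integration.\<close>

lemma terminal_increment_ge:
  assumes h: "0 \<le> h" "h \<le> \<tau>" and l: "0 \<le> l" "l \<le> 1"
    and max: "\<And>\<omega>. \<omega> \<in> U \<Longrightarrow> 0 \<le> \<pi> \<bullet> f xs \<omega> + l * r xs \<omega>"
  shows "- ((norm \<pi> + 1) * L * N * h\<^sup>2) \<le> \<pi> \<bullet> (xs - y (\<tau> - h)) + l * cost (\<tau> - h) \<tau>"
proof -
  have "((\<lambda>s. \<pi> \<bullet> f (y s) (u s)) has_integral \<pi> \<bullet> (y \<tau> - y (\<tau> - h))) {\<tau> - h..\<tau>}"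
    using has_integral_linear[OF primitive_onD[OF y_primitive[of "\<tau> - h" \<tau>], of "\<tau> - h" \<tau>]
        bounded_linear_inner_right[of \<pi>]] h by (simp add: o_def)
  moreover have "((\<lambda>s. l * r (y s) (u s)) has_integral l * cost (\<tau> - h) \<tau>) {\<tau> - h..\<tau>}"
    unfolding cost_def by (intro has_integral_mult_right integrable_integral r_integrable) (use h in auto)
  ultimately have I: "((\<lambda>s. \<pi> \<bullet> f (y s) (u s) + l * r (y s) (u s)) has_integral
      \<pi> \<bullet> (y \<tau> - y (\<tau> - h)) + l * cost (\<tau> - h) \<tau>) {\<tau> - h..\<tau>}"
    by (rule has_integral_add)
  have "((\<lambda>s. - ((norm \<pi> + 1) * (L * (N * h)))) has_integral h * (- ((norm \<pi> + 1) * (L * (N * h))))) {\<tau> - h..\<tau>}"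
    using has_integral_const_real[of "- ((norm \<pi> + 1) * (L * (N * h)))" "\<tau> - h" \<tau>] h by simp
  then have "h * (- ((norm \<pi> + 1) * (L * (N * h)))) \<le> \<pi> \<bullet> (y \<tau> - y (\<tau> - h)) + l * cost (\<tau> - h) \<tau>"
  proof (rule has_integral_le[OF _ I])
    fix s assume s: "s \<in> {\<tau> - h..\<tau>}"
    then have s0: "0 \<le> s" using h by auto
    have "norm (y s - y \<tau>) \<le> N * \<bar>s - \<tau>\<bar>" using s0 \<tau>_pos by (intro y_lipschitz) auto
    also have "\<dots> \<le> N * h" using s N_pos by (intro mult_left_mono) auto
    finally have LN: "L * norm (y s - xs) \<le> L * (N * h)" using L_pos by (simp add: xs)
    then have "norm (f (y s) (u s) - f xs (u s)) \<le> L * (N * h)"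
      using f_lipschitz[OF u_mem[OF s0], of "y s" xs] by simp
    then have "norm \<pi> * norm (f (y s) (u s) - f xs (u s)) \<le> norm \<pi> * (L * (N * h))"
      by (intro mult_left_mono) auto
    then have 1: "- (norm \<pi> * (L * (N * h))) \<le> \<pi> \<bullet> f (y s) (u s) - \<pi> \<bullet> f xs (u s)"
      using Cauchy_Schwarz_ineq2[of \<pi> "f (y s) (u s) - f xs (u s)"] by (simp add: inner_diff_right abs_le_iff)
    have "\<bar>r (y s) (u s) - r xs (u s)\<bar> \<le> L * (N * h)"
      using r_lipschitz[OF u_mem[OF s0], of "y s" xs] LN by simp
    then have "l * (- (L * (N * h))) \<le> l * (r (y s) (u s) - r xs (u s))"
      using l by (intro mult_left_mono) auto
    moreover have "l * (L * (N * h)) \<le> 1 * (L * (N * h))"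
      using l L_pos N_pos h by (intro mult_right_mono) auto
    ultimately show "- ((norm \<pi> + 1) * (L * (N * h))) \<le> \<pi> \<bullet> f (y s) (u s) + l * r (y s) (u s)"
      using max[OF u_mem[OF s0]] 1 by (simp add: algebra_simps)
  qed
  then show ?thesis by (simp add: xs power2_eq_square mult_ac)
qed

section \<open>Extremality of the adjoint arc in the normal and the abnormal case\<close>

lemma parallel_trajectory:
  assumes t: "0 \<le> t" "t \<le> \<tau>"
  obtains z where "z t = P" "\<And>T. primitive_on t T (\<lambda>s. f (z s) (u s)) z"
    "\<And>s. (\<lambda>s. r (z s) (u s)) integrable_on {t..s}"
    "\<And>s. t \<le> s \<Longrightarrow> steer P (z s) (integral {t..s} (\<lambda>s. r (z s) (u s)))"
    "\<And>s. t \<le> s \<Longrightarrow> s \<le> \<tau> \<Longrightarrow> norm (z s - y s) \<le> norm (P - y t) * exp (L * \<tau>)"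
proof -
  obtain z where z: "z t = P" "\<And>T. primitive_on t T (\<lambda>s. f (z s) (u s)) z"
    "\<And>s. (\<lambda>s. r (z s) (u s)) integrable_on {t..s}"
    "\<And>s. t \<le> s \<Longrightarrow> steer P (z s) (integral {t..s} (\<lambda>s. r (z s) (u s)))"
    by (rule steer_parallel[OF u t(1), of P]) blast
  moreover have "norm (z s - y s) \<le> norm (P - y t) * exp (L * \<tau>)" if s: "t \<le> s" "s \<le> \<tau>" for s
  proof -
    have "norm (z s - y s) \<le> norm (z t - y t) * exp (L * (s - t))"
      using solution_gap[OF z(2)[of s] y_primitive[OF t(1)], of s] s t u_mem by auto
    also have "\<dots> \<le> norm (z t - y t) * exp (L * \<tau>)"
      using s t L_pos by (intro mult_left_mono) auto
    finally show ?thesis using z(1) by simp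
  qed
  ultimately show thesis by (rule that)
qed

lemma adjoint_continuous:
  assumes "caratheodory_solution {0..\<tau>} F p"
  shows "continuous_on {0..\<tau>} p"
  using assms \<tau>_pos
  by (intro absolutely_continuous_imp_continuous_on) (auto simp: caratheodory_solution_def)

lemma left_limit_estimate:
  assumes p: "continuous_on {0..\<tau>} p" and t: "0 < t" "t \<le> \<tau>" and "\<eta> > 0"
  obtains \<delta> where "\<delta> > 0" "\<And>h. 0 \<le> h \<Longrightarrow> h < \<delta> \<Longrightarrow> h \<le> t \<Longrightarrow> norm (p (t - h) - p t) \<le> \<eta>"
proof -
  obtain \<delta> where \<delta>: "\<delta> > 0" "\<forall>s\<in>{0..\<tau>}. dist s t < \<delta> \<longrightarrow> dist (p s) (p t) < \<eta>"
    using p[unfolded continuous_on_iff, rule_format, of t \<eta>] t \<open>\<eta> > 0\<close> by auto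
  have "norm (p (t - h) - p t) \<le> \<eta>" if "0 \<le> h" "h < \<delta>" "h \<le> t" for h
    using \<delta>(2)[rule_format, of "t - h"] that t by (auto simp: dist_norm)
  with \<delta>(1) show thesis by (rule that)
qed

text \<open>After the perturbation the original control is followed until \<open>\<tau> - h\<close>,
  where \<open>terminal_estimate\<close> takes over. Its price \<open>q - \<xi>\<close> for the
  displacement is carried back to time \<open>t\<close> by \<open>adjoint_estimate\<close>, and the
  last stretch that \<open>y\<close> would have run is priced by
  \<open>terminal_increment_ge\<close>. With \<open>h\<close> proportional to
  \<open>\<epsilon>\<close> all errors are below \<open>\<eta> * \<epsilon>\<close>.\<close>

theorem extremal_normal:
  assumes q: "q \<in> superdifferential g xs" and \<sigma>: "\<sigma> \<ge> 0"
    and normal: "\<And>P. P \<in> closure (- S) \<Longrightarrow> \<xi> \<bullet> (P - xs) \<le> \<sigma> * (norm (P - xs))\<^sup>2"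
    and \<omega>: "\<omega> \<in> U" "- ((q - \<xi>) \<bullet> f xs \<omega>) - r xs \<omega> = 0"
    and max: "\<And>\<omega>. \<omega> \<in> U \<Longrightarrow> - ((q - \<xi>) \<bullet> f xs \<omega>) - r xs \<omega> \<le> 0"
    and p: "caratheodory_solution {0..\<tau>} (\<lambda>t z. - (transpose (Df (y t) (u t)) *v z) - Dr (y t) (u t)) p"
    and p\<tau>: "p \<tau> = q - \<xi>"
  shows "extremal 1 p"
  unfolding extremal_def
proof (intro allI impI)
  fix t K \<eta> :: real assume t: "0 \<le> t" "t < \<tau>" and "K > 0" "\<eta> > 0"
  \<comment> \<open>Least gain per unit of time saved: running cost minus the largest possible
    change of the terminal cost.\<close>
  define c0 where "c0 = r\<^sub>0 - G * N"
  have c0: "c0 > 0" using GN_less by (simp add: c0_def)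
  define A where "A = K * exp (L * \<tau>)"
  have A: "A > 0" using \<open>K > 0\<close> by (simp add: A_def)
  \<comment> \<open>Solves \<open>c0 / 2 * (B * \<epsilon>) = norm \<xi> * (A * \<epsilon>) +
    \<epsilon>\<close>: the distance of \<open>y\<close> from the hyperplane at time
    \<open>\<tau> - B * \<epsilon>\<close> exceeds the effect of the displacement.\<close>
  define B where "B = 2 * (norm \<xi> * A + 1) / c0"
  have B: "B > 0" using c0 A by (simp add: B_def add_nonneg_pos)
  define M where "M = A + N * B"
  have M: "M > 0" using A B N_pos by (simp add: M_def add_pos_pos)
  obtain C where C: "C \<ge> 0"
    "\<And>a s z. 0 \<le> a \<Longrightarrow> a \<le> s \<Longrightarrow> s \<le> \<tau> \<Longrightarrow> primitive_on a s (\<lambda>t. f (z t) (u t)) z \<Longrightarrow>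
       (\<lambda>t. r (z t) (u t)) integrable_on {a..s} \<Longrightarrow>
       p s \<bullet> (z s - y s) + 1 * (integral {a..s} (\<lambda>t. r (z t) (u t)) - cost a s)
         \<le> p a \<bullet> (z a - y a) + C * (norm (z a - y a))\<^sup>2"
    using adjoint_estimate[of 1 p] p by auto
  obtain \<delta>T where \<delta>T: "\<delta>T > 0"
    "\<And>P. norm (P - xs) < \<delta>T \<Longrightarrow> \<xi> \<bullet> (P - xs) \<le> \<sigma> * (norm (P - xs))\<^sup>2 \<Longrightarrow>
       \<exists>Q c. steer P Q c \<and> Q \<in> S \<and> Q \<in> \<N> \<and>
         c + g Q \<le> g xs + (q - \<xi>) \<bullet> (P - xs) + \<eta> / (4 * M) * norm (P - xs)"
    using terminal_estimate[OF q \<sigma> normal \<omega>, of "\<eta> / (4 * M)"] \<open>\<eta> > 0\<close> M by (metis divide_pos_pos mult_pos_pos zero_less_numeral)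
  obtain \<delta>A where \<delta>A: "\<delta>A > 0"
    "\<And>P. norm (P - xs) < \<delta>A \<Longrightarrow> \<xi> \<bullet> (P - xs) \<le> \<sigma> * (norm (P - xs))\<^sup>2 \<Longrightarrow>
       \<exists>Q c. steer P Q c \<and> Q \<in> S \<and> Q \<in> \<N> \<and>
         c + g Q \<le> g xs + (q - \<xi>) \<bullet> (P - xs) + c0 / (2 * N) * norm (P - xs)"
    using terminal_estimate[OF q \<sigma> normal \<omega>, of "c0 / (2 * N)"] c0 N_pos by (metis divide_pos_pos mult_pos_pos zero_less_numeral)
  obtain \<delta>p where \<delta>p: "\<delta>p > 0" "\<And>h. 0 \<le> h \<Longrightarrow> h < \<delta>p \<Longrightarrow> h \<le> \<tau> \<Longrightarrow> norm (p (\<tau> - h) - p \<tau>) \<le> \<eta> / (4 * A)"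
    using left_limit_estimate[OF adjoint_continuous[OF p] \<tau>_pos order_refl, of "\<eta> / (4 * A)"] \<open>\<eta> > 0\<close> A
    by (metis divide_pos_pos mult_pos_pos zero_less_numeral)
  have yh: "norm (y (\<tau> - h) - xs) \<le> N * h" if "0 \<le> h" "h \<le> \<tau>" for h
    using y_lipschitz[of \<tau> "\<tau> - h"] that \<tau>_pos by (simp add: xs)
  \<comment> \<open>\<open>terminal_estimate\<close> is applied to \<open>y\<close> itself. By
    optimality the shortcut cannot be cheaper than
    \<open>cost (\<tau> - h) \<tau> \<ge> r\<^sub>0 * h\<close>; subtracting the change
    \<open>G * N * h\<close> and the tolerance \<open>c0 / 2 * h\<close> leaves
    \<open>c0 / 2 * h\<close>.\<close>
  have transversal: "c0 / 2 * h \<le> \<xi> \<bullet> (xs - y (\<tau> - h))" if h: "0 < h" "h \<le> \<tau>" "N * h < \<delta>A" for h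
  proof -
    let ?P = "y (\<tau> - h)"
    have Ph: "norm (?P - xs) \<le> N * h" using yh h by simp
    have "?P \<in> closure (- S)" using outside[of "\<tau> - h"] h closure_subset[of "- S"] by auto
    then obtain Q c where Qc: "steer ?P Q c" "Q \<in> S" "Q \<in> \<N>"
      "c + g Q \<le> g xs + (q - \<xi>) \<bullet> (?P - xs) + c0 / (2 * N) * norm (?P - xs)"
      using \<delta>A(2)[of ?P] normal[of ?P] Ph h(3) by auto
    have "cost 0 \<tau> + g xs \<le> cost 0 (\<tau> - h) + c + g Q"
      using optimality[OF steer_trans[OF steer_y[of "\<tau> - h"] Qc(1)] Qc(2,3)] h by (simp add: cost_def)
    moreover have "cost 0 \<tau> = cost 0 (\<tau> - h) + cost (\<tau> - h) \<tau>" using h by (intro cost_combine) auto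
    moreover have "r\<^sub>0 * h \<le> cost (\<tau> - h) \<tau>" using cost_ge[of "\<tau> - h" \<tau>] h by simp
    moreover have "q \<bullet> (?P - xs) \<le> G * (N * h)"
      by (rule inner_le_norm_bounds[OF superdifferential_norm_le[OF q] Ph])
    moreover have "c0 / (2 * N) * norm (?P - xs) \<le> c0 / (2 * N) * (N * h)"
      using Ph c0 N_pos by (intro mult_left_mono) auto
    moreover have "c0 / (2 * N) * (N * h) = c0 / 2 * h" using N_pos by simp
    moreover have "\<xi> \<bullet> (?P - xs) = - (\<xi> \<bullet> (xs - ?P))" by (simp add: inner_diff_right)
    moreover have "r\<^sub>0 * h - G * (N * h) = c0 * h" by (simp add: c0_def algebra_simps)
    ultimately show ?thesis using Qc(4) by (simp add: inner_diff_left)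
  qed
  \<comment> \<open>Coefficient of \<open>\<epsilon>\<^sup>2\<close> in the two quadratic errors,
    from \<open>terminal_increment_ge\<close> and \<open>adjoint_estimate\<close>.\<close>
  define D where "D = (norm (q - \<xi>) + 1) * L * N * B\<^sup>2 + C * K\<^sup>2"
  have "\<forall>\<^sub>F \<epsilon> in at_right 0. \<epsilon> > 0 \<and> B * \<epsilon> < \<tau> - t \<and> (N * B) * \<epsilon> < \<delta>A \<and> M * \<epsilon> < \<delta>T \<and> B * \<epsilon> < \<delta>p \<and> D * \<epsilon> < \<eta> / 4"
    using t(2) \<delta>A(1) \<delta>T(1) \<delta>p(1) \<open>\<eta> > 0\<close>
    by (intro eventually_conj eventually_mult_small eventually_at_right_less) auto
  then show "\<forall>\<^sub>F \<epsilon> in at_right 0. \<forall>z c. steer x z c \<longrightarrow> norm (z - y t) \<le> K * \<epsilon> \<longrightarrow> \<bar>c - cost 0 t\<bar> \<le> K * \<epsilon> \<longrightarrow>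
        - \<eta> * \<epsilon> \<le> 1 * (c - cost 0 t) + p t \<bullet> (z - y t)"
  proof (rule eventually_mono, intro allI impI)
    fix \<epsilon> z0 c
    assume \<epsilon>: "\<epsilon> > 0 \<and> B * \<epsilon> < \<tau> - t \<and> (N * B) * \<epsilon> < \<delta>A \<and> M * \<epsilon> < \<delta>T \<and> B * \<epsilon> < \<delta>p \<and> D * \<epsilon> < \<eta> / 4"
      and zc: "steer x z0 c" "norm (z0 - y t) \<le> K * \<epsilon>"
    define h where "h = B * \<epsilon>"
    define s where "s = \<tau> - h"
    have h: "0 < h" "h \<le> \<tau>" "h < \<tau> - t" using \<epsilon> B t by (auto simp: h_def)
    have s: "t \<le> s" "s \<le> \<tau>" "0 \<le> s" using h t by (auto simp: s_def)
    obtain z where z: "z t = z0" "\<And>T. primitive_on t T (\<lambda>s. f (z s) (u s)) z"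
      "\<And>s. (\<lambda>s. r (z s) (u s)) integrable_on {t..s}"
      "\<And>s. t \<le> s \<Longrightarrow> steer z0 (z s) (integral {t..s} (\<lambda>s. r (z s) (u s)))"
      "\<And>s. t \<le> s \<Longrightarrow> s \<le> \<tau> \<Longrightarrow> norm (z s - y s) \<le> norm (z0 - y t) * exp (L * \<tau>)"
      by (rule parallel_trajectory[OF t(1) less_imp_le[OF t(2)]]) blast
    define R where "R = integral {t..s} (\<lambda>s. r (z s) (u s))"
    have gap: "norm (z s - y s) \<le> A * \<epsilon>"
      using order_trans[OF z(5)[OF s(1,2)] mult_right_mono[OF zc(2)]] by (simp add: A_def mult_ac)
    have near: "norm (z s - xs) \<le> M * \<epsilon>"
      using norm_triangle_ineq[of "z s - y s" "y s - xs"] gap yh[of h] h by (simp add: s_def h_def M_def algebra_simps)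
    have "\<xi> \<bullet> (z s - xs) \<le> 0"
    proof -
      have "\<xi> \<bullet> (z s - y s) \<le> norm \<xi> * (A * \<epsilon>)" by (rule inner_le_norm_bounds[OF order_refl gap])
      moreover have "c0 / 2 * h = norm \<xi> * (A * \<epsilon>) + \<epsilon>" using c0 by (simp add: h_def B_def field_simps)
      moreover have "c0 / 2 * h \<le> \<xi> \<bullet> (xs - y s)"
        unfolding s_def using transversal[of h] h \<epsilon> by (simp add: h_def mult.assoc)
      moreover have "\<xi> \<bullet> (z s - xs) = \<xi> \<bullet> (z s - y s) - \<xi> \<bullet> (xs - y s)" by (simp add: inner_diff_right)
      ultimately show ?thesis using \<epsilon> by linarith
    qed
    then have "\<xi> \<bullet> (z s - xs) \<le> \<sigma> * (norm (z s - xs))\<^sup>2" using \<sigma> by (meson order_trans mult_nonneg_nonneg zero_le_power2)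
    then obtain Q d where Q: "steer (z s) Q d" "Q \<in> S" "Q \<in> \<N>"
      "d + g Q \<le> g xs + (q - \<xi>) \<bullet> (z s - xs) + \<eta> / (4 * M) * norm (z s - xs)"
      using \<delta>T(2)[of "z s"] near \<epsilon> by auto
    have "steer x Q (c + R + d)"
      unfolding R_def by (rule steer_trans[OF steer_trans[OF zc(1) z(4)[OF s(1)]] Q(1)])
    then have "cost 0 \<tau> + g xs \<le> c + R + d + g Q" using optimality[OF _ Q(2,3)] by (simp add: cost_def)
    moreover have "cost 0 \<tau> = cost 0 t + cost t s + cost s \<tau>"
      using cost_combine[of 0 t \<tau>] cost_combine[of t s \<tau>] s t by simp
    moreover have "\<eta> / (4 * M) * norm (z s - xs) \<le> \<eta> / 4 * \<epsilon>"
      using mult_left_mono[OF near, of "\<eta> / (4 * M)"] M \<open>\<eta> > 0\<close> by (simp add: field_simps)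
    \<comment> \<open>Split at \<open>y s\<close>: the displacement \<open>z s - y s\<close> goes to
      the adjoint estimate, and \<open>xs - y s\<close> is balanced against
      \<open>cost s \<tau>\<close>.\<close>
    moreover have "(q - \<xi>) \<bullet> (z s - xs) = p \<tau> \<bullet> (z s - y s) - (q - \<xi>) \<bullet> (xs - y s)"
      by (simp add: p\<tau> inner_diff_right)
    moreover have "- ((norm (q - \<xi>) + 1) * L * N * h\<^sup>2) \<le> (q - \<xi>) \<bullet> (xs - y s) + cost s \<tau>"
      using terminal_increment_ge[of h 1 "q - \<xi>"] h max by (fastforce simp: s_def)
    moreover have "p \<tau> \<bullet> (z s - y s) \<le> p s \<bullet> (z s - y s) + \<eta> / 4 * \<epsilon>"
    proof -
      have "norm (p \<tau> - p s) \<le> \<eta> / (4 * A)"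
        using \<delta>p(2)[of h] h \<epsilon> by (simp add: s_def h_def norm_minus_commute)
      then have "(p \<tau> - p s) \<bullet> (z s - y s) \<le> \<eta> / (4 * A) * (A * \<epsilon>)"
        using gap by (rule inner_le_norm_bounds)
      also have "\<dots> = \<eta> / 4 * \<epsilon>" using A by simp
      finally show ?thesis by (simp add: inner_diff_left)
    qed
    moreover have "p s \<bullet> (z s - y s) + (R - cost t s) \<le> p t \<bullet> (z0 - y t) + C * (K * \<epsilon>)\<^sup>2"
    proof -
      have "p s \<bullet> (z s - y s) + (R - cost t s) \<le> p t \<bullet> (z0 - y t) + C * (norm (z0 - y t))\<^sup>2"
        using C(2)[OF t(1) s(1,2) z(2,3)] z(1) by (simp add: R_def)
      moreover have "C * (norm (z0 - y t))\<^sup>2 \<le> C * (K * \<epsilon>)\<^sup>2"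
        using zc(2) C(1) by (intro mult_left_mono power_mono) auto
      ultimately show ?thesis by linarith
    qed
    moreover have "(norm (q - \<xi>) + 1) * L * N * h\<^sup>2 + C * (K * \<epsilon>)\<^sup>2 \<le> \<eta> / 4 * \<epsilon>"
    proof -
      have "(norm (q - \<xi>) + 1) * L * N * h\<^sup>2 + C * (K * \<epsilon>)\<^sup>2 = D * \<epsilon> * \<epsilon>"
        by (simp add: D_def h_def power2_eq_square algebra_simps)
      also have "\<dots> \<le> \<eta> / 4 * \<epsilon>" using \<epsilon> by (intro mult_right_mono) auto
      finally show ?thesis .
    qed
    moreover have "0 \<le> \<eta> * \<epsilon>" using \<epsilon> \<open>\<eta> > 0\<close> by simp
    ultimately show "- \<eta> * \<epsilon> \<le> 1 * (c - cost 0 t) + p t \<bullet> (z0 - y t)" using Q(4) by simp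
  qed
qed

text \<open>A decrease of \<open>p t \<bullet> (z - y t)\<close> by more than
  \<open>\<eta> * \<epsilon>\<close> moves the later point \<open>z s\<close> by
  \<open>3 / 4 * (\<eta> * \<epsilon>)\<close> in direction \<open>\<xi>\<close>. At
  \<open>s = \<tau> - h\<close> with \<open>h\<^sup>2\<close> a small multiple of
  \<open>\<epsilon>\<close>, tangency and curvature consume less than that, so \<open>z s\<close> is
  in \<open>S\<close>. The saving \<open>c0 * h\<close> then contradicts optimality.\<close>

theorem extremal_abnormal:
  assumes \<sigma>: "\<sigma> \<ge> 0"
    and normal: "\<And>P. P \<in> closure (- S) \<Longrightarrow> \<xi> \<bullet> (P - xs) \<le> \<sigma> * (norm (P - xs))\<^sup>2"
    and max: "\<And>\<omega>. \<omega> \<in> U \<Longrightarrow> \<xi> \<bullet> f xs \<omega> \<le> 0"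
    and p: "caratheodory_solution {0..\<tau>} (\<lambda>t z. - (transpose (Df (y t) (u t)) *v z)) p"
    and p\<tau>: "p \<tau> = - \<xi>"
  shows "extremal 0 p"
  unfolding extremal_def
proof (intro allI impI)
  fix t K \<eta> :: real assume t: "0 \<le> t" "t < \<tau>" and "K > 0" "\<eta> > 0"
  define c0 where "c0 = r\<^sub>0 - G * N"
  have c0: "c0 > 0" using GN_less by (simp add: c0_def)
  define A where "A = K * exp (L * \<tau>)"
  have A: "A > 0" using \<open>K > 0\<close> by (simp add: A_def)
  obtain C where C: "C \<ge> 0"
    "\<And>a s z. 0 \<le> a \<Longrightarrow> a \<le> s \<Longrightarrow> s \<le> \<tau> \<Longrightarrow> primitive_on a s (\<lambda>t. f (z t) (u t)) z \<Longrightarrow>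
       (\<lambda>t. r (z t) (u t)) integrable_on {a..s} \<Longrightarrow>
       p s \<bullet> (z s - y s) + 0 * (integral {a..s} (\<lambda>t. r (z t) (u t)) - cost a s)
         \<le> p a \<bullet> (z a - y a) + C * (norm (z a - y a))\<^sup>2"
    using adjoint_estimate[of 0 p] p by auto
  \<comment> \<open>Coefficient of \<open>h\<^sup>2\<close>: the first term is the defect of
    tangency, the second the proximal curvature with \<open>norm (y s - xs) \<le> N * h\<close>,
    doubled by squaring a sum. \<open>\<kappa>\<close> makes the total
    \<open>\<eta> / 4 * \<epsilon>\<close>.\<close>
  define H where "H = (norm \<xi> + 1) * L * N + 2 * \<sigma> * N\<^sup>2"
  have H: "H > 0"
    unfolding H_def using L_pos N_pos \<sigma> by (intro add_pos_nonneg mult_pos_pos add_nonneg_pos) auto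
  define \<kappa> where "\<kappa> = sqrt (\<eta> / (4 * H))"
  have \<kappa>: "\<kappa> > 0" "H * \<kappa>\<^sup>2 = \<eta> / 4" using \<open>\<eta> > 0\<close> H by (auto simp: \<kappa>_def)
  obtain \<rho> where \<rho>: "\<rho> > 0" "\<And>P. norm (P - xs) < \<rho> \<Longrightarrow> P \<in> \<N>" using near_xs by blast
  obtain \<delta>p where \<delta>p: "\<delta>p > 0" "\<And>h. 0 \<le> h \<Longrightarrow> h < \<delta>p \<Longrightarrow> h \<le> \<tau> \<Longrightarrow> norm (p (\<tau> - h) - p \<tau>) \<le> \<eta> / (8 * A)"
    using left_limit_estimate[OF adjoint_continuous[OF p] \<tau>_pos order_refl, of "\<eta> / (8 * A)"] \<open>\<eta> > 0\<close> A
    by (metis divide_pos_pos mult_pos_pos zero_less_numeral)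
  \<comment> \<open>All losses of order \<open>\<epsilon>\<close>: cost of the perturbation, change
    of the running cost along the parallel trajectory, change of the terminal cost due to the
    displacement. The part \<open>G * N * h\<close> of the latter is already subtracted in
    \<open>c0\<close>.\<close>
  define B where "B = K + \<tau> * L * A + G * A"
  have "\<forall>\<^sub>F \<epsilon> in at_right 0. \<epsilon> > 0 \<and> \<kappa> * sqrt \<epsilon> < \<tau> - t \<and> \<kappa> * sqrt \<epsilon> < \<delta>p \<and> A * \<epsilon> < \<rho> / 2 \<and> (N * \<kappa>) * sqrt \<epsilon> < \<rho> / 2 \<and>
      (C * K\<^sup>2) * \<epsilon> < \<eta> / 8 \<and> (2 * \<sigma> * A\<^sup>2) * \<epsilon> < \<eta> / 4 \<and> B * sqrt \<epsilon> < c0 * \<kappa>"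
    using t(2) \<rho>(1) \<delta>p(1) \<open>\<eta> > 0\<close> c0 \<kappa>(1)
    by (intro eventually_conj eventually_mult_small eventually_mult_sqrt_small eventually_at_right_less) auto
  then show "\<forall>\<^sub>F \<epsilon> in at_right 0. \<forall>z c. steer x z c \<longrightarrow> norm (z - y t) \<le> K * \<epsilon> \<longrightarrow> \<bar>c - cost 0 t\<bar> \<le> K * \<epsilon> \<longrightarrow>
        - \<eta> * \<epsilon> \<le> 0 * (c - cost 0 t) + p t \<bullet> (z - y t)"
  proof (rule eventually_mono, intro allI impI)
    fix \<epsilon> z0 c
    assume \<epsilon>: "\<epsilon> > 0 \<and> \<kappa> * sqrt \<epsilon> < \<tau> - t \<and> \<kappa> * sqrt \<epsilon> < \<delta>p \<and> A * \<epsilon> < \<rho> / 2 \<and> (N * \<kappa>) * sqrt \<epsilon> < \<rho> / 2 \<and>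
      (C * K\<^sup>2) * \<epsilon> < \<eta> / 8 \<and> (2 * \<sigma> * A\<^sup>2) * \<epsilon> < \<eta> / 4 \<and> B * sqrt \<epsilon> < c0 * \<kappa>"
      and zc: "steer x z0 c" "norm (z0 - y t) \<le> K * \<epsilon>" "\<bar>c - cost 0 t\<bar> \<le> K * \<epsilon>"
    show "- \<eta> * \<epsilon> \<le> 0 * (c - cost 0 t) + p t \<bullet> (z0 - y t)"
    proof (rule ccontr)
      assume "\<not> ?thesis"
      then have neg: "p t \<bullet> (z0 - y t) < - (\<eta> * \<epsilon>)" by simp
      define h where "h = \<kappa> * sqrt \<epsilon>"
      define s where "s = \<tau> - h"
      have h: "0 < h" "h < \<tau> - t" "h \<le> \<tau>" "h < \<delta>p" using \<epsilon> \<kappa> t by (auto simp: h_def)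
      have s: "t \<le> s" "s \<le> \<tau>" "0 \<le> s" using h t by (auto simp: s_def)
      have h2: "h\<^sup>2 = \<kappa>\<^sup>2 * \<epsilon>" using \<epsilon> by (simp add: h_def power_mult_distrib)
      obtain z where z: "z t = z0" "\<And>T. primitive_on t T (\<lambda>s. f (z s) (u s)) z"
        "\<And>s. (\<lambda>s. r (z s) (u s)) integrable_on {t..s}"
        "\<And>s. t \<le> s \<Longrightarrow> steer z0 (z s) (integral {t..s} (\<lambda>s. r (z s) (u s)))"
        "\<And>s. t \<le> s \<Longrightarrow> s \<le> \<tau> \<Longrightarrow> norm (z s - y s) \<le> norm (z0 - y t) * exp (L * \<tau>)"
        by (rule parallel_trajectory[OF t(1) less_imp_le[OF t(2)]]) blast
      have gap: "norm (z s' - y s') \<le> A * \<epsilon>" if "t \<le> s'" "s' \<le> \<tau>" for s'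
        using order_trans[OF z(5)[OF that] mult_right_mono[OF zc(2)]] by (simp add: A_def mult_ac)
      have yh: "norm (y s - xs) \<le> N * h"
        using y_lipschitz[of \<tau> s] s h \<tau>_pos by (simp add: xs s_def)
      have near: "norm (z s - xs) \<le> A * \<epsilon> + N * h"
        using norm_triangle_ineq[of "z s - y s" "y s - xs"] gap[OF s(1,2)] yh by simp
      have "p s \<bullet> (z s - y s) \<le> p t \<bullet> (z0 - y t) + C * (K * \<epsilon>)\<^sup>2"
      proof -
        have "p s \<bullet> (z s - y s) \<le> p t \<bullet> (z0 - y t) + C * (norm (z0 - y t))\<^sup>2"
          using C(2)[OF t(1) s(1,2) z(2,3)] z(1) by simp
        moreover have "C * (norm (z0 - y t))\<^sup>2 \<le> C * (K * \<epsilon>)\<^sup>2"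
          using zc(2) C(1) by (intro mult_left_mono power_mono) auto
        ultimately show ?thesis by linarith
      qed
      moreover have "C * (K * \<epsilon>)\<^sup>2 \<le> \<eta> / 8 * \<epsilon>"
      proof -
        have "C * (K * \<epsilon>)\<^sup>2 = (C * K\<^sup>2) * \<epsilon> * \<epsilon>" by (simp add: power2_eq_square)
        also have "\<dots> \<le> \<eta> / 8 * \<epsilon>" using \<epsilon> by (intro mult_right_mono) auto
        finally show ?thesis .
      qed
      moreover have "p \<tau> \<bullet> (z s - y s) \<le> p s \<bullet> (z s - y s) + \<eta> / 8 * \<epsilon>"
      proof -
        have "norm (p \<tau> - p s) \<le> \<eta> / (8 * A)"
          using \<delta>p(2)[of h] h by (simp add: s_def norm_minus_commute)
        then have "(p \<tau> - p s) \<bullet> (z s - y s) \<le> \<eta> / (8 * A) * (A * \<epsilon>)"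
          using gap[OF s(1,2)] by (rule inner_le_norm_bounds)
        also have "\<dots> = \<eta> / 8 * \<epsilon>" using A by simp
        finally show ?thesis by (simp add: inner_diff_left)
      qed
      \<comment> \<open>Each of the two transports, from \<open>p t\<close> to \<open>p s\<close>
        and from \<open>p s\<close> to \<open>p \<tau>\<close>, consumes an eighth of
        \<open>\<eta> * \<epsilon>\<close>.\<close>
      ultimately have deep: "3 / 4 * (\<eta> * \<epsilon>) \<le> \<xi> \<bullet> (z s - y s)"
        using neg by (simp add: p\<tau>)
      have tangent: "\<xi> \<bullet> (xs - y s) \<le> (norm \<xi> + 1) * L * N * h\<^sup>2"
        using terminal_increment_ge[of h 0 "- \<xi>"] h max by (simp add: s_def)
      have sq: "\<sigma> * (norm (z s - xs))\<^sup>2 \<le> (2 * \<sigma> * A\<^sup>2) * \<epsilon> * \<epsilon> + 2 * \<sigma> * N\<^sup>2 * h\<^sup>2"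
      proof -
        have "(norm (z s - xs))\<^sup>2 \<le> (A * \<epsilon> + N * h)\<^sup>2" using near by (intro power_mono) auto
        also have "\<dots> \<le> 2 * (A * \<epsilon>)\<^sup>2 + 2 * (N * h)\<^sup>2"
          using sum_squares_bound[of "A * \<epsilon>" "N * h"] by (simp add: power2_sum)
        finally show ?thesis
          using mult_left_mono[of "(norm (z s - xs))\<^sup>2" "2 * (A * \<epsilon>)\<^sup>2 + 2 * (N * h)\<^sup>2" \<sigma>] \<sigma>
          by (simp add: power_mult_distrib power2_eq_square algebra_simps)
      qed
      have "\<sigma> * (norm (z s - xs))\<^sup>2 < \<xi> \<bullet> (z s - xs)"
      proof -
        have "(2 * \<sigma> * A\<^sup>2) * \<epsilon> * \<epsilon> \<le> \<eta> / 4 * \<epsilon>" using \<epsilon> by (intro mult_right_mono) auto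
        moreover have "(norm \<xi> + 1) * L * N * h\<^sup>2 + 2 * \<sigma> * N\<^sup>2 * h\<^sup>2 = \<eta> / 4 * \<epsilon>"
        proof -
          have "(norm \<xi> + 1) * L * N * h\<^sup>2 + 2 * \<sigma> * N\<^sup>2 * h\<^sup>2 = H * \<kappa>\<^sup>2 * \<epsilon>"
            unfolding h2 H_def by (simp add: algebra_simps)
          then show ?thesis unfolding \<kappa>(2) .
        qed
        moreover have "\<xi> \<bullet> (z s - xs) = \<xi> \<bullet> (z s - y s) - \<xi> \<bullet> (xs - y s)" by (simp add: inner_diff_right)
        moreover have "0 < \<eta> * \<epsilon>" using \<epsilon> \<open>\<eta> > 0\<close> by simp
        ultimately show ?thesis using deep tangent sq by simp
      qed
      then have zS: "z s \<in> S" using normal by (rule normal_mem_S[rotated])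
      have zN: "z s \<in> \<N>"
        using near \<epsilon> by (intro \<rho>(2)) (simp add: h_def mult.assoc)
      have "cost 0 \<tau> + g xs \<le> c + integral {t..s} (\<lambda>s. r (z s) (u s)) + g (z s)"
        using optimality[OF steer_trans[OF zc(1) z(4)[OF s(1)]] zS zN] by (simp add: cost_def)
      moreover have "cost 0 \<tau> = cost 0 t + cost t s + cost s \<tau>"
        using cost_combine[of 0 t \<tau>] cost_combine[of t s \<tau>] s t by simp
      moreover have "integral {t..s} (\<lambda>s. r (z s) (u s)) \<le> cost t s + \<tau> * L * A * \<epsilon>"
      proof -
        have "integral {t..s} (\<lambda>s. r (z s) (u s)) \<le> integral {t..s} (\<lambda>s. r (y s) (u s) + L * (A * \<epsilon>))"
        proof (rule integral_le[OF z(3)])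
          show "(\<lambda>s. r (y s) (u s) + L * (A * \<epsilon>)) integrable_on {t..s}"
            using r_integrable[OF t(1)] by (intro integrable_add) auto
          fix s' assume s': "s' \<in> {t..s}"
          have "L * norm (z s' - y s') \<le> L * (A * \<epsilon>)" using gap[of s'] s' s L_pos by auto
          then show "r (z s') (u s') \<le> r (y s') (u s') + L * (A * \<epsilon>)"
            using r_lipschitz[OF u_mem, of s' "z s'" "y s'"] s' t by auto
        qed
        also have "\<dots> = cost t s + (s - t) * (L * (A * \<epsilon>))"
          unfolding cost_def using r_integrable[OF t(1)] s by (subst Henstock_Kurzweil_Integration.integral_add) auto
        also have "(s - t) * (L * (A * \<epsilon>)) \<le> \<tau> * (L * (A * \<epsilon>))"
          using s t L_pos A \<epsilon> by (intro mult_right_mono) auto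
        finally show ?thesis by (simp add: mult.assoc)
      qed
      moreover have "g (z s) \<le> g xs + G * (A * \<epsilon> + N * h)"
        using g_lipschitz[OF xs_mem(2) zN] mult_left_mono[OF near G_nonneg] by linarith
      moreover have "r\<^sub>0 * h \<le> cost s \<tau>" using cost_ge[of s \<tau>] s by (simp add: s_def)
      ultimately have "c0 * h \<le> B * \<epsilon>"
        using zc(3) by (simp add: c0_def B_def algebra_simps abs_le_iff)
      \<comment> \<open>After division by \<open>sqrt \<epsilon>\<close> the losses still vanish
        with \<open>\<epsilon>\<close>, whereas the saving is the constant
        \<open>c0 * \<kappa>\<close>.\<close>
      moreover have "B * \<epsilon> = B * sqrt \<epsilon> * sqrt \<epsilon>" using \<epsilon> by (simp add: mult.assoc)
      moreover have "B * sqrt \<epsilon> * sqrt \<epsilon> < c0 * \<kappa> * sqrt \<epsilon>" using \<epsilon> by (intro mult_strict_right_mono) auto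
      ultimately show False by (simp add: h_def mult.assoc)
    qed
  qed
qed

end

section \<open>From extremality to the maximum principle\<close>

context optimal_exit begin

text \<open>Insertion: from \<open>y t\<close> the constant control \<open>\<omega>\<close> runs for
  time \<open>\<epsilon>\<close>, with displacement
  \<open>\<epsilon> *\<^sub>R f (y t) \<omega>\<close> and extra cost
  \<open>\<epsilon> * r (y t) \<omega>\<close> to first order. Dividing the extremality inequality
  by \<open>\<epsilon>\<close> gives the claim at each single \<open>t\<close>.\<close>

lemma extremal_nonneg:
  assumes E: "extremal l p" and l: "0 \<le> l" "l \<le> 1" and t: "0 \<le> t" "t < \<tau>" and \<omega>: "\<omega> \<in> U"
  shows "0 \<le> p t \<bullet> f (y t) \<omega> + l * r (y t) \<omega>"
proof (rule field_le_epsilon)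
  fix \<eta> :: real assume "\<eta> > 0"
  \<comment> \<open>Bounds displacement and extra cost together, the quadratic errors being at most
    \<open>L * N * \<epsilon>\<close> for \<open>\<epsilon> < 1\<close>.\<close>
  define K where "K = N + \<bar>r (y t) \<omega>\<bar> + L * N"
  have LN: "L * N > 0" using L_pos N_pos by simp
  have K: "K > 0" using LN N_pos by (simp add: K_def)
  have "\<forall>\<^sub>F \<epsilon> in at_right 0. (\<forall>z c. steer x z c \<longrightarrow> norm (z - y t) \<le> K * \<epsilon> \<longrightarrow> \<bar>c - cost 0 t\<bar> \<le> K * \<epsilon> \<longrightarrow>
        - (\<eta> / 2) * \<epsilon> \<le> l * (c - cost 0 t) + p t \<bullet> (z - y t)) \<and>
      \<epsilon> > 0 \<and> 1 * \<epsilon> < 1 \<and> ((1 + norm (p t)) * (L * N)) * \<epsilon> < \<eta> / 2"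
    using E[unfolded extremal_def, rule_format, OF t K, of "\<eta> / 2"] \<open>\<eta> > 0\<close>
    by (intro eventually_conj eventually_mult_small eventually_at_right_less) auto
  then obtain \<epsilon> where ex: "\<And>z c. steer x z c \<Longrightarrow> norm (z - y t) \<le> K * \<epsilon> \<Longrightarrow> \<bar>c - cost 0 t\<bar> \<le> K * \<epsilon> \<Longrightarrow>
        - (\<eta> / 2) * \<epsilon> \<le> l * (c - cost 0 t) + p t \<bullet> (z - y t)"
      and \<epsilon>: "\<epsilon> > 0" "\<epsilon> < 1" "((1 + norm (p t)) * (L * N)) * \<epsilon> < \<eta> / 2"
    using eventually_happens'[OF trivial_limit_at_right_real] by fastforce
  obtain Q c where Qc: "steer (y t) Q c" "norm (Q - y t - \<epsilon> *\<^sub>R f (y t) \<omega>) \<le> L * N * \<epsilon>\<^sup>2"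
    "\<bar>c - \<epsilon> * r (y t) \<omega>\<bar> \<le> L * N * \<epsilon>\<^sup>2"
    using steer_const[OF \<omega>, of \<epsilon>] \<epsilon>(1) by (metis less_imp_le)
  have ee: "L * N * \<epsilon>\<^sup>2 \<le> L * N * \<epsilon>" using \<epsilon> LN by (intro mult_left_mono) (auto simp: power2_eq_square mult_left_le)
  have "norm (Q - y t) \<le> K * \<epsilon>"
  proof -
    have "norm (\<epsilon> *\<^sub>R f (y t) \<omega>) \<le> N * \<epsilon>" using f_bound[OF \<omega>, of "y t"] \<epsilon>(1) by (simp add: mult.commute)
    moreover have "0 \<le> \<bar>r (y t) \<omega>\<bar> * \<epsilon>" using \<epsilon>(1) by simp
    ultimately show ?thesis
      using norm_triangle_ineq[of "Q - y t - \<epsilon> *\<^sub>R f (y t) \<omega>" "\<epsilon> *\<^sub>R f (y t) \<omega>"] Qc(2) ee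
      by (simp add: K_def algebra_simps)
  qed
  moreover have "\<bar>cost 0 t + c - cost 0 t\<bar> \<le> K * \<epsilon>"
  proof -
    have "\<bar>\<epsilon> * r (y t) \<omega>\<bar> = \<bar>r (y t) \<omega>\<bar> * \<epsilon>" using \<epsilon>(1) by (simp add: abs_mult)
    moreover have "0 \<le> N * \<epsilon>" using \<epsilon>(1) N_pos by simp
    ultimately show ?thesis using Qc(3) ee by (simp add: K_def algebra_simps)
  qed
  ultimately have "- (\<eta> / 2) * \<epsilon> \<le> l * c + p t \<bullet> (Q - y t)"
    using ex[OF steer_trans[OF steer_y[OF t(1)] Qc(1)]] by simp
  also have "l * c \<le> l * (\<epsilon> * r (y t) \<omega>) + L * N * \<epsilon>\<^sup>2"
  proof -
    have "l * (c - \<epsilon> * r (y t) \<omega>) \<le> l * (L * N * \<epsilon>\<^sup>2)" using Qc(3) l by (intro mult_left_mono) auto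
    also have "\<dots> \<le> 1 * (L * N * \<epsilon>\<^sup>2)" using l LN by (intro mult_right_mono) auto
    finally show ?thesis by (simp add: algebra_simps)
  qed
  also have "p t \<bullet> (Q - y t) \<le> \<epsilon> * (p t \<bullet> f (y t) \<omega>) + norm (p t) * (L * N * \<epsilon>\<^sup>2)"
    using inner_le_norm_bounds[OF order_refl Qc(2), of "p t"] by (simp add: inner_diff_right)
  finally have "- (\<eta> / 2) * \<epsilon> \<le> \<epsilon> * (p t \<bullet> f (y t) \<omega> + l * r (y t) \<omega>) + ((1 + norm (p t)) * (L * N)) * \<epsilon> * \<epsilon>"
    by (simp add: algebra_simps power2_eq_square)
  also have "((1 + norm (p t)) * (L * N)) * \<epsilon> * \<epsilon> \<le> \<eta> / 2 * \<epsilon>"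
    using \<epsilon> by (intro mult_right_mono) auto
  finally have "\<epsilon> * 0 \<le> \<epsilon> * (p t \<bullet> f (y t) \<omega> + l * r (y t) \<omega> + \<eta>)" by (simp add: algebra_simps)
  then show "0 \<le> p t \<bullet> f (y t) \<omega> + l * r (y t) \<omega> + \<eta>"
    using \<epsilon>(1) by (simp only: mult_le_cancel_left_pos)
qed

text \<open>Deletion: \<open>y (t - \<epsilon>)\<close> is itself a point close to
  \<open>y t\<close>, reached at the smaller cost \<open>cost 0 (t - \<epsilon>)\<close>.
  Extremality then bounds the integral of \<open>H\<close> over the deleted interval from above;
  since \<open>H \<ge> 0\<close> before \<open>\<tau>\<close> by insertion, the integral vanishes
  and so does \<open>H\<close> almost everywhere.\<close>

theorem extremal_maximum_principle:
  assumes E: "extremal l p" and l: "0 \<le> l" "l \<le> 1" and p: "continuous_on {0..\<tau>} p"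
  shows "AE t in lebesgue_on {0..\<tau>}.
    (\<forall>\<omega>\<in>U. 0 \<le> p t \<bullet> f (y t) \<omega> + l * r (y t) \<omega>) \<and> p t \<bullet> f (y t) (u t) + l * r (y t) (u t) = 0"
proof -
  define H where "H t = p t \<bullet> f (y t) (u t) + l * r (y t) (u t)" for t
  have "bounded (p ` {0..\<tau>})" using p by (intro compact_imp_bounded compact_continuous_image) auto
  then obtain B where B: "B > 0" "\<And>t. t \<in> {0..\<tau>} \<Longrightarrow> norm (p t) \<le> B"
    unfolding bounded_pos by auto
  obtain R where R: "R > 0" "\<And>s \<omega>. s \<in> {0..\<tau>} \<Longrightarrow> \<omega> \<in> U \<Longrightarrow> norm (r (y s) \<omega>) \<le> R"
    by (rule bounded_along[of 0 \<tau> y r]) (use continuous_on_subset[OF y_continuous] r_cont in auto)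
  have pf: "(\<lambda>t. p t \<bullet> f (y t) (u t)) integrable_on {0..\<tau>}"
  proof (rule measurable_bounded_by_integrable_imp_integrable)
    have "(\<lambda>t. f (y t) (u t)) \<in> borel_measurable (lebesgue_on {0..\<tau>})"
      by (rule measurable_restrict_mono[OF measurable_along[OF y_continuous u f_cont]]) auto
    then show "(\<lambda>t. p t \<bullet> f (y t) (u t)) \<in> borel_measurable (lebesgue_on {0..\<tau>})"
      using continuous_imp_measurable_on_sets_lebesgue[OF p] by (intro borel_measurable_inner) auto
    show "norm (p t \<bullet> f (y t) (u t)) \<le> B * N" if t: "t \<in> {0..\<tau>}" for t
    proof -
      have "norm (p t \<bullet> f (y t) (u t)) \<le> norm (p t) * norm (f (y t) (u t))"
        by (simp add: Cauchy_Schwarz_ineq2)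
      also have "\<dots> \<le> B * N" using B t f_bound[OF u_mem[of t], of "y t"] by (intro mult_mono) auto
      finally show ?thesis .
    qed
  qed auto
  have Hint: "H integrable_on {a..b}" if "0 \<le> a" "b \<le> \<tau>" for a b
    unfolding H_def
    by (intro integrable_add integrable_on_mult_right integrable_subinterval_real[OF pf] r_integrable)
      (use that in auto)
  define \<Psi> where "\<Psi> t = integral {0..t} H" for t
  have \<Psi>c: "continuous_on {0..\<tau>} \<Psi>"
    unfolding \<Psi>_def by (rule indefinite_integral_continuous_1) (rule Hint, auto)
  have H_nonneg: "0 \<le> H t" if "t \<in> {0..<\<tau>}" for t
    unfolding H_def using extremal_nonneg[OF E l _ _ u_mem, of t t] that by auto
  have slope: "\<forall>\<^sub>F \<epsilon> in at_right 0. \<Psi> t - \<Psi> (t - \<epsilon>) \<le> \<eta> * \<epsilon>" if t: "0 < t" "t < \<tau>" and "\<eta> > 0" for t \<eta>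
  proof -
    define K where "K = N + R"
    have K: "K > 0" using N_pos R by (simp add: K_def)
    obtain \<delta> where \<delta>: "\<delta> > 0" "\<And>h. 0 \<le> h \<Longrightarrow> h < \<delta> \<Longrightarrow> h \<le> t \<Longrightarrow> norm (p (t - h) - p t) \<le> \<eta> / (2 * N)"
      using left_limit_estimate[OF p t(1) less_imp_le[OF t(2)], of "\<eta> / (2 * N)"] \<open>\<eta> > 0\<close> N_pos
      by (metis divide_pos_pos mult_pos_pos zero_less_numeral)
    have "\<forall>\<^sub>F \<epsilon> in at_right 0. (\<forall>z c. steer x z c \<longrightarrow> norm (z - y t) \<le> K * \<epsilon> \<longrightarrow> \<bar>c - cost 0 t\<bar> \<le> K * \<epsilon> \<longrightarrow>
        - (\<eta> / 2) * \<epsilon> \<le> l * (c - cost 0 t) + p t \<bullet> (z - y t)) \<and> \<epsilon> > 0 \<and> 1 * \<epsilon> < t \<and> 1 * \<epsilon> < \<delta>"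
      using E[unfolded extremal_def, rule_format, OF less_imp_le[OF t(1)] t(2) K, of "\<eta> / 2"] \<open>\<eta> > 0\<close> t \<delta>(1)
      by (intro eventually_conj eventually_mult_small eventually_at_right_less) auto
    then show ?thesis
    proof (rule eventually_mono)
      fix \<epsilon>
      assume "(\<forall>z c. steer x z c \<longrightarrow> norm (z - y t) \<le> K * \<epsilon> \<longrightarrow> \<bar>c - cost 0 t\<bar> \<le> K * \<epsilon> \<longrightarrow>
        - (\<eta> / 2) * \<epsilon> \<le> l * (c - cost 0 t) + p t \<bullet> (z - y t)) \<and> \<epsilon> > 0 \<and> 1 * \<epsilon> < t \<and> 1 * \<epsilon> < \<delta>"
      then have ex: "\<And>z c. steer x z c \<Longrightarrow> norm (z - y t) \<le> K * \<epsilon> \<Longrightarrow> \<bar>c - cost 0 t\<bar> \<le> K * \<epsilon> \<Longrightarrow>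
          - (\<eta> / 2) * \<epsilon> \<le> l * (c - cost 0 t) + p t \<bullet> (z - y t)"
        and \<epsilon>: "\<epsilon> > 0" "\<epsilon> < t" "\<epsilon> < \<delta>"
        by auto
      define s where "s = t - \<epsilon>"
      have s: "0 \<le> s" "s \<le> t" "t - s = \<epsilon>" using \<epsilon> by (auto simp: s_def)
      have cs: "cost 0 t = cost 0 s + cost s t" using s by (intro cost_combine) auto
      have "cost s t \<le> R * \<epsilon>"
      proof -
        have "cost s t \<le> integral {s..t} (\<lambda>_. R)"
          unfolding cost_def
          by (rule integral_le[OF r_integrable[OF s(1)]])
            (use R(2) u_mem s t in \<open>auto simp: abs_le_iff intro!: order_trans[OF abs_ge_self]\<close>)
        then show ?thesis using s by (simp add: mult.commute)
      qed
      moreover have "0 \<le> cost s t" using cost_ge[OF s(1,2)] r\<^sub>0_pos s by (smt (verit) mult_nonneg_nonneg)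
      moreover have "0 \<le> N * \<epsilon>" "0 \<le> R * \<epsilon>" using N_pos R \<epsilon> by auto
      moreover have "norm (y s - y t) \<le> N * \<epsilon>" using y_lipschitz[of t s] s t by simp
      ultimately have "- (\<eta> / 2) * \<epsilon> \<le> l * (- cost s t) + p t \<bullet> (y s - y t)"
        using ex[OF steer_y[OF s(1)]] cs by (simp add: K_def algebra_simps)
      \<comment> \<open>Continuity of \<open>p\<close> lets \<open>p t\<close> replace
        \<open>p s'\<close> on the short interval, after which \<open>f\<close> integrates to the
        increment of \<open>y\<close>.\<close>
      moreover have "\<Psi> t - \<Psi> s \<le> p t \<bullet> (y t - y s) + l * cost s t + \<eta> / 2 * \<epsilon>"
      proof -
        have "integral {0..s} H + integral {s..t} H = integral {0..t} H"
          by (rule Henstock_Kurzweil_Integration.integral_combine) (use s t Hint in auto)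
        then have "integral {s..t} H = \<Psi> t - \<Psi> s" by (simp add: \<Psi>_def)
        then have "((\<lambda>s. H s) has_integral \<Psi> t - \<Psi> s) {s..t}"
          using integrable_integral[OF Hint, of s t] s t by simp
        moreover have "((\<lambda>s. p t \<bullet> f (y s) (u s)) has_integral p t \<bullet> (y t - y s)) {s..t}"
          using has_integral_linear[OF primitive_onD[OF y_primitive[OF s(1)] order_refl s(2) order_refl]
              bounded_linear_inner_right[of "p t"]] by (simp add: o_def)
        moreover have "((\<lambda>s. l * r (y s) (u s)) has_integral l * cost s t) {s..t}"
          unfolding cost_def by (intro has_integral_mult_right integrable_integral r_integrable s)
        moreover have "((\<lambda>s. \<eta> / 2) has_integral \<eta> / 2 * \<epsilon>) {s..t}"
          using has_integral_const_real[of "\<eta> / 2" s t] s by (simp add: mult.commute)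
        ultimately have I: "((\<lambda>s. H s) has_integral \<Psi> t - \<Psi> s) {s..t}"
          "((\<lambda>s. p t \<bullet> f (y s) (u s) + l * r (y s) (u s) + \<eta> / 2) has_integral
             p t \<bullet> (y t - y s) + l * cost s t + \<eta> / 2 * \<epsilon>) {s..t}"
          by (auto intro!: has_integral_add)
        show ?thesis
        proof (rule has_integral_le[OF I])
          fix s' assume s': "s' \<in> {s..t}"
          have "norm (p s' - p t) \<le> \<eta> / (2 * N)" using \<delta>(2)[of "t - s'"] s' s \<epsilon> by auto
          moreover have "norm (f (y s') (u s')) \<le> N" using s' s by (intro f_bound u_mem) auto
          ultimately have "(p s' - p t) \<bullet> f (y s') (u s') \<le> \<eta> / (2 * N) * N" by (rule inner_le_norm_bounds)
          then show "H s' \<le> p t \<bullet> f (y s') (u s') + l * r (y s') (u s') + \<eta> / 2"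
            using N_pos by (simp add: H_def inner_diff_left)
        qed
      qed
      moreover have "p t \<bullet> (y s - y t) = - (p t \<bullet> (y t - y s))" by (simp add: inner_diff_right)
      ultimately show "\<Psi> t - \<Psi> (t - \<epsilon>) \<le> \<eta> * \<epsilon>" by (simp add: s_def)
    qed
  qed
  have \<Psi>0: "\<Psi> T = 0" if "T \<in> {0..<\<tau>}" for T
  proof (rule antisym)
    have "\<Psi> T \<le> \<Psi> 0"
      by (rule le_if_left_slope_nonpos) (use that slope continuous_on_subset[OF \<Psi>c] in auto)
    then show "\<Psi> T \<le> 0" by (simp add: \<Psi>_def)
    show "0 \<le> \<Psi> T"
      unfolding \<Psi>_def by (rule integral_nonneg) (use Hint H_nonneg that in auto)
  qed
  \<comment> \<open>Extremality speaks of times before \<open>\<tau>\<close> only; the end point is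
    reached by continuity.\<close>
  have "\<Psi> \<tau> = 0"
    by (rule continuous_constant_on_closure[of "{0..<\<tau>}" \<Psi> 0 \<tau>]) (use \<Psi>c \<Psi>0 \<tau>_pos in auto)
  \<comment> \<open>The sign of \<open>H\<close> at \<open>\<tau>\<close> itself is unknown, so that
    one value is reset to 0.\<close>
  define H' where "H' t = (if t = \<tau> then 0 else H t)" for t
  have H'_nonneg: "0 \<le> H' t" if "t \<in> {0..\<tau>}" for t
    using H_nonneg[of t] that by (auto simp: H'_def)
  have "(H has_integral 0) {0..\<tau>}"
    using integrable_integral[OF Hint, of 0 \<tau>] \<open>\<Psi> \<tau> = 0\<close> by (simp add: \<Psi>_def)
  then have H'0: "(H' has_integral 0) {0..\<tau>}"
    by (rule has_integral_spike_finite[of "{\<tau>}", rotated -1]) (auto simp: H'_def)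
  then have H'a: "H' absolutely_integrable_on {0..\<tau>}"
    using H'_nonneg by (intro nonnegative_absolutely_integrable_1) auto
  have "(LINT t:{0..\<tau>}|lebesgue. H' t) = 0"
    using set_lebesgue_integral_eq_integral(2)[OF H'a] integral_unique[OF H'0] by simp
  then have "AE t in lebesgue. indicator {0..\<tau>} t *\<^sub>R H' t = 0"
    using H'a unfolding set_lebesgue_integral_def set_integrable_def
    by (subst (asm) integral_nonneg_eq_0_iff_AE) (use H'_nonneg in \<open>auto simp: indicator_def\<close>)
  moreover have "AE t in lebesgue. t \<noteq> \<tau>"
    unfolding eventually_ae_filter_negligible by (intro exI[of _ "{\<tau>}"]) auto
  ultimately have "AE t in lebesgue. t \<in> {0..\<tau>} \<longrightarrow>
    (\<forall>\<omega>\<in>U. 0 \<le> p t \<bullet> f (y t) \<omega> + l * r (y t) \<omega>) \<and> p t \<bullet> f (y t) (u t) + l * r (y t) (u t) = 0"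
  proof eventually_elim
    case (elim t)
    then show ?case
      using extremal_nonneg[OF E l, of t] by (auto simp: H'_def H_def)
  qed
  then show ?thesis by (subst AE_restrict_space_iff) auto
qed

end

section \<open>From the stated hypotheses to the locales, and from extremality to the
  Hamiltonians\<close>

theorem proposition4p1:
  fixes U :: "(real ^ 'm) set" and S :: "(real ^ 'd) set"
    and f :: "real ^ 'd \<Rightarrow> real ^ 'm \<Rightarrow> real ^ 'd"
    and Df :: "real ^ 'd \<Rightarrow> real ^ 'm \<Rightarrow> real ^ 'd ^ 'd"
    and r :: "real ^ 'd \<Rightarrow> real ^ 'm \<Rightarrow> real"
    and Dr :: "real ^ 'd \<Rightarrow> real ^ 'm \<Rightarrow> real ^ 'd"
    and g :: "real ^ 'd \<Rightarrow> real"
    and N L r\<^sub>0 \<tau> :: real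
    and x xs :: "real ^ 'd"
    and u :: "real \<Rightarrow> real ^ 'm" and y :: "real \<Rightarrow> real ^ 'd"
  assumes "U \<noteq> {}" and "compact U" and "S \<noteq> {}" and "closed S"
    and "N > 0" and "L > 0" and "r\<^sub>0 > 0"
    and dynamics: "dynamics_hyp U f Df N L"
    and running_cost: "running_cost_hyp U r Dr L r\<^sub>0"
    and terminal_cost: "terminal_cost_hyp S g N r\<^sub>0"
    and semiconcave: "locally_semiconcave g"
    and V_continuous: "continuous_on (reachable_set f U S) (value_function f r g U S)"
    and x: "x \<in> reachable_set f U S - S"
    and optimal: "optimal_pair f r g U S x u y"
    and \<tau>: "hitting_time S y = ereal \<tau>"
    and xs: "xs = y \<tau>" "xs \<in> frontier S"
  shows
    "(\<forall>q \<xi> p. q \<in> superdifferential g xs \<longrightarrow> \<xi> \<in> normals1 f U S xs \<longrightarrow>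
        hamiltonian f r U xs (q - \<xi>) = 0 \<longrightarrow>
        caratheodory_solution {0..\<tau>}
          (\<lambda>t z. - (transpose (Df (y t) (u t)) *v z) - Dr (y t) (u t)) p \<longrightarrow>
        p \<tau> = q - \<xi> \<longrightarrow>
        (AE t in lebesgue_on {0..\<tau>}.
           hamiltonian f r U (y t) (p t) = - (p t \<bullet> f (y t) (u t)) - r (y t) (u t) \<and>
           - (p t \<bullet> f (y t) (u t)) - r (y t) (u t) = 0)) \<and>
     (\<forall>\<xi> p. \<xi> \<in> normals0 f U S xs \<longrightarrow>
        caratheodory_solution {0..\<tau>} (\<lambda>t z. - (transpose (Df (y t) (u t)) *v z)) p \<longrightarrow>
        p \<tau> = - \<xi> \<longrightarrow>
        (AE t in lebesgue_on {0..\<tau>}.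
           hamiltonian0 f U (y t) (p t) = - (p t \<bullet> f (y t) (u t)) \<and>
           - (p t \<bullet> f (y t) (u t)) = 0))"
proof -
  obtain \<N> G where terminal: "frontier S \<subseteq> interior \<N>" "0 \<le> G" "G < r\<^sub>0 / N"
    "\<And>x y. x \<in> \<N> \<Longrightarrow> y \<in> \<N> \<Longrightarrow> \<bar>g y - g x\<bar> \<le> G * norm (y - x)"
    using terminal_cost unfolding terminal_cost_hyp_def by blast
  have f_cont: "continuous_on (UNIV \<times> U) (\<lambda>(x, \<omega>). f x \<omega>)"
    using dynamics by (simp add: dynamics_hyp_def)
  have r_cont: "continuous_on (UNIV \<times> U) (\<lambda>(x, \<omega>). r x \<omega>)"
    using running_cost by (simp add: running_cost_hyp_def)
  interpret exit_problem U f r N L Df Dr S \<N> g G r\<^sub>0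
  proof
    show "norm (f x \<omega>) \<le> N" if "\<omega> \<in> U" for x \<omega>
      using dynamics that unfolding dynamics_hyp_def by (meson less_imp_le)
    have rL: "\<bar>r y \<omega> - r x \<omega>\<bar> + norm (Dr y \<omega> - Dr x \<omega>) \<le> L * norm (y - x)" if "\<omega> \<in> U" for x y \<omega>
      using running_cost that by (simp add: running_cost_hyp_def)
    show "\<bar>r y \<omega> - r x \<omega>\<bar> \<le> L * norm (y - x)" if "\<omega> \<in> U" for x y \<omega>
      using rL[OF that, of y x] norm_ge_zero[of "Dr y \<omega> - Dr x \<omega>"] by linarith
    show "norm (Dr y \<omega> - Dr x \<omega>) \<le> L * norm (y - x)" if "\<omega> \<in> U" for x y \<omega>
      using rL[OF that, of y x] abs_ge_zero[of "r y \<omega> - r x \<omega>"] by linarith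
    show "G * N < r\<^sub>0" using terminal(3) \<open>N > 0\<close> by (simp add: pos_less_divide_eq)
  qed (use assms(1-7) dynamics running_cost terminal f_cont r_cont in
      \<open>auto simp: dynamics_hyp_def running_cost_hyp_def\<close>)
  have u: "admissible_control U u" and y: "solves x u y"
    and V: "ereal (total_cost r g S u y) = value_function f r g U S x"
    using optimal trajectory_iff_solves by (auto simp: optimal_pair_def)
  \<comment> \<open>A finite infimum excludes the empty set, whose infimum is
    \<open>\<infinity>\<close>; hence the hitting time is attained.\<close>
  have "{t. 0 \<le> t \<and> y t \<in> S} \<noteq> {}"
  proof
    assume "{t. 0 \<le> t \<and> y t \<in> S} = {}"
    then have "hitting_time S y = \<infinity>" unfolding hitting_time_def by (simp only:) (simp add: top_ereal_def)
    then show False using \<tau> by simp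
  qed
  then obtain T where "0 \<le> T" "y T \<in> S" by blast
  then obtain h where h: "0 \<le> h" "hitting_time S y = ereal h" "y h \<in> S" "\<And>s. 0 \<le> s \<Longrightarrow> s < h \<Longrightarrow> y s \<notin> S"
    using hitting_time_attained[OF solves_continuous[OF u y] S_closed] by metis
  have "h = \<tau>" using h(2) \<tau> by simp
  interpret optimal_exit U f r N L Df Dr S \<N> g G r\<^sub>0 x xs u y \<tau>
  proof
    show "\<tau> > 0"
      using h(1,3) y x \<open>h = \<tau>\<close> by (cases "\<tau> = 0") (auto simp: solves_def)
    show "integral {0..\<tau>} (\<lambda>s. r (y s) (u s)) + g xs \<le> c + g Q"
      if "steer x Q c" "Q \<in> S" "Q \<in> \<N>" for Q c
      using value_function_le_steer[OF that(1) _ that(2,3)] x V total_cost_eq[OF u y \<tau>] xs(1)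
      by (metis DiffD2 ereal_less_eq(3))
  qed (use u y xs h \<open>h = \<tau>\<close> in auto)
  have Sup0: "(SUP \<omega>\<in>U. \<phi> \<omega>) = \<phi> (u t)"
    if "\<forall>\<omega>\<in>U. \<phi> \<omega> \<le> \<phi> (u t)" "0 \<le> t" for \<phi> :: "real ^ 'm \<Rightarrow> real" and t
    by (rule cSup_eq_maximum) (use that u_mem in auto)
  have c: "continuous_on U (f z)" "continuous_on U (r z)" for z
  proof -
    have "continuous_on U (\<lambda>\<omega>. (z, \<omega>))" "(\<lambda>\<omega>. (z, \<omega>)) ` U \<subseteq> UNIV \<times> U"
      by (auto intro!: continuous_intros)
    from continuous_on_compose2[OF f_cont this] continuous_on_compose2[OF r_cont this]
    show "continuous_on U (f z)" "continuous_on U (r z)" by simp_all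
  qed
  \<comment> \<open>Compactness of \<open>U\<close> provides the maximizing value at
    \<open>xs\<close>, which becomes the constant terminal control in case (i), and makes the
    suprema genuine upper bounds.\<close>
  have attained: "(\<exists>\<omega>\<in>U. \<phi> \<omega> = (SUP \<omega>\<in>U. \<phi> \<omega>)) \<and> (\<forall>\<omega>\<in>U. \<phi> \<omega> \<le> (SUP \<omega>\<in>U. \<phi> \<omega>))"
    if \<phi>: "continuous_on U \<phi>" for \<phi> :: "real ^ 'm \<Rightarrow> real"
  proof -
    obtain \<omega> where "\<omega> \<in> U" "\<forall>\<omega>'\<in>U. \<phi> \<omega>' \<le> \<phi> \<omega>"
      using continuous_attains_sup[OF U_compact U_nonempty \<phi>] by blast
    moreover from this have "(SUP \<omega>\<in>U. \<phi> \<omega>) = \<phi> \<omega>" by (intro cSup_eq_maximum) auto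
    ultimately show ?thesis by auto
  qed
  show ?thesis
  proof (intro conjI allI impI)
    fix q \<xi> p
    assume q: "q \<in> superdifferential g xs" and \<xi>: "\<xi> \<in> normals1 f U S xs"
      and H: "hamiltonian f r U xs (q - \<xi>) = 0"
      and p: "caratheodory_solution {0..\<tau>}
          (\<lambda>t z. - (transpose (Df (y t) (u t)) *v z) - Dr (y t) (u t)) p" and p\<tau>: "p \<tau> = q - \<xi>"
    obtain \<sigma> where \<sigma>: "\<sigma> \<ge> 0"
      "\<And>P. P \<in> closure (- S) \<Longrightarrow> \<xi> \<bullet> (P - xs) \<le> \<sigma> * (norm (P - xs))\<^sup>2"
      using \<xi> by (auto simp: normals1_def proximal_normal_cone_def)
    have "continuous_on U (\<lambda>\<omega>. - ((q - \<xi>) \<bullet> f xs \<omega>) - r xs \<omega>)" by (intro continuous_intros c)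
    from attained[OF this] obtain \<omega> where \<omega>: "\<omega> \<in> U" "- ((q - \<xi>) \<bullet> f xs \<omega>) - r xs \<omega> = 0"
      and max: "\<And>\<omega>. \<omega> \<in> U \<Longrightarrow> - ((q - \<xi>) \<bullet> f xs \<omega>) - r xs \<omega> \<le> 0"
      using H by (auto simp: hamiltonian_def)
    have "extremal 1 p" by (rule extremal_normal[OF q \<sigma> \<omega> max p p\<tau>])
    from extremal_maximum_principle[OF this _ _ adjoint_continuous[OF p]]
    have "AE t in lebesgue_on {0..\<tau>}.
      (\<forall>\<omega>\<in>U. 0 \<le> p t \<bullet> f (y t) \<omega> + 1 * r (y t) \<omega>) \<and> p t \<bullet> f (y t) (u t) + 1 * r (y t) (u t) = 0" by simp
    with AE_space show "AE t in lebesgue_on {0..\<tau>}.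
           hamiltonian f r U (y t) (p t) = - (p t \<bullet> f (y t) (u t)) - r (y t) (u t) \<and>
           - (p t \<bullet> f (y t) (u t)) - r (y t) (u t) = 0"
    proof eventually_elim
      case (elim t)
      then have t: "0 \<le> t" by simp
      \<comment> \<open>Nonnegativity for all \<open>\<omega>\<close> together with value 0 at
        \<open>u t\<close> says that \<open>u t\<close> maximizes.\<close>
      from elim have "\<forall>\<omega>\<in>U. - (p t \<bullet> f (y t) \<omega>) - r (y t) \<omega> \<le> - (p t \<bullet> f (y t) (u t)) - r (y t) (u t)"
        by fastforce
      from Sup0[OF this t] show ?case using elim by (simp add: hamiltonian_def)
    qed
  next
    fix \<xi> p
    assume \<xi>: "\<xi> \<in> normals0 f U S xs"
      and p: "caratheodory_solution {0..\<tau>} (\<lambda>t z. - (transpose (Df (y t) (u t)) *v z)) p"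
      and p\<tau>: "p \<tau> = - \<xi>"
    obtain \<sigma> where \<sigma>: "\<sigma> \<ge> 0"
      "\<And>P. P \<in> closure (- S) \<Longrightarrow> \<xi> \<bullet> (P - xs) \<le> \<sigma> * (norm (P - xs))\<^sup>2"
      using \<xi> by (auto simp: normals0_def proximal_normal_cone_def)
    have "continuous_on U (\<lambda>\<omega>. \<xi> \<bullet> f xs \<omega>)" by (intro continuous_intros c)
    from attained[OF this] have max: "\<And>\<omega>. \<omega> \<in> U \<Longrightarrow> \<xi> \<bullet> f xs \<omega> \<le> 0"
      using \<xi> by (auto simp: normals0_def)
    have "extremal 0 p" by (rule extremal_abnormal[OF \<sigma> max p p\<tau>])
    from extremal_maximum_principle[OF this _ _ adjoint_continuous[OF p]]
    have "AE t in lebesgue_on {0..\<tau>}.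
      (\<forall>\<omega>\<in>U. 0 \<le> p t \<bullet> f (y t) \<omega> + 0 * r (y t) \<omega>) \<and> p t \<bullet> f (y t) (u t) + 0 * r (y t) (u t) = 0" by simp
    with AE_space show "AE t in lebesgue_on {0..\<tau>}.
           hamiltonian0 f U (y t) (p t) = - (p t \<bullet> f (y t) (u t)) \<and>
           - (p t \<bullet> f (y t) (u t)) = 0"
    proof eventually_elim
      case (elim t)
      then have t: "0 \<le> t" by simp
      from elim have "\<forall>\<omega>\<in>U. - (p t \<bullet> f (y t) \<omega>) \<le> - (p t \<bullet> f (y t) (u t))"
        by fastforce
      from Sup0[OF this t] show ?case using elim by (simp add: hamiltonian0_def)
    qed
  qed
qed

end
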